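(* Let $\Omega\subset\mathbb{R}^d$ be a bounded domain and let $\Omega'\subset\mathbb{R}^d$ be a bounded domain which tiles $\Omega$. (D) If the Dirichlet Pólya conjecture holds for $\Omega$, then it holds for $\Omega'$. (N) Suppose $\Omega$ and $\Omega'$ have Lipschitz boundaries. If the Neumann Pólya conjecture holds for $\Omega$, then it holds for $\Omega'$.
   Context: For a bounded domain $\Omega\subset\mathbb{R}^d$, let $0<\lambda_1(\Omega)\le\lambda_2(\Omega)\le\dots$ be the eigenvalues (with multiplicity) of the Dirichlet Laplacian $-\Delta$ on $\Omega$ and, when $\partial\Omega$ is Lipschitz, let $0=\mu_1(\Omega)\le\mu_2(\Omega)\le\dots$ be the eigenvalues (with multiplicity) of the Neumann Laplacian $-\Delta$ on $\Omega$. Put $\mathcal{N}^{\mathrm D}_\Omega(\lambda)=\#\{n:\lambda_n(\Omega)\le\lambda^2\}$ and $\mathcal{N}^{\mathrm N}_\Omega(\lambda)=\#\{n:\mu_n(\Omega)\le\lambda^2\}$. Let $C_d=\frac{1}{(4\pi)^{d/2}\Gamma(d/2+1)}$ and let $|\cdot|_d$ denote $d$-dimensional volume. The Dirichlet Pólya conjecture holds for $\Omega$ if $\mathcal{N}^{\mathrm D}_\Omega(\lambda)\le C_d|\Omega|_d\lambda^d$ for all $\lambda\ge0$; the Neumann Pólya conjecture holds for $\Omega$ if $\mathcal{N}^{\mathrm N}_\Omega(\lambda)\ge C_d|\Omega|_d\lambda^d$ for all $\lambda\ge0$. $\Omega'$ tiles $\Omega$ if $\Omega$ is, up to a set of measure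 zero, a disjoint union of (finitely many) congruent copies of $\Omega'$ contained in $\Omega$. *)

theory Defs
  imports "HOL-Analysis.Analysis" "HOL-Library.Extended_Nat"
begin

definition bounded_domain :: "'a::euclidean_space set \<Rightarrow> bool" where
  "bounded_domain \<Omega> \<longleftrightarrow> open \<Omega> \<and> connected \<Omega> \<and> \<Omega> \<noteq> {} \<and> bounded \<Omega>"

text \<open>Near every boundary point the set is the strict epigraph, in some unit direction \<open>e\<close>, of a
  Lipschitz function of the component \<open>x - (x \<bullet> e) *\<^sub>R e\<close> orthogonal to \<open>e\<close>.\<close>

definition lipschitz_boundary :: "'a::euclidean_space set \<Rightarrow> bool" where
  "lipschitz_boundary \<Omega> \<longleftrightarrow>
    (\<forall>p \<in> frontier \<Omega>. \<exists>r>0. \<exists>e L. \<exists>g :: 'a \<Rightarrow> real.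
       norm e = 1 \<and> L-lipschitz_on {y. y \<bullet> e = 0} g \<and>
       (\<forall>x \<in> ball p r. x \<in> \<Omega> \<longleftrightarrow> g (x - (x \<bullet> e) *\<^sub>R e) < x \<bullet> e))"

definition congruent_to :: "'a::euclidean_space set \<Rightarrow> 'a set \<Rightarrow> bool" where
  "congruent_to S T \<longleftrightarrow> (\<exists>a f. orthogonal_transformation f \<and> T = (\<lambda>x. a + f x) ` S)"

definition tiles :: "'a::euclidean_space set \<Rightarrow> 'a set \<Rightarrow> bool" where
  "tiles \<Omega>' \<Omega> \<longleftrightarrow>
    (\<exists>\<T>. finite \<T> \<and> disjoint \<T> \<and> (\<forall>T \<in> \<T>. congruent_to \<Omega>' T \<and> T \<subseteq> \<Omega>) \<and> negligible (\<Omega> - \<Union>\<T>))"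


section \<open>Sobolev spaces\<close>

primrec C_k :: "nat \<Rightarrow> ('a::euclidean_space \<Rightarrow> real) \<Rightarrow> bool" where
  "C_k 0 f \<longleftrightarrow> continuous_on UNIV f"
| "C_k (Suc k) f \<longleftrightarrow> (\<exists>f'. (\<forall>x. GDERIV f x :> f' x) \<and> (\<forall>b \<in> Basis. C_k k (\<lambda>x. f' x \<bullet> b)))"

definition test_function :: "'a::euclidean_space set \<Rightarrow> ('a \<Rightarrow> real) \<Rightarrow> bool" where
  "test_function \<Omega> \<phi> \<longleftrightarrow>
    (\<forall>k. C_k k \<phi>) \<and> compact (closure {x. \<phi> x \<noteq> 0}) \<and> closure {x. \<phi> x \<noteq> 0} \<subseteq> \<Omega>"

text \<open>Elements of \<open>L\<^sup>2(\<Omega>)\<close> are represented by functions on the whole space, of which only the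
  values on \<open>\<Omega>\<close>, up to null sets, matter.\<close>

definition square_integrable :: "'a::euclidean_space set \<Rightarrow> ('a \<Rightarrow> 'b::euclidean_space) \<Rightarrow> bool" where
  "square_integrable \<Omega> u \<longleftrightarrow>
    u \<in> borel_measurable (lebesgue_on \<Omega>) \<and> integrable (lebesgue_on \<Omega>) (\<lambda>x. (norm (u x))\<^sup>2)"

definition weak_gradient :: "'a::euclidean_space set \<Rightarrow> ('a \<Rightarrow> real) \<Rightarrow> ('a \<Rightarrow> 'a) \<Rightarrow> bool" where
  "weak_gradient \<Omega> u G \<longleftrightarrow>
    square_integrable \<Omega> u \<and> square_integrable \<Omega> G \<and>
    (\<forall>\<phi> \<psi>. test_function \<Omega> \<phi> \<longrightarrow> (\<forall>x. GDERIV \<phi> x :> \<psi> x) \<longrightarrow>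
       (LINT x|lebesgue_on \<Omega>. u x *\<^sub>R \<psi> x) = - (LINT x|lebesgue_on \<Omega>. \<phi> x *\<^sub>R G x))"

definition H1 :: "'a::euclidean_space set \<Rightarrow> ('a \<Rightarrow> real) set" where
  "H1 \<Omega> = {u. \<exists>G. weak_gradient \<Omega> u G}"

text \<open>The closure of the test functions in the \<open>H\<^sup>1\<close> norm.\<close>

definition H1_0 :: "'a::euclidean_space set \<Rightarrow> ('a \<Rightarrow> real) set" where
  "H1_0 \<Omega> = {u. \<exists>G. weak_gradient \<Omega> u G \<and>
     (\<exists>\<phi> \<psi>. (\<forall>n::nat. test_function \<Omega> (\<phi> n) \<and> (\<forall>x. GDERIV (\<phi> n) x :> \<psi> n x)) \<and>
        (\<lambda>n. LINT x|lebesgue_on \<Omega>. (u x - \<phi> n x)\<^sup>2 + (norm (G x - \<psi> n x))\<^sup>2) \<longlonglongrightarrow> 0)}"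


section \<open>The Dirichlet and Neumann Laplacians and their eigenvalues\<close>

text \<open>The graph \<open>{(u, f). -\<Delta>u = f}\<close> of the self-adjoint operator on \<open>L\<^sup>2(\<Omega>)\<close> associated with
  the Dirichlet energy form with form domain \<open>V\<close>. Real-valued functions suffice, since this operator
  is real: real and complex multiplicities of its eigenvalues agree.\<close>

definition form_laplacian ::
  "('a \<Rightarrow> real) set \<Rightarrow> 'a::euclidean_space set \<Rightarrow> ('a \<Rightarrow> real) \<Rightarrow> ('a \<Rightarrow> real) \<Rightarrow> bool" where
  "form_laplacian V \<Omega> u f \<longleftrightarrow>
    u \<in> V \<and> square_integrable \<Omega> f \<and>
    (\<exists>G. weak_gradient \<Omega> u G \<and>
      (\<forall>v \<in> V. \<forall>H. weak_gradient \<Omega> v H \<longrightarrow>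
        (LINT x|lebesgue_on \<Omega>. G x \<bullet> H x) = (LINT x|lebesgue_on \<Omega>. f x * v x)))"

definition dirichlet_laplacian ::
  "'a::euclidean_space set \<Rightarrow> ('a \<Rightarrow> real) \<Rightarrow> ('a \<Rightarrow> real) \<Rightarrow> bool" where
  "dirichlet_laplacian \<Omega> = form_laplacian (H1_0 \<Omega>) \<Omega>"

definition neumann_laplacian ::
  "'a::euclidean_space set \<Rightarrow> ('a \<Rightarrow> real) \<Rightarrow> ('a \<Rightarrow> real) \<Rightarrow> bool" where
  "neumann_laplacian \<Omega> = form_laplacian (H1 \<Omega>) \<Omega>"

text \<open>The multiplicity of \<open>t\<close> for an operator \<open>A\<close>, given by its graph, is the dimension of
  \<open>{u. A u = t u}\<close> modulo equality almost everywhere; it is 0 if \<open>t\<close> is not an eigenvalue.\<close>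

definition multiplicity_on ::
  "'a::euclidean_space set \<Rightarrow> (('a \<Rightarrow> real) \<Rightarrow> ('a \<Rightarrow> real) \<Rightarrow> bool) \<Rightarrow> real \<Rightarrow> enat" where
  "multiplicity_on \<Omega> A t = Sup {enat n | n. \<exists>u :: nat \<Rightarrow> 'a \<Rightarrow> real.
     (\<forall>i<n. A (u i) (\<lambda>x. t * u i x)) \<and>
     (\<forall>c :: nat \<Rightarrow> real. (AE x in lebesgue_on \<Omega>. (\<Sum>i<n. c i * u i x) = 0) \<longrightarrow> (\<forall>i<n. c i = 0))}"

text \<open>The eigenvalues, numbered from 1, in nondecreasing order and repeated according to
  multiplicity. For the operators considered here such a sequence exists (their spectra are
  discrete), and it is unique at the indices \<open>n \<ge> 1\<close>.\<close>

definition eigenvalue_sequence ::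
  "'a::euclidean_space set \<Rightarrow> (('a \<Rightarrow> real) \<Rightarrow> ('a \<Rightarrow> real) \<Rightarrow> bool) \<Rightarrow> nat \<Rightarrow> real" where
  "eigenvalue_sequence \<Omega> A = (SOME ev. mono_on {1..} ev \<and>
     (\<forall>t. finite {n. 1 \<le> n \<and> ev n = t} \<and>
          multiplicity_on \<Omega> A t = enat (card {n. 1 \<le> n \<and> ev n = t})))"

definition dirichlet_eigenvalue :: "'a::euclidean_space set \<Rightarrow> nat \<Rightarrow> real" where
  "dirichlet_eigenvalue \<Omega> = eigenvalue_sequence \<Omega> (dirichlet_laplacian \<Omega>)"

definition neumann_eigenvalue :: "'a::euclidean_space set \<Rightarrow> nat \<Rightarrow> real" where
  "neumann_eigenvalue \<Omega> = eigenvalue_sequence \<Omega> (neumann_laplacian \<Omega>)"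

definition dirichlet_count :: "'a::euclidean_space set \<Rightarrow> real \<Rightarrow> nat" where
  "dirichlet_count \<Omega> r = card {n. 1 \<le> n \<and> dirichlet_eigenvalue \<Omega> n \<le> r\<^sup>2}"

definition neumann_count :: "'a::euclidean_space set \<Rightarrow> real \<Rightarrow> nat" where
  "neumann_count \<Omega> r = card {n. 1 \<le> n \<and> neumann_eigenvalue \<Omega> n \<le> r\<^sup>2}"


section \<open>The Polya conjectures\<close>

definition weyl_constant :: "nat \<Rightarrow> real" where
  "weyl_constant d = 1 / ((4 * pi) powr (real d / 2) * Gamma (real d / 2 + 1))"

definition dirichlet_polya :: "'a::euclidean_space set \<Rightarrow> bool" where
  "dirichlet_polya \<Omega> \<longleftrightarrow>
    (\<forall>r\<ge>0. real (dirichlet_count \<Omega> r) \<le>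
       weyl_constant DIM('a) * measure lebesgue \<Omega> * r ^ DIM('a))"

definition neumann_polya :: "'a::euclidean_space set \<Rightarrow> bool" where
  "neumann_polya \<Omega> \<longleftrightarrow>
    (\<forall>r\<ge>0. real (neumann_count \<Omega> r) \<ge>
       weyl_constant DIM('a) * measure lebesgue \<Omega> * r ^ DIM('a))"

end

theory Submission
  imports Defs "HOL-Library.Function_Algebras"
begin

text \<open>Let \<open>K\<close> be the number of tiles and \<open>N(t)\<close> the number of eigenvalues at most \<open>t\<close>; then
  \<open>|\<Omega>| = K |\<Omega>'|\<close>. In the Dirichlet case, copying the first \<open>N'(t)\<close> eigenfunctions of \<open>\<Omega>'\<close> to every
  tile and extending by zero gives \<open>K N'(t)\<close> orthogonal elements of \<open>H\<^sup>1\<^sub>0(\<Omega>)\<close> with Rayleigh quotients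
  at most \<open>t\<close>, so \<open>K N'(t) \<le> N(t)\<close>. In the Neumann case, if \<open>N(t) > K N'(t)\<close> then some nonzero
  combination of the first \<open>N(t)\<close> eigenfunctions of \<open>\<Omega>\<close> is orthogonal on each tile to the first
  \<open>N'(t)\<close> eigenfunctions, so its Rayleigh quotient exceeds \<open>t\<close> on some tile and is never below it.

  The eigenvalues come from successive minimisation of the Rayleigh quotient. The minima are attained
  because, for each \<open>\<epsilon>\<close>, finitely many linear functionals \<open>l\<^sub>i\<close> satisfy
  \<open>|u|\<^sup>2 \<le> \<epsilon> |\<nabla>u|\<^sup>2 + \<Sum>\<^sub>i l\<^sub>i(u)\<^sup>2\<close>: in the interior the \<open>l\<^sub>i\<close> are multiples of means over small balls,
  and near a Lipschitz boundary \<open>u\<close> is compared with a translate that only sees a compact subset of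
  the domain.\<close>

section \<open>Eigenvalues of a pair of quadratic forms\<close>

text \<open>One linear-algebra fact drives every count: fewer homogeneous equations than unknowns
  leave a nonzero solution. It takes the place of the min-max formula in both comparisons and also
  bounds multiplicities. The two parts use opposite constructions because the form domains behave
  oppositely: extension by zero preserves \<open>H1_0\<close> and restriction to a tile preserves
  \<open>H1\<close>, while in general neither holds with the spaces exchanged. So Dirichlet
  eigenfunctions are assembled on the large domain and Neumann eigenfunctions are cut into tiles.
  Boundary regularity enters through compactness. For a general bounded open set the embedding of
  \<open>H1\<close> into L^2 may fail to be compact, and then the Neumann spectrum need not be
  discrete; for \<open>H1_0\<close>, zero extension reduces everything to an interior estimate on
  the whole space. The eigenvalues are picked by \<open>SOME\<close> from a condition on
  multiplicities. Nothing is known about the counts until some sequence with these multiplicities is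
  exhibited, which is why the spectrum must be constructed before anything can be compared.\<close>

lemma homogeneous_system_nontrivial:
  fixes a :: "'j \<Rightarrow> 'i \<Rightarrow> real"
  assumes "finite J" "finite I" "card J < card I"
  shows "\<exists>c. (\<exists>i\<in>I. c i \<noteq> 0) \<and> (\<forall>j\<in>J. (\<Sum>i\<in>I. c i * a j i) = 0)"
  using assms
proof (induction J arbitrary: I a rule: finite_induct)
  case empty
  then have "I \<noteq> {}" by auto
  then show ?case by (intro exI[of _ "\<lambda>_. 1"]) auto
next
  case (insert j0 J)
  show ?case
  proof (cases "\<forall>i\<in>I. a j0 i = 0")
    case True
    have "card J < card I" using insert by auto
    from insert.IH[OF insert.prems(1) this, of a] obtain c where
      c: "\<exists>i\<in>I. c i \<noteq> 0" "\<forall>j\<in>J. (\<Sum>i\<in>I. c i * a j i) = 0" by blast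
    show ?thesis by (intro exI[of _ c]) (use c True in auto)
  next
    case False
    then obtain i0 where i0: "i0 \<in> I" "a j0 i0 \<noteq> 0" by auto
    let ?I = "I - {i0}"
    \<comment> \<open>One step of Gauss elimination: equation \<open>j0\<close> removes the unknown
      \<open>i0\<close> from all the others, and \<open>c0\<close> below solves that equation for
      the removed unknown.\<close>
    define a' where "a' j i = a j i - a j i0 * a j0 i / a j0 i0" for j i
    have "card J < card ?I" using insert i0 by (simp add: card_Diff_singleton_if)
    from insert.IH[OF _ this, of a'] insert.prems obtain c where
      c: "\<exists>i\<in>?I. c i \<noteq> 0" "\<forall>j\<in>J. (\<Sum>i\<in>?I. c i * a' j i) = 0" by auto
    define c0 where "c0 = - (\<Sum>i\<in>?I. c i * a j0 i) / a j0 i0"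
    let ?c = "c(i0 := c0)"
    have eq: "(\<Sum>i\<in>I. ?c i * a j i) = c0 * a j i0 + (\<Sum>i\<in>?I. c i * a j i)" for j
    proof -
      have "(\<Sum>i\<in>I. ?c i * a j i) = ?c i0 * a j i0 + (\<Sum>i\<in>?I. ?c i * a j i)"
        using i0 insert.prems by (simp add: sum.remove)
      also have "(\<Sum>i\<in>?I. ?c i * a j i) = (\<Sum>i\<in>?I. c i * a j i)"
        by (intro sum.cong) auto
      finally show ?thesis by simp
    qed
    have "(\<Sum>i\<in>I. ?c i * a j i) = 0" if "j \<in> J" for j
    proof -
      have "0 = (\<Sum>i\<in>?I. c i * a' j i)" using c that by simp
      also have "\<dots> = (\<Sum>i\<in>?I. c i * a j i - a j i0 / a j0 i0 * (c i * a j0 i))"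
        unfolding a'_def by (intro sum.cong) (auto simp: field_simps)
      also have "\<dots> = (\<Sum>i\<in>?I. c i * a j i) - a j i0 / a j0 i0 * (\<Sum>i\<in>?I. c i * a j0 i)"
        by (simp add: sum_subtractf sum_distrib_left)
      also have "\<dots> = c0 * a j i0 + (\<Sum>i\<in>?I. c i * a j i)"
        unfolding c0_def by simp
      finally show ?thesis using eq by simp
    qed
    moreover have "(\<Sum>i\<in>I. ?c i * a j0 i) = 0"
      using eq[of j0] i0 by (simp add: c0_def)
    moreover have "\<exists>i\<in>I. ?c i \<noteq> 0" using c by auto
    ultimately show ?thesis by (intro exI[of _ ?c]) auto
  qed
qed

text \<open>Bolzano-Weierstrass applied \<open>N\<close> times, each subsequence refining the
  previous one. It is used on the finitely many functionals of the compactness inequality along a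
  minimising sequence.\<close>

lemma common_convergent_subsequence:
  fixes s :: "nat \<Rightarrow> nat \<Rightarrow> real"
  assumes "\<And>i. i < N \<Longrightarrow> bounded (range (s i))"
  shows "\<exists>r::nat\<Rightarrow>nat. strict_mono r \<and> (\<forall>i<N. convergent (\<lambda>k. s i (r k)))"
  using assms
proof (induction N)
  case 0
  show ?case by (intro exI[of _ id]) (auto simp: strict_mono_def)
next
  case (Suc N)
  then obtain r where r: "strict_mono r" "\<forall>i<N. convergent (\<lambda>k. s i (r k))" by auto
  have "bounded (range (s N \<circ> r))"
    by (rule bounded_subset[OF Suc.prems[of N]]) auto
  from bounded_imp_convergent_subsequence[OF this]
  obtain l r' where r': "strict_mono r'" "((s N \<circ> r) \<circ> r') \<longlonglongrightarrow> l" by metis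
  show ?case
  proof (intro exI[of _ "r \<circ> r'"] conjI allI impI)
    show "strict_mono (r \<circ> r')" using r r' by (simp add: strict_mono_o)
    fix i assume "i < Suc N"
    then consider "i < N" | "i = N" by linarith
    then show "convergent (\<lambda>k. s i ((r \<circ> r') k))"
    proof cases
      case 1
      then show ?thesis using r(2) convergent_subseq_convergent[OF _ r'(1)] by (fastforce simp: o_def)
    next
      case 2
      then show ?thesis using r' by (auto simp: convergent_def o_def)
    qed
  qed
qed

text \<open>Semidefinite rather than definite, because functions that agree almost everywhere remain
  different vectors. The laws are relative to \<open>X\<close>, because integrals are bilinear only
  where the integrands are integrable.\<close>

locale psd_form =
  fixes X :: "'v::real_vector set" and b :: "'v \<Rightarrow> 'v \<Rightarrow> real"
  assumes X: "subspace X"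
    and sym: "u \<in> X \<Longrightarrow> v \<in> X \<Longrightarrow> b u v = b v u"
    and add_left: "u \<in> X \<Longrightarrow> v \<in> X \<Longrightarrow> w \<in> X \<Longrightarrow> b (u + v) w = b u w + b v w"
    and scale_left: "u \<in> X \<Longrightarrow> w \<in> X \<Longrightarrow> b (c *\<^sub>R u) w = c * b u w"
    and nonneg: "u \<in> X \<Longrightarrow> 0 \<le> b u u"
begin

lemma add_right: "u \<in> X \<Longrightarrow> v \<in> X \<Longrightarrow> w \<in> X \<Longrightarrow> b w (u + v) = b w u + b w v"
  using add_left[of u v w] sym[of w "u + v"] sym[of w u] sym[of w v] subspace_add[OF X, of u v] by simp

lemma scale_right: "u \<in> X \<Longrightarrow> w \<in> X \<Longrightarrow> b w (c *\<^sub>R u) = c * b w u"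
  using scale_left[of u w c] sym[of w "c *\<^sub>R u"] sym[of w u] subspace_scale[OF X, of u c] by simp

lemma diff_left: "u \<in> X \<Longrightarrow> v \<in> X \<Longrightarrow> w \<in> X \<Longrightarrow> b (u - v) w = b u w - b v w"
  using add_left[of u "(-1) *\<^sub>R v" w] scale_left[of v w "-1"] subspace_scale[OF X, of v "-1"] by simp

lemma diff_right: "u \<in> X \<Longrightarrow> v \<in> X \<Longrightarrow> w \<in> X \<Longrightarrow> b w (u - v) = b w u - b w v"
  using diff_left[of u v w] sym[of w "u - v"] sym[of w u] sym[of w v] subspace_diff[OF X, of u v] by simp

lemma zero_left: "w \<in> X \<Longrightarrow> b 0 w = 0"
  using scale_left[of w w 0] by simp

lemma sum_left:
  assumes "\<And>i. i \<in> I \<Longrightarrow> u i \<in> X" "w \<in> X"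
  shows "b (\<Sum>i\<in>I. c i *\<^sub>R u i) w = (\<Sum>i\<in>I. c i * b (u i) w)"
  using assms
proof (induction I rule: infinite_finite_induct)
  case (insert i I)
  then have "(\<Sum>i\<in>I. c i *\<^sub>R u i) \<in> X" "c i *\<^sub>R u i \<in> X" "u i \<in> X"
    using X by (auto intro!: subspace_sum subspace_scale)
  with insert show ?case by (simp add: add_left scale_left)
qed (auto simp: zero_left)

lemma sum_right:
  assumes "\<And>i. i \<in> I \<Longrightarrow> u i \<in> X" "w \<in> X"
  shows "b w (\<Sum>i\<in>I. c i *\<^sub>R u i) = (\<Sum>i\<in>I. c i * b w (u i))"
proof -
  have "(\<Sum>i\<in>I. c i *\<^sub>R u i) \<in> X" using X assms by (auto intro!: subspace_sum subspace_scale)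
  then have "b w (\<Sum>i\<in>I. c i *\<^sub>R u i) = (\<Sum>i\<in>I. c i * b (u i) w)"
    using sum_left[OF assms] sym[OF assms(2)] by simp
  also have "\<dots> = (\<Sum>i\<in>I. c i * b w (u i))" using assms sym by (intro sum.cong) auto
  finally show ?thesis .
qed

lemma orthogonal_sum:
  assumes "finite I" and u: "\<And>i. i \<in> I \<Longrightarrow> u i \<in> X"
    and orth: "\<And>i j. i \<in> I \<Longrightarrow> j \<in> I \<Longrightarrow> i \<noteq> j \<Longrightarrow> b (u i) (u j) = 0"
  shows "b (\<Sum>i\<in>I. c i *\<^sub>R u i) (\<Sum>i\<in>I. c i *\<^sub>R u i) = (\<Sum>i\<in>I. (c i)\<^sup>2 * b (u i) (u i))"
proof -
  have S: "(\<Sum>i\<in>I. c i *\<^sub>R u i) \<in> X" using X u by (auto intro!: subspace_sum subspace_scale)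
  have "b (\<Sum>i\<in>I. c i *\<^sub>R u i) (\<Sum>i\<in>I. c i *\<^sub>R u i) = (\<Sum>i\<in>I. c i * b (u i) (\<Sum>j\<in>I. c j *\<^sub>R u j))"
    by (rule sum_left[OF u S])
  also have "\<dots> = (\<Sum>i\<in>I. c i * (\<Sum>j\<in>I. c j * b (u i) (u j)))"
    using u by (intro sum.cong) (auto simp: sum_right)
  also have "\<dots> = (\<Sum>i\<in>I. c i * (\<Sum>j\<in>I. if j = i then c i * b (u i) (u i) else 0))"
    using orth by (intro sum.cong refl arg_cong2[where f="(*)"]) auto
  also have "\<dots> = (\<Sum>i\<in>I. (c i)\<^sup>2 * b (u i) (u i))"
    using \<open>finite I\<close> by (intro sum.cong) (auto simp: power2_eq_square)
  finally show ?thesis .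
qed

lemma diff_expand:
  assumes "u \<in> X" "v \<in> X"
  shows "b (u - v) (u - v) = b u u - 2 * b u v + b v v"
  using assms diff_left[of u v] diff_right[of u v] sym[of u v] subspace_diff[OF X, of u v] by simp

lemma add_expand:
  assumes "u \<in> X" "v \<in> X"
  shows "b (u + v) (u + v) = b u u + 2 * b u v + b v v"
  using assms add_left[of u v] add_right[of u v] sym[of u v] subspace_add[OF X, of u v] by simp

lemma diff_le:
  assumes "u \<in> X" "v \<in> X"
  shows "b (u - v) (u - v) \<le> 2 * b u u + 2 * b v v"
  using diff_expand[OF assms] add_expand[OF assms] nonneg[OF subspace_add[OF X assms]] by simp

lemma add_le:
  assumes "u \<in> X" "v \<in> X"
  shows "b (u + v) (u + v) \<le> 2 * b u u + 2 * b v v"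
  using diff_expand[OF assms] add_expand[OF assms] nonneg[OF subspace_diff[OF X assms]] by simp

lemma cauchy_schwarz:
  assumes u: "u \<in> X" and v: "v \<in> X"
  shows "(b u v)\<^sup>2 \<le> b u u * b v v"
proof -
  have q: "0 \<le> b u u - 2 * t * b u v + t\<^sup>2 * b v v" for t
  proof -
    have tv: "t *\<^sub>R v \<in> X" using X v by (simp add: subspace_scale)
    have "b (u - t *\<^sub>R v) (u - t *\<^sub>R v) = b u u - 2 * b u (t *\<^sub>R v) + b (t *\<^sub>R v) (t *\<^sub>R v)"
      by (rule diff_expand[OF u tv])
    also have "\<dots> = b u u - 2 * t * b u v + t\<^sup>2 * b v v"
      using scale_right[OF v u] scale_left[OF v tv] scale_right[OF v v]
      by (simp add: power2_eq_square)
    finally show ?thesis using nonneg[OF subspace_diff[OF X u tv]] by simp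
  qed
  show ?thesis
  proof (cases "b v v = 0")
    case True
    have "b u v = 0"
    proof (rule ccontr)
      assume ne: "b u v \<noteq> 0"
      \<comment> \<open>With \<open>b v v = 0\<close> the quadratic \<open>q\<close> is affine in
        \<open>t\<close>, and at this \<open>t\<close> its value is -1.\<close>
      from q[of "(b u u + 1) / (2 * b u v)"] True ne show False by (simp add: field_simps)
    qed
    then show ?thesis using True by simp
  next
    case False
    then have pos: "b v v > 0" using nonneg[OF v] by simp
    from q[of "b u v / b v v"] have "0 \<le> b u u - (b u v)\<^sup>2 / b v v"
      using pos by (simp add: power2_eq_square field_simps)
    then show ?thesis using pos by (simp add: field_simps)
  qed
qed

lemma tendsto_left:
  assumes s: "\<And>k. s k \<in> X" and u: "u \<in> X" and w: "w \<in> X"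
    and lim: "(\<lambda>k::nat. b (s k - u) (s k - u)) \<longlonglongrightarrow> 0"
  shows "(\<lambda>k. b (s k) w) \<longlonglongrightarrow> b u w"
proof -
  have "(\<lambda>k. b (s k - u) w) \<longlonglongrightarrow> 0"
  proof (rule Lim_null_comparison)
    show "\<forall>\<^sub>F k in sequentially. norm (b (s k - u) w) \<le> sqrt (b (s k - u) (s k - u) * b w w)"
      using cauchy_schwarz[OF subspace_diff[OF X s u] w] by (auto intro!: always_eventually real_le_rsqrt)
    have "(\<lambda>k. sqrt (b (s k - u) (s k - u) * b w w)) \<longlonglongrightarrow> sqrt (0 * b w w)"
      by (intro tendsto_intros lim)
    then show "(\<lambda>k. sqrt (b (s k - u) (s k - u) * b w w)) \<longlonglongrightarrow> 0" by simp
  qed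
  then have "(\<lambda>k. b (s k) w - b u w) \<longlonglongrightarrow> 0" using diff_left[OF s u w] by simp
  then show ?thesis by (simp add: LIM_zero_iff)
qed

lemma tendsto_quadratic:
  assumes s: "\<And>k. s k \<in> X" and u: "u \<in> X"
    and lim: "(\<lambda>k::nat. b (s k - u) (s k - u)) \<longlonglongrightarrow> 0"
  shows "(\<lambda>k. b (s k) (s k)) \<longlonglongrightarrow> b u u"
proof -
  have "(\<lambda>k. b (s k - u) (s k - u) + 2 * b (s k) u - b u u) \<longlonglongrightarrow> 0 + 2 * b u u - b u u"
    by (intro tendsto_intros lim tendsto_left[OF s u u lim])
  moreover have "b (s k - u) (s k - u) + 2 * b (s k) u - b u u = b (s k) (s k)" for k
    using diff_expand[OF s u] by simp
  ultimately show ?thesis by simp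
qed

end

text \<open>\<open>m\<close> models the L^2 product and \<open>e\<close> the Dirichlet integral.
  \<open>compact\<close> is the compact embedding of the form domain in quantitative form: up to a
  small multiple of the full norm, finitely many \<open>m\<close>-bounded functionals control the
  mass. \<open>infinite_dim\<close> ensures that the orthogonal complement of finitely many vectors
  still contains a vector of positive mass.\<close>

locale energy_space = m: psd_form X m + e: psd_form X e
  for X :: "'v::real_vector set" and m e :: "'v \<Rightarrow> 'v \<Rightarrow> real" +
  assumes complete: "\<lbrakk>\<And>k::nat. s k \<in> X;
      \<And>\<epsilon>. \<epsilon> > 0 \<Longrightarrow> \<exists>M. \<forall>k\<ge>M. \<forall>l\<ge>M. m (s k - s l) (s k - s l) + e (s k - s l) (s k - s l) < \<epsilon>\<rbrakk>
      \<Longrightarrow> \<exists>u\<in>X. (\<lambda>k. m (s k - u) (s k - u) + e (s k - u) (s k - u)) \<longlonglongrightarrow> 0"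
    and compact: "\<epsilon> > 0 \<Longrightarrow> \<exists>(N::nat) l B. (\<forall>i<N. \<forall>u\<in>X. \<forall>v\<in>X. \<forall>c. l i (u + v) = l i u + l i v \<and>
        l i (c *\<^sub>R u) = c * l i u \<and> (l i u)\<^sup>2 \<le> B * m u u) \<and>
        (\<forall>u\<in>X. m u u \<le> \<epsilon> * (m u u + e u u) + (\<Sum>i<N. (l i u)\<^sup>2))"
    and infinite_dim: "\<exists>w. (\<forall>i<n::nat. w i \<in> X \<and> m (w i) (w i) > 0) \<and>
        (\<forall>i<n. \<forall>j<n. i \<noteq> j \<longrightarrow> m (w i) (w j) = 0)"
begin

text \<open>The direct method without weak convergence. The form \<open>e - \<mu> * m\<close> is
  semidefinite on \<open>W\<close> and tends to 0 along a minimising sequence, so differences of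
  late members are small in it. The compactness inequality upgrades this to smallness in
  \<open>m + e\<close>, and completeness provides the limit.\<close>

lemma minimizer_exists:
  fixes a :: "nat \<Rightarrow> 'v" and n :: nat
  assumes a: "\<And>i. i < n \<Longrightarrow> a i \<in> X"
  defines "W \<equiv> {w \<in> X. \<forall>i<n. m w (a i) = 0}"
  assumes w0: "w0 \<in> W" "m w0 w0 > 0"
  shows "\<exists>u\<in>W. m u u = 1 \<and> (\<forall>w\<in>W. e u u * m w w \<le> e w w)"
proof -
  have WX: "W \<subseteq> X" unfolding W_def by auto
  have subW: "subspace W"
    unfolding W_def subspace_def using m.X a
    by (auto simp: subspace_0 subspace_add subspace_scale m.zero_left m.add_left m.scale_left)
  define S where "S = (\<lambda>w. e w w) ` {w\<in>W. m w w = 1}"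
  have normalize: "\<exists>c. m (c *\<^sub>R w) (c *\<^sub>R w) = 1 \<and> e (c *\<^sub>R w) (c *\<^sub>R w) = e w w / m w w \<and> c *\<^sub>R w \<in> W"
    if "w \<in> W" "m w w > 0" for w
  proof (intro exI[of _ "1 / sqrt (m w w)"] conjI)
    have wX: "w \<in> X" "\<And>c. c *\<^sub>R w \<in> X" using that WX m.X by (auto intro: subspace_scale)
    have sq: "(1 / sqrt (m w w)) * (1 / sqrt (m w w)) = 1 / m w w"
      using that by (simp add: real_sqrt_mult_self)
    show "m ((1 / sqrt (m w w)) *\<^sub>R w) ((1 / sqrt (m w w)) *\<^sub>R w) = 1"
      using m.scale_left[OF wX(1) wX(2)] m.scale_right[OF wX(1) wX(1)] that sq by simp
    show "e ((1 / sqrt (m w w)) *\<^sub>R w) ((1 / sqrt (m w w)) *\<^sub>R w) = e w w / m w w"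
      using e.scale_left[OF wX(1) wX(2)] e.scale_right[OF wX(1) wX(1)] that sq
      by (simp add: mult.assoc[symmetric])
    show "(1 / sqrt (m w w)) *\<^sub>R w \<in> W" using subW that by (simp add: subspace_scale)
  qed
  obtain c0 where "c0 *\<^sub>R w0 \<in> W" "m (c0 *\<^sub>R w0) (c0 *\<^sub>R w0) = 1" using normalize[OF w0] by auto
  then have Sne: "S \<noteq> {}" unfolding S_def by auto
  have Sbdd: "bdd_below S" unfolding S_def by (rule bdd_belowI[of _ 0]) (use WX e.nonneg in auto)
  define \<mu> where "\<mu> = Inf S"
  have \<mu>0: "\<mu> \<ge> 0" unfolding \<mu>_def by (rule cInf_greatest[OF Sne]) (use WX e.nonneg in \<open>auto simp: S_def\<close>)
  have \<mu>_le: "\<mu> * m w w \<le> e w w" if wW: "w \<in> W" for w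
  proof (cases "m w w > 0")
    case True
    then obtain c where c: "m (c *\<^sub>R w) (c *\<^sub>R w) = 1" "e (c *\<^sub>R w) (c *\<^sub>R w) = e w w / m w w" "c *\<^sub>R w \<in> W"
      using normalize[OF wW True] by blast
    then have "e w w / m w w \<in> S" unfolding S_def by (auto intro!: image_eqI[of _ _ "c *\<^sub>R w"])
    then have "\<mu> \<le> e w w / m w w" unfolding \<mu>_def using Sbdd by (rule cInf_lower)
    then show ?thesis using True by (simp add: field_simps)
  next
    case False
    then have "m w w = 0" using m.nonneg[of w] that WX by force
    then show ?thesis using e.nonneg[of w] that WX by auto
  qed
  define q where "q u v = e u v - \<mu> * m u v" for u v
  have memX: "\<And>u. u \<in> W \<Longrightarrow> u \<in> X" using WX by auto
  interpret q: psd_form W q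
  proof
    fix u v w c assume "u \<in> W" "v \<in> W" "w \<in> W"
    then have "u \<in> X" "v \<in> X" "w \<in> X" using WX by auto
    then show "q u v = q v u" "q (u + v) w = q u w + q v w"
      unfolding q_def using m.sym[of u v] e.sym[of u v]
      by (auto simp: m.add_left e.add_left algebra_simps)
  next
    fix u w c assume "u \<in> W" "w \<in> W"
    then show "q (c *\<^sub>R u) w = c * q u w"
      unfolding q_def by (simp add: memX m.scale_left e.scale_left algebra_simps)
  next
    fix u assume "u \<in> W"
    then show "0 \<le> q u u" using \<mu>_le unfolding q_def by simp
  qed (rule subW)
  have "\<exists>u. u \<in> W \<and> m u u = 1 \<and> e u u < \<mu> + 1 / Suc k" for k :: nat
  proof -
    have "\<exists>x\<in>S. x < \<mu> + 1 / Suc k"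
      using cInf_lessD[OF Sne, of "\<mu> + 1 / Suc k"] unfolding \<mu>_def by (auto simp: field_simps)
    then show ?thesis unfolding S_def by auto
  qed
  then obtain u where u: "\<And>k. u k \<in> W" "\<And>k. m (u k) (u k) = 1" "\<And>k. e (u k) (u k) < \<mu> + 1 / Suc k"
    by metis
  \<comment> \<open>After substituting \<open>e = q + \<mu> * m\<close>, the compactness inequality
    has \<open>m\<close> on the right with coefficient \<open>\<epsilon> * (1 + \<mu>)\<close>; the
    value 1/2 allows this term to be absorbed on the left.\<close>
  define \<epsilon> where "\<epsilon> = 1 / (2 * (1 + \<mu>))"
  have \<epsilon>: "\<epsilon> > 0" "\<epsilon> * (1 + \<mu>) = 1 / 2" unfolding \<epsilon>_def using \<mu>0 by (auto simp: field_simps)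
  obtain N :: nat and l B where lin: "\<And>i u v. i < N \<Longrightarrow> u \<in> X \<Longrightarrow> v \<in> X \<Longrightarrow> l i (u + v) = l i u + l i v"
    and linc: "\<And>i u c. i < N \<Longrightarrow> u \<in> X \<Longrightarrow> l i (c *\<^sub>R u) = c * l i u"
    and lB: "\<And>i u. i < N \<Longrightarrow> u \<in> X \<Longrightarrow> (l i u)\<^sup>2 \<le> B * m u u"
    and cpt: "\<And>u. u \<in> X \<Longrightarrow> m u u \<le> \<epsilon> * (m u u + e u u) + (\<Sum>i<N. (l i u)\<^sup>2)"
    using compact[OF \<epsilon>(1)] by blast
  have ldiff: "l i (u - v) = l i u - l i v" if "i < N" "u \<in> X" "v \<in> X" for i u v
    using lin[OF that(1,2), of "(-1) *\<^sub>R v"] linc[OF that(1,3), of "-1"] that subspace_scale[OF m.X, of v "-1"]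
    by simp
  have "bounded (range (\<lambda>k. l i (u k)))" if "i < N" for i
  proof (rule boundedI)
    fix x assume "x \<in> range (\<lambda>k. l i (u k))"
    then obtain k where "x = l i (u k)" by auto
    then have "x\<^sup>2 \<le> B" using lB[OF that memX[OF u(1)], of k] u(2)[of k] by simp
    then show "norm x \<le> sqrt B" by (simp add: real_le_rsqrt)
  qed
  from common_convergent_subsequence[of N "\<lambda>i k. l i (u k)", OF this] obtain r :: "nat \<Rightarrow> nat"
    where r: "strict_mono r" "\<And>i. i < N \<Longrightarrow> convergent (\<lambda>k. l i (u (r k)))" by blast
  define v where "v k = u (r k)" for k
  have v: "\<And>k. v k \<in> W" "\<And>k. v k \<in> X" "\<And>k. m (v k) (v k) = 1" using u WX by (auto simp: v_def)
  have ulim: "(\<lambda>k. e (u k) (u k)) \<longlonglongrightarrow> \<mu>"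
  proof (rule tendsto_sandwich[of "\<lambda>_. \<mu>" _ _ "\<lambda>k. \<mu> + 1 / Suc k"])
    show "\<forall>\<^sub>F k in sequentially. \<mu> \<le> e (u k) (u k)"
      using \<mu>_le[OF u(1)] u(2) by (auto intro!: always_eventually)
    show "\<forall>\<^sub>F k in sequentially. e (u k) (u k) \<le> \<mu> + 1 / Suc k"
      using u(3) by (auto intro!: always_eventually less_imp_le)
    have "(\<lambda>k. \<mu> + 1 / Suc k) \<longlonglongrightarrow> \<mu> + 0"
      by (intro tendsto_intros lim_1_over_n LIMSEQ_Suc)
    then show "(\<lambda>k. \<mu> + 1 / Suc k) \<longlonglongrightarrow> \<mu>" by simp
  qed simp
  have vlim: "(\<lambda>k. e (v k) (v k)) \<longlonglongrightarrow> \<mu>"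
    using LIMSEQ_subseq_LIMSEQ[OF ulim r(1)] by (simp add: v_def o_def)
  have qlim: "(\<lambda>k. q (v k) (v k)) \<longlonglongrightarrow> 0"
    using tendsto_diff[OF vlim tendsto_const[of \<mu>]] by (simp add: q_def v)
  have cauchy: "\<exists>M. \<forall>k\<ge>M. \<forall>j\<ge>M. m (v k - v j) (v k - v j) + e (v k - v j) (v k - v j) < \<delta>"
    if "\<delta> > 0" for \<delta>
  proof -
    \<comment> \<open>\<open>4 * \<eta> * K\<close> is the bound that the estimates below produce
      for \<open>m + e\<close> of a difference, so \<open>\<eta>\<close> is chosen to make it equal
      to \<open>\<delta>\<close>.\<close>
    define K where "K = (1 + \<mu>) * (2 * \<epsilon> + 2) + 1"
    have pos: "K > 0" unfolding K_def using \<mu>0 \<epsilon> by (simp add: add_nonneg_pos)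
    define \<eta> where "\<eta> = \<delta> / (4 * K)"
    have \<eta>: "\<eta> > 0" "4 * \<eta> * K = \<delta>"
      unfolding \<eta>_def using that pos by auto
    obtain M1 where M1: "\<And>k. k \<ge> M1 \<Longrightarrow> q (v k) (v k) < \<eta>"
      using order_tendstoD(2)[OF qlim \<eta>(1)] by (auto simp: eventually_sequentially)
    have "\<exists>M. \<forall>k\<ge>M. \<forall>j\<ge>M. (\<Sum>i<N. (l i (v k) - l i (v j))\<^sup>2) < \<eta>"
    proof -
      have "\<exists>L. (\<lambda>k. l i (v k)) \<longlonglongrightarrow> L" if "i < N" for i using r(2)[OF that] by (simp add: convergent_def v_def)
      then obtain L where L: "\<And>i. i < N \<Longrightarrow> (\<lambda>k. l i (v k)) \<longlonglongrightarrow> L i" by metis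
      have "(\<lambda>k. \<Sum>i<N. (l i (v k) - L i)\<^sup>2) \<longlonglongrightarrow> (\<Sum>i<N. (L i - L i)\<^sup>2)"
        by (intro tendsto_intros L) auto
      then have lim: "(\<lambda>k. \<Sum>i<N. (l i (v k) - L i)\<^sup>2) \<longlonglongrightarrow> 0" by simp
      obtain M where M: "\<And>k. k \<ge> M \<Longrightarrow> (\<Sum>i<N. (l i (v k) - L i)\<^sup>2) < \<eta> / 4"
        using order_tendstoD(2)[OF lim, of "\<eta> / 4"] \<eta> by (auto simp: eventually_sequentially)
      show ?thesis
      proof (intro exI[of _ M] allI impI)
        fix k j assume kj: "k \<ge> M" "j \<ge> M"
        have "(\<Sum>i<N. (l i (v k) - l i (v j))\<^sup>2)
            \<le> (\<Sum>i<N. 2 * (l i (v k) - L i)\<^sup>2 + 2 * (l i (v j) - L i)\<^sup>2)"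
        proof (rule sum_mono)
          fix i
          have "0 \<le> ((l i (v k) - L i) + (l i (v j) - L i))\<^sup>2" by simp
          then show "(l i (v k) - l i (v j))\<^sup>2 \<le> 2 * (l i (v k) - L i)\<^sup>2 + 2 * (l i (v j) - L i)\<^sup>2"
            by (simp add: power2_eq_square algebra_simps)
        qed
        also have "\<dots> = 2 * (\<Sum>i<N. (l i (v k) - L i)\<^sup>2) + 2 * (\<Sum>i<N. (l i (v j) - L i)\<^sup>2)"
          by (simp add: sum.distrib sum_distrib_left)
        also have "\<dots> < \<eta>" using M[OF kj(1)] M[OF kj(2)] by simp
        finally show "(\<Sum>i<N. (l i (v k) - l i (v j))\<^sup>2) < \<eta>" .
      qed
    qed
    then obtain M2 where M2: "\<And>k j. k \<ge> M2 \<Longrightarrow> j \<ge> M2 \<Longrightarrow> (\<Sum>i<N. (l i (v k) - l i (v j))\<^sup>2) < \<eta>"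
      by blast
    show ?thesis
    proof (intro exI[of _ "max M1 M2"] allI impI)
      fix k j assume kj: "k \<ge> max M1 M2" "j \<ge> max M1 M2"
      let ?w = "v k - v j"
      have wW: "?w \<in> W" "?w \<in> X" using subW v m.X by (auto intro: subspace_diff)
      have Q: "q ?w ?w \<le> 4 * \<eta>" using q.diff_le[OF v(1)[of k] v(1)[of j]] M1[of k] M1[of j] kj by auto
      have L: "(\<Sum>i<N. (l i ?w)\<^sup>2) < \<eta>"
        using M2[of k j] kj by (simp add: ldiff v)
      have e: "e ?w ?w = q ?w ?w + \<mu> * m ?w ?w" by (simp add: q_def)
      have "m ?w ?w \<le> \<epsilon> * (m ?w ?w + e ?w ?w) + (\<Sum>i<N. (l i ?w)\<^sup>2)" by (rule cpt[OF wW(2)])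
      also have "\<epsilon> * (m ?w ?w + e ?w ?w) = (\<epsilon> * (1 + \<mu>)) * m ?w ?w + \<epsilon> * q ?w ?w"
        by (simp add: e algebra_simps)
      also have "\<dots> = m ?w ?w / 2 + \<epsilon> * q ?w ?w" unfolding \<epsilon>(2) by simp
      finally have "m ?w ?w \<le> 2 * \<epsilon> * q ?w ?w + 2 * \<eta>" using L by simp
      also have "\<dots> \<le> 2 * \<epsilon> * (4 * \<eta>) + 2 * (4 * \<eta>)" using Q \<epsilon> \<eta> by (intro add_mono mult_left_mono) auto
      finally have mm: "m ?w ?w \<le> (2 * \<epsilon> + 2) * (4 * \<eta>)" by (simp add: algebra_simps)
      have "m ?w ?w + e ?w ?w = (1 + \<mu>) * m ?w ?w + q ?w ?w" by (simp add: e algebra_simps)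
      also have "\<dots> \<le> (1 + \<mu>) * ((2 * \<epsilon> + 2) * (4 * \<eta>)) + q ?w ?w"
        using mm \<mu>0 by (intro add_mono mult_left_mono) auto
      also have "\<dots> < (1 + \<mu>) * ((2 * \<epsilon> + 2) * (4 * \<eta>)) + 4 * \<eta>"
        using q.diff_le[OF v(1)[of k] v(1)[of j]] M1[of k] M1[of j] kj by auto
      also have "\<dots> = \<delta>" using \<eta>(2) by (simp add: K_def algebra_simps)
      finally show "m ?w ?w + e ?w ?w < \<delta>" .
    qed
  qed
  obtain z where z: "z \<in> X" and lim: "(\<lambda>k. m (v k - z) (v k - z) + e (v k - z) (v k - z)) \<longlonglongrightarrow> 0"
    using complete[of v, OF v(2) cauchy] by blast
  have vz: "v k - z \<in> X" for k using v z m.X by (auto intro: subspace_diff)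
  have limm: "(\<lambda>k. m (v k - z) (v k - z)) \<longlonglongrightarrow> 0"
    by (rule tendsto_sandwich[OF _ _ tendsto_const lim])
      (use m.nonneg[OF vz] e.nonneg[OF vz] in \<open>auto intro!: always_eventually\<close>)
  have lime: "(\<lambda>k. e (v k - z) (v k - z)) \<longlonglongrightarrow> 0"
    by (rule tendsto_sandwich[OF _ _ tendsto_const lim])
      (use m.nonneg[OF vz] e.nonneg[OF vz] in \<open>auto intro!: always_eventually\<close>)
  have "m z (a i) = 0" if "i < n" for i
  proof -
    have "(\<lambda>k. m (v k) (a i)) \<longlonglongrightarrow> m z (a i)" by (rule m.tendsto_left[OF v(2) z a[OF that] limm])
    moreover have "m (v k) (a i) = 0" for k using v(1)[of k] that unfolding W_def by auto
    ultimately show ?thesis using LIMSEQ_unique[of "\<lambda>_. 0" _ 0] by auto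
  qed
  then have "z \<in> W" using z unfolding W_def by auto
  moreover have "m z z = 1"
    using m.tendsto_quadratic[OF v(2) z limm] v(3) by (simp add: LIMSEQ_const_iff)
  moreover have "e z z = \<mu>"
    using LIMSEQ_unique[OF e.tendsto_quadratic[OF v(2) z lime] vlim] .
  ultimately show ?thesis using \<mu>_le by auto
qed

text \<open>The last conjunct is the form in which completeness of the system is used: a vector
  orthogonal to all eigenvectors up to level \<open>t\<close> has Rayleigh quotient strictly above
  \<open>t\<close>. The strictness decides both counting arguments, since the counts include
  eigenvalues equal to \<open>t\<close>.\<close>

definition eigenbasis :: "(nat \<Rightarrow> 'v) \<Rightarrow> (nat \<Rightarrow> real) \<Rightarrow> bool" where
  "eigenbasis u \<Lambda> \<longleftrightarrow> (\<forall>n. u n \<in> X \<and> m (u n) (u n) = 1) \<and> (\<forall>i j. i \<noteq> j \<longrightarrow> m (u i) (u j) = 0) \<and>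
     (\<forall>n. \<forall>v\<in>X. e (u n) v = \<Lambda> n * m (u n) v) \<and> mono \<Lambda> \<and> (\<forall>t. finite {n. \<Lambda> n \<le> t}) \<and>
     (\<forall>t. \<forall>v\<in>X. (\<forall>n. \<Lambda> n \<le> t \<longrightarrow> m v (u n) = 0) \<longrightarrow> m v v > 0 \<longrightarrow> t * m v v < e v v)"

lemma eigenbasis_exists: "\<exists>u \<Lambda>. eigenbasis u \<Lambda>"
proof -
  define P where "P f n r \<longleftrightarrow> r \<in> X \<and> m r r = 1 \<and> (\<forall>i<n. m r (f i) = 0) \<and>
     (\<forall>w\<in>X. (\<forall>i<n. m w (f i) = 0) \<longrightarrow> e r r * m w w \<le> e w w)" for f and n :: nat and r
  have "\<exists>u. \<forall>n. P u n (u n)"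
  \<comment> \<open>Each vector depends on all earlier ones, so the choice runs along the well-order
    of the naturals. The first goal states that \<open>P\<close> looks only at earlier
    values.\<close>
  proof (rule dependent_wellorder_choice)
    show "P f x r = P g x r" if "\<And>y. y < x \<Longrightarrow> f y = g y" for r f g x
      unfolding P_def using that by auto
    fix n f assume f: "\<And>y. y < n \<Longrightarrow> P f y (f y)"
    then have fX: "\<And>i. i < n \<Longrightarrow> f i \<in> X" by (auto simp: P_def)
    obtain w where w: "\<And>i. i < Suc n \<Longrightarrow> w i \<in> X" "\<And>i. i < Suc n \<Longrightarrow> m (w i) (w i) > 0"
      "\<And>i j. i < Suc n \<Longrightarrow> j < Suc n \<Longrightarrow> i \<noteq> j \<Longrightarrow> m (w i) (w j) = 0"
      using infinite_dim[of "Suc n"] by blast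
    \<comment> \<open>\<open>n + 1\<close> orthogonal vectors of positive mass against
      \<open>n\<close> orthogonality conditions: some nontrivial combination lies in the complement
      of the vectors already chosen, so the next minimisation problem is not void.\<close>
    obtain c where c: "\<exists>i\<in>{..<Suc n}. c i \<noteq> 0" "\<forall>j\<in>{..<n}. (\<Sum>i<Suc n. c i * m (w i) (f j)) = 0"
      using homogeneous_system_nontrivial[of "{..<n}" "{..<Suc n}" "\<lambda>j i. m (w i) (f j)"] by auto
    let ?w = "\<Sum>i<Suc n. c i *\<^sub>R w i"
    have wX: "?w \<in> X" using w m.X by (intro subspace_sum subspace_scale) auto
    have "m ?w ?w = (\<Sum>i<Suc n. (c i)\<^sup>2 * m (w i) (w i))"
      using w by (intro m.orthogonal_sum) auto
    also have "\<dots> > 0"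
    proof -
      obtain i where i: "i < Suc n" "c i \<noteq> 0" using c by auto
      show ?thesis
      proof (rule sum_pos2[of _ i])
        show "0 < (c i)\<^sup>2 * m (w i) (w i)" using i w by simp
      qed (use i w m.nonneg in \<open>auto intro!: mult_nonneg_nonneg\<close>)
    qed
    finally have pos: "m ?w ?w > 0" .
    have orth: "\<forall>j<n. m ?w (f j) = 0"
    proof (intro allI impI)
      fix j assume "j < n"
      have "m ?w (f j) = (\<Sum>i<Suc n. c i * m (w i) (f j))" using w fX \<open>j < n\<close> by (intro m.sum_left) auto
      then show "m ?w (f j) = 0" using c \<open>j < n\<close> by auto
    qed
    show "\<exists>r. P f n r"
      using minimizer_exists[of n f ?w, OF fX] wX orth pos unfolding P_def by blast
  qed
  then obtain u where u: "\<And>n. P u n (u n)" by blast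
  define \<Lambda> where "\<Lambda> n = e (u n) (u n)" for n
  have uX: "u n \<in> X" and u1: "m (u n) (u n) = 1" for n using u by (auto simp: P_def)
  have orth: "m (u i) (u j) = 0" if "i \<noteq> j" for i j
  proof (cases "j < i")
    case True then show ?thesis using u[of i] by (auto simp: P_def)
  next
    case False
    then show ?thesis using u[of j] that m.sym[OF uX uX, of i j] by (auto simp: P_def)
  qed
  have min: "\<Lambda> n * m w w \<le> e w w" if "w \<in> X" "\<And>i. i < n \<Longrightarrow> m w (u i) = 0" for n w
    using u[of n] that by (auto simp: P_def \<Lambda>_def)
  \<comment> \<open>First variation: moving the minimiser \<open>u n\<close> by
    \<open>t *\<^sub>R v\<close> inside the complement gives a quadratic in \<open>t\<close> without
    constant term that is nonnegative for all \<open>t\<close>, so its linear coefficient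
    vanishes.\<close>
  have eig0: "e (u n) v = \<Lambda> n * m (u n) v" if v: "v \<in> X" and vo: "\<And>i. i < n \<Longrightarrow> m v (u i) = 0" for n v
  proof -
    define Q where "Q x y = e x y - \<Lambda> n * m x y" for x y
    have q: "0 \<le> 2 * t * Q (u n) v + t\<^sup>2 * Q v v" for t
    proof -
      have tv: "t *\<^sub>R v \<in> X" using m.X v by (simp add: subspace_scale)
      have wX: "u n + t *\<^sub>R v \<in> X" using m.X uX tv by (simp add: subspace_add)
      have "m (u n + t *\<^sub>R v) (u i) = 0" if "i < n" for i
        using that uX tv v vo orth[of n i] by (simp add: m.add_left m.scale_left)
      then have "\<Lambda> n * m (u n + t *\<^sub>R v) (u n + t *\<^sub>R v) \<le> e (u n + t *\<^sub>R v) (u n + t *\<^sub>R v)"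
        by (rule min[OF wX])
      then show ?thesis
        using m.add_expand[OF uX tv] e.add_expand[OF uX tv] u1 
        by (simp add: m.scale_right m.scale_left e.scale_left e.scale_right uX v tv Q_def \<Lambda>_def[symmetric]
            power2_eq_square algebra_simps)
    qed
    have "Q (u n) v = 0"
    proof (rule ccontr)
      assume ne: "Q (u n) v \<noteq> 0"
      \<comment> \<open>The added 1 keeps \<open>D\<close> positive even if
        \<open>Q v v = 0\<close>; at \<open>t = - Q (u n) v / D\<close> the quadratic is then at
        most \<open>- (Q (u n) v)\<^sup>2 / D\<close>.\<close>
      define D where "D = \<bar>Q v v\<bar> + 1"
      have D: "D > 0" "Q v v < D" unfolding D_def by auto
      have "0 \<le> 2 * (- Q (u n) v / D) * Q (u n) v + (- Q (u n) v / D)\<^sup>2 * Q v v" by (rule q)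
      also have "\<dots> \<le> 2 * (- Q (u n) v / D) * Q (u n) v + (- Q (u n) v / D)\<^sup>2 * D"
        using D by (intro add_left_mono mult_left_mono) auto
      also have "\<dots> = - (Q (u n) v)\<^sup>2 / D" using D by (simp add: power2_eq_square field_simps)
      finally show False using ne D by (simp add: divide_le_0_iff zero_le_divide_iff)
    qed
    then show ?thesis by (simp add: Q_def)
  qed
  \<comment> \<open>A general \<open>v\<close> differs from a vector of the complement by its
    projection \<open>p\<close> onto the earlier eigenvectors. Both sides vanish on
    \<open>p\<close>: by symmetry \<open>e (u n) (u i) = e (u i) (u n)\<close>, and the eigenvalue
    equation of the earlier \<open>u i\<close> applies to \<open>u n\<close>.\<close>
  have eig: "e (u n) v = \<Lambda> n * m (u n) v" if v: "v \<in> X" for n v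
  proof -
    define p where "p = (\<Sum>i<n. m v (u i) *\<^sub>R u i)"
    have pX: "p \<in> X" unfolding p_def using m.X uX by (intro subspace_sum subspace_scale) auto
    have wX: "v - p \<in> X" using m.X v pX by (simp add: subspace_diff)
    have "m p (u j) = m v (u j)" if "j < n" for j
    proof -
      have "m p (u j) = (\<Sum>i<n. m v (u i) * m (u i) (u j))" unfolding p_def using uX by (intro m.sum_left) auto
      also have "\<dots> = (\<Sum>i<n. if i = j then m v (u j) else 0)" using orth u1 by (intro sum.cong) auto
      finally show ?thesis using that by simp
    qed
    then have "m (v - p) (u j) = 0" if "j < n" for j using that v pX uX by (simp add: m.diff_left)
    then have 1: "e (u n) (v - p) = \<Lambda> n * m (u n) (v - p)" by (rule eig0[OF wX])
    have mp: "m (u n) p = 0"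
    proof -
      have "m (u n) p = (\<Sum>i<n. m v (u i) * m (u n) (u i))" unfolding p_def using uX by (intro m.sum_right) auto
      then show ?thesis using orth by (auto intro!: sum.neutral)
    qed
    have ep: "e (u n) p = 0"
    proof -
      have "e (u n) p = (\<Sum>i<n. m v (u i) * e (u n) (u i))" unfolding p_def using uX by (intro e.sum_right) auto
      also have "e (u n) (u i) = 0" if "i < n" for i
      proof -
        have "e (u i) (u n) = \<Lambda> i * m (u i) (u n)"
          by (rule eig0[OF uX]) (use that orth in auto)
        then show ?thesis using e.sym[OF uX uX, of i n] orth[of i n] that by simp
      qed
      then have "(\<Sum>i<n. m v (u i) * e (u n) (u i)) = 0" by (intro sum.neutral) auto
      finally show ?thesis .
    qed
    show ?thesis using 1 mp ep by (simp add: m.diff_right e.diff_right uX v pX)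
  qed
  have mono: "mono \<Lambda>"
  proof (rule incseq_SucI)
    fix n
    have "\<Lambda> n * m (u (Suc n)) (u (Suc n)) \<le> e (u (Suc n)) (u (Suc n))"
      by (rule min[OF uX]) (use orth in auto)
    then show "\<Lambda> n \<le> \<Lambda> (Suc n)" by (simp add: u1 \<Lambda>_def)
  qed
  have \<Lambda>0: "\<Lambda> n \<ge> 0" for n unfolding \<Lambda>_def using e.nonneg uX by auto
  \<comment> \<open>By monotonicity, infinitely many values up to \<open>t\<close> would mean that
    all of them are. Among \<open>N + 1\<close> eigenvectors some nontrivial combination is
    annihilated by all \<open>N\<close> functionals, and the compactness inequality then reads
    \<open>m \<le> m / 2\<close> for a vector of positive mass.\<close>
  have fin: "finite {n. \<Lambda> n \<le> t}" for t
  proof (rule ccontr)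
    assume inf: "infinite {n. \<Lambda> n \<le> t}"
    have all: "\<Lambda> n \<le> t" for n
    proof -
      obtain k where "k \<ge> n" "\<Lambda> k \<le> t" using inf unfolding infinite_nat_iff_unbounded_le by auto
      then show ?thesis using monoD[OF mono, of n k] by simp
    qed
    then have t: "t \<ge> 0" using \<Lambda>0 by (meson order_trans)
    define \<epsilon> where "\<epsilon> = 1 / (2 * (1 + t))"
    have \<epsilon>: "\<epsilon> > 0" "\<epsilon> * (1 + t) = 1 / 2" unfolding \<epsilon>_def using t by (auto simp: field_simps)
    obtain N :: nat and l B where lin: "\<And>i u v. i < N \<Longrightarrow> u \<in> X \<Longrightarrow> v \<in> X \<Longrightarrow> l i (u + v) = l i u + l i v"
      and linc: "\<And>i u c. i < N \<Longrightarrow> u \<in> X \<Longrightarrow> l i (c *\<^sub>R u) = c * l i u"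
      and lB: "\<And>i u. i < N \<Longrightarrow> u \<in> X \<Longrightarrow> (l i u)\<^sup>2 \<le> B * m u u"
      and cpt: "\<And>u. u \<in> X \<Longrightarrow> m u u \<le> \<epsilon> * (m u u + e u u) + (\<Sum>i<N. (l i u)\<^sup>2)"
      using compact[OF \<epsilon>(1)] by blast
    obtain c where c: "\<exists>i\<in>{..<Suc N}. c i \<noteq> 0" "\<forall>j\<in>{..<N}. (\<Sum>i<Suc N. c i * l j (u i)) = 0"
      using homogeneous_system_nontrivial[of "{..<N}" "{..<Suc N}" "\<lambda>j i. l j (u i)"] by auto
    have lsum: "l j (\<Sum>i<k. c i *\<^sub>R u i) = (\<Sum>i<k. c i * l j (u i))" if "j < N" for j k
    proof (induction k)
      case 0
      show ?case using linc[OF that uX, of 0] by simp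
    next
      case (Suc k)
      have "(\<Sum>i<k. c i *\<^sub>R u i) \<in> X" "c k *\<^sub>R u k \<in> X"
        using m.X uX by (auto intro!: subspace_sum subspace_scale)
      then show ?case using Suc lin[OF that] linc[OF that uX] by simp
    qed
    let ?w = "\<Sum>i<Suc N. c i *\<^sub>R u i"
    have wX: "?w \<in> X" using uX m.X by (intro subspace_sum subspace_scale) auto
    have mw: "m ?w ?w = (\<Sum>i<Suc N. (c i)\<^sup>2 * m (u i) (u i))"
      using uX orth by (intro m.orthogonal_sum) auto
    have ew: "e ?w ?w = (\<Sum>i<Suc N. (c i)\<^sup>2 * e (u i) (u i))"
      using uX orth eig by (intro e.orthogonal_sum) auto
    have "e ?w ?w \<le> (\<Sum>i<Suc N. t * ((c i)\<^sup>2 * m (u i) (u i)))"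
      unfolding ew using all by (intro sum_mono) (auto simp: u1 \<Lambda>_def[symmetric] mult.commute intro!: mult_right_mono)
    also have "\<dots> = t * m ?w ?w" unfolding mw by (rule sum_distrib_left[symmetric])
    finally have et: "e ?w ?w \<le> t * m ?w ?w" .
    obtain i where i: "i < Suc N" "c i \<noteq> 0" using c by auto
    have pos: "m ?w ?w > 0"
      unfolding mw by (rule sum_pos2[of _ i]) (use i u1 in auto)
    have "m ?w ?w \<le> \<epsilon> * (m ?w ?w + e ?w ?w) + (\<Sum>i<N. (l i ?w)\<^sup>2)" by (rule cpt[OF wX])
    also have "(\<Sum>i<N. (l i ?w)\<^sup>2) = 0"
    proof (rule sum.neutral, rule ballI)
      fix j assume "j \<in> {..<N}"
      then have "l j ?w = 0" using lsum[of j "Suc N"] c by auto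
      then show "(l j ?w)\<^sup>2 = 0" by simp
    qed
    also have "\<epsilon> * (m ?w ?w + e ?w ?w) \<le> \<epsilon> * (m ?w ?w + t * m ?w ?w)"
      using et \<epsilon> by (intro mult_left_mono) auto
    also have "\<dots> = (\<epsilon> * (1 + t)) * m ?w ?w" by (simp add: algebra_simps)
    also have "\<dots> = m ?w ?w / 2" unfolding \<epsilon>(2) by simp
    finally show False using pos by simp
  qed
  \<comment> \<open>At the first index \<open>k\<close> with \<open>t < \<Lambda> k\<close>, the
    vector \<open>v\<close> is admissible in the minimisation that produced \<open>u k\<close>, so
    its Rayleigh quotient is at least \<open>\<Lambda> k\<close>.\<close>
  have strict: "t * m v v < e v v"
    if v: "v \<in> X" and vo: "\<And>n. \<Lambda> n \<le> t \<Longrightarrow> m v (u n) = 0" and pos: "m v v > 0" for t v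
  proof -
    have "\<exists>n. t < \<Lambda> n"
    proof (rule ccontr)
      assume "\<not> ?thesis"
      then have "{n. \<Lambda> n \<le> t} = UNIV" by (auto simp: not_less)
      then show False using fin[of t] by simp
    qed
    define k where "k = (LEAST n. t < \<Lambda> n)"
    have k: "t < \<Lambda> k" unfolding k_def using \<open>\<exists>n. t < \<Lambda> n\<close> by (rule LeastI_ex)
    have "\<Lambda> i \<le> t" if "i < k" for i using not_less_Least[OF that[unfolded k_def]] by simp
    then have "\<Lambda> k * m v v \<le> e v v" by (intro min[OF v] vo)
    moreover have "t * m v v < \<Lambda> k * m v v" using k pos by simp
    ultimately show ?thesis by simp
  qed
  show ?thesis
    unfolding eigenbasis_def using uX u1 orth eig mono fin strict
    by (intro exI[of _ u] exI[of _ \<Lambda>]) blast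
qed

lemma
  assumes "eigenbasis u \<Lambda>"
  shows eigenbasis_mem: "u n \<in> X" and eigenbasis_norm: "m (u n) (u n) = 1"
    and eigenbasis_orth: "i \<noteq> j \<Longrightarrow> m (u i) (u j) = 0"
    and eigenbasis_eigen: "v \<in> X \<Longrightarrow> e (u n) v = \<Lambda> n * m (u n) v"
    and eigenbasis_mono: "mono \<Lambda>" and eigenbasis_finite: "finite {n. \<Lambda> n \<le> t}"
    and eigenbasis_less: "v \<in> X \<Longrightarrow> (\<And>n. \<Lambda> n \<le> t \<Longrightarrow> m v (u n) = 0) \<Longrightarrow> m v v > 0 \<Longrightarrow> t * m v v < e v v"
  using assms unfolding eigenbasis_def by auto

lemma eigenbasis_le:
  assumes "eigenbasis u \<Lambda>" "v \<in> X" "\<And>n. \<Lambda> n \<le> t \<Longrightarrow> m v (u n) = 0"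
  shows "t * m v v \<le> e v v"
proof (cases "m v v = 0")
  case False
  then have "m v v > 0" using m.nonneg[OF assms(2)] by simp
  from eigenbasis_less[OF assms(1,2) _ this, of t] assms(3) show ?thesis by auto
qed (use e.nonneg[OF assms(2)] in simp)

text \<open>If there were more vectors \<open>w i\<close> than eigenvalues up to \<open>t\<close>, a
  nontrivial combination would be orthogonal to all low eigenvectors. Its quotient would then exceed
  \<open>t\<close>, while orthogonality in both forms keeps it at most \<open>t\<close>.\<close>

lemma low_energy_family_card_le:
  assumes eb: "eigenbasis u \<Lambda>" and I: "finite I" and w: "\<And>i. i \<in> I \<Longrightarrow> w i \<in> X"
    and m1: "\<And>i. i \<in> I \<Longrightarrow> m (w i) (w i) = 1" and e1: "\<And>i. i \<in> I \<Longrightarrow> e (w i) (w i) \<le> t"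
    and m0: "\<And>i j. i \<in> I \<Longrightarrow> j \<in> I \<Longrightarrow> i \<noteq> j \<Longrightarrow> m (w i) (w j) = 0"
    and e0: "\<And>i j. i \<in> I \<Longrightarrow> j \<in> I \<Longrightarrow> i \<noteq> j \<Longrightarrow> e (w i) (w j) = 0"
  shows "card I \<le> card {n. \<Lambda> n \<le> t}"
proof (rule ccontr)
  assume "\<not> ?thesis"
  then obtain c where c: "\<exists>i\<in>I. c i \<noteq> 0" "\<forall>n\<in>{n. \<Lambda> n \<le> t}. (\<Sum>i\<in>I. c i * m (w i) (u n)) = 0"
    using homogeneous_system_nontrivial[OF eigenbasis_finite[OF eb] I, of t "\<lambda>n i. m (w i) (u n)"] by auto
  let ?w = "\<Sum>i\<in>I. c i *\<^sub>R w i"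
  have wX: "?w \<in> X" using w m.X by (intro subspace_sum subspace_scale) auto
  have mw: "m ?w ?w = (\<Sum>i\<in>I. (c i)\<^sup>2 * m (w i) (w i))" by (rule m.orthogonal_sum[OF I w m0])
  have ew: "e ?w ?w = (\<Sum>i\<in>I. (c i)\<^sup>2 * e (w i) (w i))" by (rule e.orthogonal_sum[OF I w e0])
  obtain i where i: "i \<in> I" "c i \<noteq> 0" using c by auto
  have pos: "m ?w ?w > 0" unfolding mw by (rule sum_pos2[OF I i(1)]) (use i m1 in auto)
  have "t * m ?w ?w < e ?w ?w"
  proof (rule eigenbasis_less[OF eb wX _ pos])
    fix n assume "\<Lambda> n \<le> t"
    moreover have "m ?w (u n) = (\<Sum>i\<in>I. c i * m (w i) (u n))"
      using w eigenbasis_mem[OF eb] by (intro m.sum_left) auto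
    ultimately show "m ?w (u n) = 0" using c by auto
  qed
  also have "e ?w ?w \<le> (\<Sum>i\<in>I. t * ((c i)\<^sup>2 * m (w i) (w i)))"
    unfolding ew using m1 e1 by (intro sum_mono) (auto simp: mult.commute intro!: mult_right_mono)
  also have "\<dots> = t * m ?w ?w" unfolding mw by (simp add: sum_distrib_left)
  finally show False by simp
qed

text \<open>The upper bound for multiplicities. A surplus eigenvector for \<open>t\<close> can be
  made orthogonal to the \<open>u k\<close> with \<open>\<Lambda> k = t\<close>; symmetry of
  \<open>e\<close> makes it orthogonal to the remaining ones. Being orthogonal to the whole basis
  while satisfying \<open>e = t * m\<close>, it has mass 0, against independence.\<close>

lemma eigenvector_family_card_le:
  assumes eb: "eigenbasis u \<Lambda>" and v: "\<And>i. i < n \<Longrightarrow> v i \<in> X"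
    and eig: "\<And>i z. i < n \<Longrightarrow> z \<in> X \<Longrightarrow> e (v i) z = t * m (v i) z"
    and indep: "\<And>c. m (\<Sum>i<n. c i *\<^sub>R v i) (\<Sum>i<n. c i *\<^sub>R v i) = 0 \<Longrightarrow> \<forall>i<n. c i = 0"
  shows "n \<le> card {k. \<Lambda> k = t}"
proof (rule ccontr)
  assume "\<not> ?thesis"
  then have lt: "card {k. \<Lambda> k = t} < card {..<n}" by simp
  have fin: "finite {k. \<Lambda> k = t}" by (rule finite_subset[OF _ eigenbasis_finite[OF eb, of t]]) auto
  obtain c where c: "\<exists>i\<in>{..<n}. c i \<noteq> 0" "\<forall>k\<in>{k. \<Lambda> k = t}. (\<Sum>i<n. c i * m (v i) (u k)) = 0"
    using homogeneous_system_nontrivial[OF fin _ lt, of "\<lambda>k i. m (v i) (u k)"] by auto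
  let ?w = "\<Sum>i<n. c i *\<^sub>R v i"
  have wX: "?w \<in> X" using v m.X by (intro subspace_sum subspace_scale) auto
  have ew: "e ?w z = t * m ?w z" if z: "z \<in> X" for z
    using e.sum_left[of "{..<n}" v z c] m.sum_left[of "{..<n}" v z c] v z eig
    by (simp add: sum_distrib_left algebra_simps)
  have "m ?w (u k) = 0" for k
  proof (cases "\<Lambda> k = t")
    case True
    moreover have "m ?w (u k) = (\<Sum>i<n. c i * m (v i) (u k))"
      using v eigenbasis_mem[OF eb] by (intro m.sum_left) auto
    ultimately show ?thesis using c by auto
  next
    case False
    have "\<Lambda> k * m (u k) ?w = t * m ?w (u k)"
      using ew[OF eigenbasis_mem[OF eb], of k] eigenbasis_eigen[OF eb wX, of k]
        e.sym[OF wX eigenbasis_mem[OF eb], of k] by simp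
    then show ?thesis using False m.sym[OF wX eigenbasis_mem[OF eb], of k] by auto
  qed
  then have "\<not> m ?w ?w > 0" using eigenbasis_less[OF eb wX, of t] ew[OF wX] by auto
  then have "m ?w ?w = 0" using m.nonneg[OF wX] by simp
  then show False using indep c by auto
qed

end

section \<open>Square integrable functions\<close>

text \<open>Together with pointwise addition this turns functions, and pairs of functions, into
  vectors to which the abstract forms apply.\<close>

instantiation "fun" :: (type, real_vector) real_vector
begin

definition "scaleR c f = (\<lambda>x. c *\<^sub>R f x)"

instance
  by standard (auto simp: scaleR_fun_def fun_eq_iff scaleR_add_left scaleR_add_right)

end

lemma scaleR_fun_apply [simp]: "(c *\<^sub>R f) x = c *\<^sub>R f x"
  by (simp add: scaleR_fun_def)

lemma sum_fun_apply: "(\<Sum>i\<in>I. f i) x = (\<Sum>i\<in>I. f i x)"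
  by (induction I rule: infinite_finite_induct) auto

text \<open>For an arbitrary measure, because the forms live on \<open>lebesgue_on\<close> while
  translations and Fubini are carried out over \<open>lborel\<close>.\<close>

definition L2 :: "'x measure \<Rightarrow> ('x \<Rightarrow> 'b::euclidean_space) set" where
  "L2 M = {u. u \<in> borel_measurable M \<and> integrable M (\<lambda>x. (norm (u x))\<^sup>2)}"

definition ip :: "'x measure \<Rightarrow> ('x \<Rightarrow> 'b::euclidean_space) \<Rightarrow> ('x \<Rightarrow> 'b) \<Rightarrow> real" where
  "ip M u v = (LINT x|M. u x \<bullet> v x)"

lemma square_integrable_iff_L2: "square_integrable \<Omega> u \<longleftrightarrow> u \<in> L2 (lebesgue_on \<Omega>)"
  by (simp add: square_integrable_def L2_def)

lemma L2_measurable: "u \<in> L2 M \<Longrightarrow> u \<in> borel_measurable M"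
  by (simp add: L2_def)

lemma L2_integrable_square: "u \<in> L2 M \<Longrightarrow> integrable M (\<lambda>x. (norm (u x))\<^sup>2)"
  by (simp add: L2_def)

lemma two_mult_le_squares: "2 * (a * b) \<le> a\<^sup>2 + (b::real)\<^sup>2"
  using sum_squares_bound[of a b] by (simp add: mult.assoc)

lemma mult_le_squares: "a * b \<le> a\<^sup>2 + (b::real)\<^sup>2"
proof -
  have "0 \<le> a\<^sup>2 + b\<^sup>2" by simp
  then show ?thesis using two_mult_le_squares[of a b] by linarith
qed

lemma L2_inner_integrable:
  assumes "u \<in> L2 M" "v \<in> L2 M"
  shows "integrable M (\<lambda>x. u x \<bullet> v x)"
proof (rule Bochner_Integration.integrable_bound)
  show "integrable M (\<lambda>x. (norm (u x))\<^sup>2 + (norm (v x))\<^sup>2)"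
    using assms by (simp add: L2_def)
  show "(\<lambda>x. u x \<bullet> v x) \<in> borel_measurable M"
    using assms by (auto simp: L2_def)
  show "AE x in M. norm (u x \<bullet> v x) \<le> norm ((norm (u x))\<^sup>2 + (norm (v x))\<^sup>2)"
    using order_trans[OF Cauchy_Schwarz_ineq2 mult_le_squares] by (auto intro!: AE_I2)
qed

lemma L2_scaleR_integrable:
  fixes u :: "'x \<Rightarrow> real"
  assumes "u \<in> L2 M" "v \<in> L2 M"
  shows "integrable M (\<lambda>x. u x *\<^sub>R v x)"
proof (rule Bochner_Integration.integrable_bound)
  show "integrable M (\<lambda>x. (norm (u x))\<^sup>2 + (norm (v x))\<^sup>2)"
    using assms by (simp add: L2_def)
  show "(\<lambda>x. u x *\<^sub>R v x) \<in> borel_measurable M"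
    using assms by (auto simp: L2_def)
  show "AE x in M. norm (u x *\<^sub>R v x) \<le> norm ((norm (u x))\<^sup>2 + (norm (v x))\<^sup>2)"
  proof (rule AE_I2)
    fix x
    show "norm (u x *\<^sub>R v x) \<le> norm ((norm (u x))\<^sup>2 + (norm (v x))\<^sup>2)"
      using mult_le_squares[of "\<bar>u x\<bar>" "norm (v x)"] by simp
  qed
qed

lemma L2_add:
  assumes "u \<in> L2 M" "v \<in> L2 M"
  shows "(\<lambda>x. u x + v x) \<in> L2 M"
proof -
  have "integrable M (\<lambda>x. (norm (u x + v x))\<^sup>2)"
  proof (rule Bochner_Integration.integrable_bound)
    show "integrable M (\<lambda>x. (norm (u x))\<^sup>2 + 2 * (u x \<bullet> v x) + (norm (v x))\<^sup>2)"
      using assms L2_inner_integrable[OF assms] by (simp add: L2_def)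
    show "(\<lambda>x. (norm (u x + v x))\<^sup>2) \<in> borel_measurable M"
      using assms by (auto simp: L2_def)
    show "AE x in M. norm ((norm (u x + v x))\<^sup>2) \<le> norm ((norm (u x))\<^sup>2 + 2 * (u x \<bullet> v x) + (norm (v x))\<^sup>2)"
      by (auto intro!: AE_I2 simp: power2_norm_eq_inner algebra_simps inner_commute)
  qed
  then show ?thesis using assms by (auto simp: L2_def)
qed

lemma L2_scale: "u \<in> L2 M \<Longrightarrow> (\<lambda>x. c *\<^sub>R u x) \<in> L2 M"
  by (auto simp: L2_def power_mult_distrib)

lemma L2_diff:
  assumes "u \<in> L2 M" "v \<in> L2 M"
  shows "(\<lambda>x. u x - v x) \<in> L2 M"
  using L2_add[OF assms(1) L2_scale[OF assms(2), of "-1"]] by simp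

lemma subspace_L2: "subspace (L2 M)"
  unfolding subspace_def
proof (intro conjI ballI allI)
  show "0 \<in> L2 M" by (simp add: L2_def zero_fun_def)
  show "u + v \<in> L2 M" if "u \<in> L2 M" "v \<in> L2 M" for u v
    using L2_add[OF that] by (simp add: plus_fun_def)
  show "c *\<^sub>R u \<in> L2 M" if "u \<in> L2 M" for c u
    using L2_scale[OF that] by (simp add: scaleR_fun_def)
qed

lemma lebesgue_on_integrable_subset:
  fixes f :: "'a::euclidean_space \<Rightarrow> 'b::euclidean_space"
  assumes "integrable (lebesgue_on S) f" "T \<subseteq> S" "T \<in> sets lebesgue" "S \<in> sets lebesgue"
  shows "integrable (lebesgue_on T) f"
proof -
  have "integrable lebesgue (\<lambda>x. indicator S x *\<^sub>R f x)"
    using assms by (simp add: integrable_restrict_space)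
  then have "integrable lebesgue (\<lambda>x. indicator T x *\<^sub>R (indicator S x *\<^sub>R f x))"
    using assms(3) by (intro integrable_mult_indicator[where f="\<lambda>x. indicator S x *\<^sub>R f x"]) auto
  also have "(\<lambda>x. indicator T x *\<^sub>R (indicator S x *\<^sub>R f x)) = (\<lambda>x. indicator T x *\<^sub>R f x)"
    using assms(2) by (auto simp: indicator_def fun_eq_iff)
  finally show ?thesis using assms by (simp add: integrable_restrict_space)
qed

lemma L2_subset:
  assumes "u \<in> L2 (lebesgue_on S)" "T \<subseteq> S" "T \<in> sets lebesgue" "S \<in> sets lebesgue"
  shows "u \<in> L2 (lebesgue_on T)"
proof -
  have "u \<in> borel_measurable (lebesgue_on T)"
    by (rule measurable_restrict_mono[OF L2_measurable[OF assms(1)] assms(2)])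
  moreover have "integrable (lebesgue_on T) (\<lambda>x. (norm (u x))\<^sup>2)"
    by (rule lebesgue_on_integrable_subset[OF L2_integrable_square[OF assms(1)] assms(2-4)])
  ultimately show ?thesis by (simp add: L2_def)
qed

interpretation L2: psd_form "L2 M" "ip M" for M
proof
  show "subspace (L2 M)" by (rule subspace_L2)
  fix u v w :: "'a \<Rightarrow> 'b" and c
  assume u: "u \<in> L2 M" and v: "v \<in> L2 M"
  show "ip M u v = ip M v u" by (simp add: ip_def inner_commute)
  show "ip M (c *\<^sub>R u) v = c * ip M u v"
    by (simp add: ip_def)
  show "0 \<le> ip M u u" by (simp add: ip_def)
  assume w: "w \<in> L2 M"
  show "ip M (u + v) w = ip M u w + ip M v w"
    using L2_inner_integrable[OF u w] L2_inner_integrable[OF v w] by (simp add: ip_def inner_add_left)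
qed

lemma ip_self: "ip M u u = (LINT x|M. (norm (u x))\<^sup>2)"
  by (simp add: ip_def power2_norm_eq_inner)

lemma nn_integral_norm_square:
  "u \<in> L2 M \<Longrightarrow> (\<integral>\<^sup>+x. ennreal ((norm (u x))\<^sup>2) \<partial>M) = ennreal (ip M u u)"
  unfolding ip_self by (rule nn_integral_eq_integral) (auto simp: L2_def)

lemma L2_null_iff:
  assumes "u \<in> L2 M"
  shows "ip M u u = 0 \<longleftrightarrow> (AE x in M. u x = 0)"
  unfolding ip_self using integral_nonneg_eq_0_iff_AE[OF L2_integrable_square[OF assms]] by auto

lemma ip_diff_eq: "ip M (u - v) (u - v) = (LINT x|M. (norm (u x - v x))\<^sup>2)"
  by (simp add: ip_self)

text \<open>The hypothesis bounds the steps by \<open>sqrt C * (1/2) ^ k\<close>, so the telescoping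
  series converges absolutely. It turns a finite weighted sum of squares into pointwise
  convergence.\<close>

lemma convergent_of_geometric_steps:
  fixes a :: "nat \<Rightarrow> 'b::banach"
  assumes "\<And>k. 4 ^ k * (norm (a (Suc k) - a k))\<^sup>2 \<le> C"
  shows "convergent a"
proof -
  have C: "C \<ge> 0" using order_trans[OF _ assms[of 0]] by simp
  have "norm (a (Suc k) - a k) \<le> sqrt C * (1/2) ^ k" for k
  proof (rule power2_le_imp_le)
    have p: "((1/2) ^ k)\<^sup>2 * (4::real) ^ k = 1"
      by (induction k) (simp_all add: power2_eq_square)
    have "(norm (a (Suc k) - a k))\<^sup>2 = (4 ^ k * (norm (a (Suc k) - a k))\<^sup>2) * ((1/2) ^ k)\<^sup>2"
    proof -
      have "x = (4 ^ k * x) * y" if "y * (4::real) ^ k = 1" for x y :: real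
      proof -
        have "(4 ^ k * x) * y = x * (y * 4 ^ k)" by (simp only: ac_simps)
        then show ?thesis using that by simp
      qed
      then show ?thesis using p by blast
    qed
    also have "\<dots> \<le> C * ((1/2) ^ k)\<^sup>2" using assms[of k] by (rule mult_right_mono) simp
    also have "\<dots> = (sqrt C * (1/2) ^ k)\<^sup>2" using C by (simp only: power_mult_distrib real_sqrt_pow2)
    finally show "(norm (a (Suc k) - a k))\<^sup>2 \<le> (sqrt C * (1/2) ^ k)\<^sup>2" .
  qed (use C in simp)
  moreover have "summable (\<lambda>k. sqrt C * (1/2) ^ k)"
    by (intro summable_mult summable_geometric) simp
  ultimately have "summable (\<lambda>k. a (Suc k) - a k)"
    by (blast intro: summable_comparison_test')
  then have "convergent (\<lambda>n. \<Sum>k<n. a (Suc k) - a k)" by (simp add: summable_iff_convergent)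
  then have "convergent (\<lambda>n. a n - a 0)" by (simp add: sum_lessThan_telescope)
  then have "convergent (\<lambda>n. (a n - a 0) + a 0)" by (intro convergent_add convergent_const)
  then show ?thesis by simp
qed

text \<open>Riesz-Fischer: a rapidly Cauchy subsequence converges almost everywhere, and Fatou
  transfers the Cauchy bounds to the pointwise limit.\<close>

lemma L2_complete:
  fixes s :: "nat \<Rightarrow> 'x \<Rightarrow> 'b::euclidean_space"
  assumes s: "\<And>n. s n \<in> L2 M"
    and cauchy: "\<And>\<epsilon>. \<epsilon> > 0 \<Longrightarrow> \<exists>N. \<forall>k\<ge>N. \<forall>l\<ge>N. ip M (s k - s l) (s k - s l) < \<epsilon>"
  shows "\<exists>u\<in>L2 M. (\<lambda>k. ip M (s k - u) (s k - u)) \<longlonglongrightarrow> 0"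
proof -
  have sd: "s k - s l \<in> L2 M" for k l by (rule subspace_diff[OF subspace_L2 s s])
  have [measurable]: "s n \<in> borel_measurable M" for n using s by (rule L2_measurable)
  have nn: "(\<integral>\<^sup>+x. ennreal ((norm (s k x - s l x))\<^sup>2) \<partial>M) = ennreal (ip M (s k - s l) (s k - s l))" for k l
    using nn_integral_norm_square[OF sd] by simp
  have "\<exists>N. \<forall>i\<ge>N. \<forall>l\<ge>N. ip M (s i - s l) (s i - s l) < (1/8) ^ k" for k :: nat
    by (rule cauchy) simp
  then obtain N where N: "\<And>k i l. i \<ge> N k \<Longrightarrow> l \<ge> N k \<Longrightarrow> ip M (s i - s l) (s i - s l) < (1/8) ^ k"
    by metis
  \<comment> \<open>The partial sums make \<open>r\<close> monotone with
    \<open>N k \<le> r k\<close>; the extra \<open>k\<close> makes it unbounded.\<close>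
  define r where "r k = (\<Sum>i\<le>k. N i) + k" for k
  have rN: "r k \<ge> N k" for k unfolding r_def by (simp add: trans_le_add1 member_le_sum)
  have r_mono: "r k \<le> r (Suc k)" for k unfolding r_def by simp
  have r_ge: "r k \<ge> k" for k unfolding r_def by simp
  \<comment> \<open>The weights \<open>4 ^ k\<close> still leave integrals of at most
    \<open>(1/2) ^ k\<close> because the subsequence moves by less than \<open>(1/8) ^ k\<close>.
    Almost everywhere finiteness of the sum then bounds every weighted step.\<close>
  define d where "d k x = 4 ^ k * (norm (s (r (Suc k)) x - s (r k) x))\<^sup>2" for k x
  have [measurable]: "d k \<in> borel_measurable M" for k unfolding d_def by measurable
  have "(\<integral>\<^sup>+x. (\<Sum>k. ennreal (d k x)) \<partial>M) = (\<Sum>k. \<integral>\<^sup>+x. ennreal (d k x) \<partial>M)"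
    by (rule nn_integral_suminf) measurable
  also have "\<dots> \<le> (\<Sum>k. ennreal ((1/2) ^ k))"
  proof (intro suminf_le summableI)
    fix k
    have "(\<integral>\<^sup>+x. ennreal (d k x) \<partial>M) = ennreal (4 ^ k) * ennreal (ip M (s (r (Suc k)) - s (r k)) (s (r (Suc k)) - s (r k)))"
      unfolding d_def by (simp add: ennreal_mult nn_integral_cmult nn)
    also have "\<dots> = ennreal (4 ^ k * ip M (s (r (Suc k)) - s (r k)) (s (r (Suc k)) - s (r k)))"
      using L2.nonneg[OF sd] by (simp add: ennreal_mult)
    also have "\<dots> \<le> ennreal (4 ^ k * (1/8) ^ k)"
      using N[of k "r (Suc k)" "r k"] rN[of k] r_mono[of k] by (intro ennreal_leI mult_left_mono) auto
    also have "4 ^ k * (1/8) ^ k = (4 * (1/8)::real) ^ k" by (rule power_mult_distrib[symmetric])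
    also have "4 * (1/8) = (1/2::real)" by simp
    finally show "(\<integral>\<^sup>+x. ennreal (d k x) \<partial>M) \<le> ennreal ((1/2) ^ k)" .
  qed
  also have "\<dots> = ennreal (\<Sum>k. (1/2) ^ k)"
    by (rule suminf_ennreal2) (auto intro!: summable_geometric)
  also have "\<dots> < \<infinity>" by simp
  finally have "(\<integral>\<^sup>+x. (\<Sum>k. ennreal (d k x)) \<partial>M) \<noteq> \<infinity>" by simp
  then have "AE x in M. (\<Sum>k. ennreal (d k x)) \<noteq> \<infinity>"
    by (intro nn_integral_noteq_infinite) measurable
  then have conv: "AE x in M. convergent (\<lambda>k. s (r k) x)"
  proof (eventually_elim)
    fix x assume fin: "(\<Sum>k. ennreal (d k x)) \<noteq> \<infinity>"
    obtain C where C: "(\<Sum>k. ennreal (d k x)) = ennreal C" "C \<ge> 0"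
      using fin by (cases "(\<Sum>k. ennreal (d k x))") auto
    have "ennreal (d k x) \<le> ennreal C" for k
      unfolding C(1)[symmetric] using sum_le_suminf[of "\<lambda>k. ennreal (d k x)" "{k}"] by simp
    then have "d k x \<le> C" for k using C by simp
    then show "convergent (\<lambda>k. s (r k) x)"
      by (intro convergent_of_geometric_steps[of _ C]) (simp add: d_def)
  qed
  define u where "u x = lim (\<lambda>k. s (r k) x)" for x
  have [measurable]: "u \<in> borel_measurable M" unfolding u_def by measurable
  \<comment> \<open>Fatou along the subsequence: a bound on the distance from \<open>s n\<close> to
    all later terms passes to the distance from \<open>s n\<close> to the limit.\<close>
  have bound: "(\<integral>\<^sup>+x. ennreal ((norm (s n x - u x))\<^sup>2) \<partial>M) \<le> ennreal \<epsilon>"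
    if n: "\<And>l. l \<ge> n \<Longrightarrow> ip M (s n - s l) (s n - s l) \<le> \<epsilon>" for n \<epsilon>
  proof -
    have "AE x in M. ennreal ((norm (s n x - u x))\<^sup>2) = liminf (\<lambda>k. ennreal ((norm (s n x - s (r k) x))\<^sup>2))"
      using conv
    proof eventually_elim
      fix x assume "convergent (\<lambda>k. s (r k) x)"
      then have "(\<lambda>k. s (r k) x) \<longlonglongrightarrow> u x" by (simp add: u_def convergent_LIMSEQ_iff)
      then have "(\<lambda>k. ennreal ((norm (s n x - s (r k) x))\<^sup>2)) \<longlonglongrightarrow> ennreal ((norm (s n x - u x))\<^sup>2)"
        by (intro tendsto_intros) auto
      then show "ennreal ((norm (s n x - u x))\<^sup>2) = liminf (\<lambda>k. ennreal ((norm (s n x - s (r k) x))\<^sup>2))"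
        by (intro lim_imp_Liminf[symmetric]) auto
    qed
    then have "(\<integral>\<^sup>+x. ennreal ((norm (s n x - u x))\<^sup>2) \<partial>M)
        = (\<integral>\<^sup>+x. liminf (\<lambda>k. ennreal ((norm (s n x - s (r k) x))\<^sup>2)) \<partial>M)"
      by (rule nn_integral_cong_AE)
    also have "\<dots> \<le> liminf (\<lambda>k. \<integral>\<^sup>+x. ennreal ((norm (s n x - s (r k) x))\<^sup>2) \<partial>M)"
      by (rule nn_integral_liminf) measurable
    also have "\<dots> \<le> ennreal \<epsilon>"
    proof -
      have "\<forall>\<^sub>F k in sequentially. (\<integral>\<^sup>+x. ennreal ((norm (s n x - s (r k) x))\<^sup>2) \<partial>M) \<le> ennreal \<epsilon>"
        unfolding nn eventually_sequentially
        by (intro exI[of _ n] allI impI ennreal_leI n) (use r_ge order_trans in blast)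
      then show ?thesis by (intro Liminf_le) auto
    qed
    finally show ?thesis .
  qed
  \<comment> \<open>Fatou with the crude bound 1 shows that \<open>s n0 - u\<close> is square
    integrable, and therefore \<open>u\<close> is too.\<close>
  obtain n0 where n0: "\<And>k l. k \<ge> n0 \<Longrightarrow> l \<ge> n0 \<Longrightarrow> ip M (s k - s l) (s k - s l) < 1"
    using cauchy[of 1] by auto
  have "(\<integral>\<^sup>+x. ennreal ((norm (s n0 x - u x))\<^sup>2) \<partial>M) \<le> ennreal 1"
    by (rule bound) (use n0 in \<open>auto intro: less_imp_le\<close>)
  then have "(\<integral>\<^sup>+x. ennreal ((norm (s n0 x - u x))\<^sup>2) \<partial>M) < \<infinity>"
    using order.strict_trans1 by fastforce
  then have "(\<lambda>x. s n0 x - u x) \<in> L2 M"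
    unfolding L2_def by (auto intro!: integrableI_bounded)
  from L2_diff[OF s[of n0] this] have u: "u \<in> L2 M" by simp
  have ud: "s k - u \<in> L2 M" for k using subspace_diff[OF subspace_L2 s u] .
  have "(\<lambda>k. ip M (s k - u) (s k - u)) \<longlonglongrightarrow> 0"
  proof (rule LIMSEQ_I)
    fix \<epsilon> :: real assume "\<epsilon> > 0"
    then obtain N where N: "\<And>k l. k \<ge> N \<Longrightarrow> l \<ge> N \<Longrightarrow> ip M (s k - s l) (s k - s l) < \<epsilon> / 2"
      using cauchy[of "\<epsilon> / 2"] by auto
    show "\<exists>no. \<forall>n\<ge>no. norm (ip M (s n - u) (s n - u) - 0) < \<epsilon>"
    proof (intro exI[of _ N] allI impI)
      fix n assume "n \<ge> N"
      have "ennreal (ip M (s n - u) (s n - u)) \<le> ennreal (\<epsilon> / 2)"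
        unfolding nn_integral_norm_square[OF ud, symmetric] minus_apply
        by (rule bound) (use N \<open>n \<ge> N\<close> in \<open>auto intro!: less_imp_le\<close>)
      then have "ip M (s n - u) (s n - u) \<le> \<epsilon> / 2" using \<open>\<epsilon> > 0\<close> by simp
      then show "norm (ip M (s n - u) (s n - u) - 0) < \<epsilon>"
        using \<open>\<epsilon> > 0\<close> L2.nonneg[OF ud] by simp
    qed
  qed
  then show ?thesis using u by blast
qed

section \<open>Test functions\<close>

lemma GDERIV_unique: "GDERIV f x :> a \<Longrightarrow> GDERIV f x :> b \<Longrightarrow> a = b"
proof -
  assume "GDERIV f x :> a" "GDERIV f x :> b"
  then have "(\<lambda>h. h \<bullet> a) = (\<lambda>h. h \<bullet> b)"
    unfolding gderiv_def by (rule has_derivative_unique)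
  then have "\<forall>h. h \<bullet> a = h \<bullet> b" by (simp add: fun_eq_iff)
  then show "a = b" by (simp only: vector_eq_ldot)
qed

lemma GDERIV_continuous: "GDERIV f x :> a \<Longrightarrow> isCont f x"
  unfolding gderiv_def by (rule has_derivative_continuous)

lemma C_k_continuous:
  assumes "C_k k f"
  shows "continuous_on UNIV f"
proof (cases k)
  case 0
  then show ?thesis using assms by simp
next
  case (Suc n)
  then show ?thesis using assms GDERIV_continuous by (auto intro!: continuous_at_imp_continuous_on)
qed

lemma C_k_SucD: "C_k (Suc k) f \<Longrightarrow> C_k k f"
proof (induction k arbitrary: f)
  case 0
  then show ?case using C_k_continuous[of "Suc 0" f] by simp
next
  case (Suc k)
  from Suc.prems obtain f' where "\<forall>x. GDERIV f x :> f' x" "\<forall>b\<in>Basis. C_k (Suc k) (\<lambda>x. f' x \<bullet> b)"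
    using C_k.simps(2)[of "Suc k" f] by blast
  then show ?case using Suc.IH by (subst C_k.simps) blast
qed

lemma C_k_const: "C_k k (\<lambda>x. c)"
proof (induction k arbitrary: c)
  case (Suc k)
  show ?case
    by (subst C_k.simps, rule exI[of _ "\<lambda>_. 0"]) (simp add: Suc GDERIV_const)
qed simp

lemma C_k_add: "C_k k f \<Longrightarrow> C_k k g \<Longrightarrow> C_k k (\<lambda>x. f x + g x)"
proof (induction k arbitrary: f g)
  case 0
  then show ?case by (auto intro: continuous_intros)
next
  case (Suc k)
  from Suc.prems obtain f' g' where
    "\<forall>x. GDERIV f x :> f' x" "\<forall>b\<in>Basis. C_k k (\<lambda>x. f' x \<bullet> b)"
    "\<forall>x. GDERIV g x :> g' x" "\<forall>b\<in>Basis. C_k k (\<lambda>x. g' x \<bullet> b)" by auto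
  then show ?case using Suc.IH
    by (subst C_k.simps, intro exI[of _ "\<lambda>x. f' x + g' x"]) (auto intro: GDERIV_add simp: inner_add_left)
qed

lemma C_k_cmult: "C_k k f \<Longrightarrow> C_k k (\<lambda>x. c * f x)"
proof (induction k arbitrary: f)
  case 0
  then show ?case by (auto intro: continuous_intros)
next
  case (Suc k)
  from Suc.prems obtain f' where
    f': "\<forall>x. GDERIV f x :> f' x" "\<forall>b\<in>Basis. C_k k (\<lambda>x. f' x \<bullet> b)" by auto
  have "GDERIV (\<lambda>x. c * f x) x :> c *\<^sub>R f' x" for x
    using GDERIV_mult[OF GDERIV_const[of c x] f'(1)[rule_format, of x]] by simp
  then show ?case using Suc.IH f'
    by (subst C_k.simps, intro exI[of _ "\<lambda>x. c *\<^sub>R f' x"]) auto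
qed

lemma C_k_sum: "(\<And>i. i \<in> I \<Longrightarrow> C_k k (f i)) \<Longrightarrow> C_k k (\<lambda>x. \<Sum>i\<in>I. f i x)"
  by (induction I rule: infinite_finite_induct) (auto intro: C_k_add C_k_const)

lemma C_k_mult: "C_k k f \<Longrightarrow> C_k k g \<Longrightarrow> C_k k (\<lambda>x. f x * g x)"
proof (induction k arbitrary: f g)
  case 0
  then show ?case by (auto intro: continuous_intros)
next
  case (Suc k)
  from Suc.prems obtain f' g' where
    d: "\<forall>x. GDERIV f x :> f' x" "\<forall>b\<in>Basis. C_k k (\<lambda>x. f' x \<bullet> b)"
    "\<forall>x. GDERIV g x :> g' x" "\<forall>b\<in>Basis. C_k k (\<lambda>x. g' x \<bullet> b)" by auto
  have "C_k k f" "C_k k g" using Suc.prems C_k_SucD by auto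
  then have "C_k k (\<lambda>x. f x * (g' x \<bullet> b) + g x * (f' x \<bullet> b))" if "b \<in> Basis" for b
    using that d Suc.IH by (intro C_k_add) auto
  then show ?case using d
    by (subst C_k.simps, intro exI[of _ "\<lambda>x. f x *\<^sub>R g' x + g x *\<^sub>R f' x"])
      (auto intro: GDERIV_mult simp: inner_add_left)
qed

lemma C_k_prod: "(\<And>i. i \<in> I \<Longrightarrow> C_k k (f i)) \<Longrightarrow> C_k k (\<lambda>x. \<Prod>i\<in>I. f i x)"
  by (induction I rule: infinite_finite_induct) (auto intro: C_k_mult C_k_const)

text \<open>The chain rule gives the transpose of \<open>A\<close> applied to \<open>D\<close>; for
  an orthogonal map the transpose is the inverse \<open>B\<close>.\<close>

lemma GDERIV_compose_orthogonal:
  fixes A :: "'a::euclidean_space \<Rightarrow> 'a"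
  assumes A: "orthogonal_transformation A" and B: "\<And>y. A (B y) = y"
    and f: "GDERIV f (c + A x) :> D"
  shows "GDERIV (\<lambda>x. f (c + A x)) x :> B D"
proof -
  have lin: "bounded_linear A"
    using orthogonal_transformation_linear[OF A] by (simp only: linear_conv_bounded_linear)
  have der: "((\<lambda>x. c + A x) has_derivative A) (at x)"
    using has_derivative_add[OF has_derivative_const bounded_linear_imp_has_derivative[OF lin]] by simp
  have "((\<lambda>x. f (c + A x)) has_derivative (\<lambda>h. A h \<bullet> D)) (at x)"
    by (rule has_derivative_compose[OF der f[unfolded gderiv_def]])
  moreover have "A h \<bullet> D = h \<bullet> B D" for h
    using A B unfolding orthogonal_transformation_def by metis
  ultimately show ?thesis by (simp add: gderiv_def)
qed

lemma C_k_compose_orthogonal: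
  fixes A :: "'a::euclidean_space \<Rightarrow> 'a"
  assumes A: "orthogonal_transformation A"
  shows "C_k k f \<Longrightarrow> C_k k (\<lambda>x. f (c + A x))"
proof (induction k arbitrary: f)
  case 0
  have "continuous_on UNIV A"
    using orthogonal_transformation_linear[OF A] by (intro linear_continuous_on) (simp only: linear_conv_bounded_linear)
  then show ?case using 0 by (auto intro!: continuous_on_compose2[of UNIV f UNIV "\<lambda>x. c + A x"] continuous_intros)
next
  case (Suc k)
  from Suc.prems obtain f' where
    f': "\<forall>x. GDERIV f x :> f' x" "\<forall>b\<in>Basis. C_k k (\<lambda>x. f' x \<bullet> b)" by auto
  obtain B where B: "\<And>y. A (B y) = y"
    using orthogonal_transformation_surj[OF A] by (metis surj_def)
  have "C_k k (\<lambda>x. B (f' (c + A x)) \<bullet> b)" if "b \<in> Basis" for b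
  proof -
    have "B (f' (c + A x)) \<bullet> b = (\<Sum>i\<in>Basis. (A b \<bullet> i) * (f' (c + A x) \<bullet> i))" for x
    proof -
      have "B (f' (c + A x)) \<bullet> b = f' (c + A x) \<bullet> A b"
        using A B unfolding orthogonal_transformation_def by metis
      also have "\<dots> = (\<Sum>i\<in>Basis. (f' (c + A x) \<bullet> i) * (A b \<bullet> i))" by (rule euclidean_inner)
      finally show ?thesis by (simp add: mult.commute)
    qed
    then show ?thesis using f'(2) Suc.IH by (auto intro!: C_k_sum C_k_cmult)
  qed
  then show ?case using GDERIV_compose_orthogonal[OF A B] f'(1)
    by (subst C_k.simps, intro exI[of _ "\<lambda>x. B (f' (c + A x))"]) auto
qed

section \<open>Smooth bump functions built from exp(-1/t)\<close>

definition exp_cutoff :: "nat \<Rightarrow> real \<Rightarrow> real" where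
  "exp_cutoff j t = (if t > 0 then exp (- (1 / t)) / t ^ j else 0)"

text \<open>From (1 + x/n)^n \<le> exp x with \<open>x = 1 / t\<close> and \<open>n = j + 2\<close>,
  so that dividing by \<open>t ^ j\<close> leaves a factor \<open>t\<^sup>2\<close>. A quadratic
  bound is what makes the derivative at 0 vanish.\<close>

lemma exp_cutoff_le_square: "\<bar>exp_cutoff j t\<bar> \<le> real ((j + 2) ^ (j + 2)) * t\<^sup>2"
proof (cases "t > 0")
  case True
  define n where "n = j + 2"
  have n0: "n > 0" by (simp add: n_def)
  have "(1 / t / real n) ^ n \<le> (1 + 1 / t / real n) ^ n"
    using True by (intro power_mono) auto
  also have "\<dots> \<le> exp (1 / t)"
    by (rule exp_ge_one_plus_x_over_n_power_n)
      (use True in \<open>auto simp: n_def intro: order_trans[of _ 0]\<close>)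
  finally have "1 / (t ^ n * real (n ^ n)) \<le> exp (1 / t)"
    by (simp add: power_divide power_mult_distrib)
  then have "exp (- (1 / t)) \<le> t ^ n * real (n ^ n)"
  proof -
    have "1 / E \<le> P" if "1 / P \<le> E" "P > 0" "E > 0" for P E :: real
      using that by (simp add: field_simps)
    moreover have "t ^ n * real (n ^ n) > 0" using True n0 by simp
    ultimately show ?thesis using \<open>1 / (t ^ n * real (n ^ n)) \<le> exp (1 / t)\<close>
      by (simp add: exp_minus inverse_eq_divide)
  qed
  then have "exp (- (1 / t)) / t ^ j \<le> t ^ n * real (n ^ n) / t ^ j"
    using True by (intro divide_right_mono) auto
  also have "\<dots> = real (n ^ n) * t\<^sup>2"
    using True by (simp add: n_def power_add power2_eq_square)
  finally show ?thesis using True by (simp add: exp_cutoff_def n_def)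
qed (simp add: exp_cutoff_def)

text \<open>The reason for the index \<open>j\<close>: the family exp(-1/t) / t^j is closed under
  differentiation up to linear combinations, so smoothness follows by induction for all
  \<open>j\<close> at once.\<close>

lemma DERIV_exp_cutoff:
  "DERIV (exp_cutoff j) t :> exp_cutoff (j + 2) t - real j * exp_cutoff (j + 1) t"
proof -
  consider "t > 0" | "t < 0" | "t = 0" by linarith
  then show ?thesis
  proof cases
    case 1
    have ev: "\<forall>\<^sub>F x in nhds t. exp_cutoff j x = exp (- (1 / x)) / x ^ j"
      using eventually_nhds_in_open[of "{0<..}" t] 1
      by (auto simp: exp_cutoff_def elim: eventually_mono)
    have "((\<lambda>x. exp (- (1 / x)) / x ^ j) has_real_derivative
      (exp (- (1 / t)) * (1 / t\<^sup>2) * t ^ j - exp (- (1 / t)) * (real j * t ^ (j - 1))) / (t ^ j * t ^ j)) (at t)"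
      using 1 by (auto intro!: derivative_eq_intros simp: power2_eq_square)
    also have "(exp (- (1 / t)) * (1 / t\<^sup>2) * t ^ j - exp (- (1 / t)) * (real j * t ^ (j - 1))) / (t ^ j * t ^ j)
       = exp (- (1 / t)) * (1 / t ^ (j + 2) - real j / t ^ (j + 1))"
      using 1 by (cases j) (auto simp: field_simps power2_eq_square)
    finally have "((\<lambda>x. exp (- (1 / x)) / x ^ j) has_real_derivative
       exp (- (1 / t)) * (1 / t ^ (j + 2) - real j / t ^ (j + 1))) (at t)" .
    moreover have "exp (- (1 / t)) * (1 / t ^ (j + 2) - real j / t ^ (j + 1)) =
      exp_cutoff (j + 2) t - real j * exp_cutoff (j + 1) t"
      using 1 by (simp add: exp_cutoff_def algebra_simps)
    ultimately show ?thesis using DERIV_cong_ev[OF refl ev refl] by simp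
  next
    case 2
    have ev: "\<forall>\<^sub>F x in nhds t. exp_cutoff j x = 0"
      using eventually_nhds_in_open[of "{..<0}" t] 2
      by (auto simp: exp_cutoff_def elim: eventually_mono)
    have "((\<lambda>x. 0) has_real_derivative 0) (at t)" by simp
    then have "(exp_cutoff j has_real_derivative 0) (at t)"
      by (simp only: DERIV_cong_ev[OF refl ev refl])
    moreover have "exp_cutoff (j + 2) t - real j * exp_cutoff (j + 1) t = 0"
      using 2 by (simp add: exp_cutoff_def)
    ultimately show ?thesis by simp
  next
    case 3
    let ?C = "real ((j + 2) ^ (j + 2))"
    have "(\<lambda>h. exp_cutoff j h / h) \<midarrow>0\<rightarrow> 0"
    proof (rule Lim_null_comparison)
      show "\<forall>\<^sub>F h in at 0. norm (exp_cutoff j h / h) \<le> ?C * \<bar>h\<bar>"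
      proof (rule eventually_at_filter[THEN iffD2], rule always_eventually, safe)
        fix h :: real assume "h \<noteq> 0"
        then have "\<bar>exp_cutoff j h\<bar> / \<bar>h\<bar> \<le> ?C * h\<^sup>2 / \<bar>h\<bar>"
          by (intro divide_right_mono exp_cutoff_le_square) auto
        also have "?C * h\<^sup>2 / \<bar>h\<bar> = ?C * \<bar>h\<bar>"
          using \<open>h \<noteq> 0\<close> by (simp add: power2_eq_square abs_if)
        finally show "norm (exp_cutoff j h / h) \<le> ?C * \<bar>h\<bar>" by simp
      qed
      show "(\<lambda>h. ?C * \<bar>h\<bar>) \<midarrow>0\<rightarrow> 0" by (auto intro!: tendsto_eq_intros)
    qed
    then show ?thesis using 3 by (simp add: DERIV_def exp_cutoff_def)
  qed
qed

lemma C_k_exp_cutoff: "C_k k (\<lambda>x. exp_cutoff j (c + x \<bullet> v))"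
proof (induction k arbitrary: j)
  case 0
  have "continuous_on UNIV (exp_cutoff j)"
    using DERIV_exp_cutoff by (meson DERIV_continuous continuous_at_imp_continuous_on)
  then show ?case by (auto intro!: continuous_on_compose2[of UNIV "exp_cutoff j"] continuous_intros)
next
  case (Suc k)
  have "GDERIV (\<lambda>x. c + x \<bullet> v) x :> v" for x
    unfolding gderiv_def by (auto intro!: derivative_eq_intros)
  from GDERIV_DERIV_compose[OF this DERIV_exp_cutoff]
  have "GDERIV (\<lambda>x. exp_cutoff j (c + x \<bullet> v)) x :>
     (exp_cutoff (j + 2) (c + x \<bullet> v) - real j * exp_cutoff (j + 1) (c + x \<bullet> v)) *\<^sub>R v" for x .
  moreover have "C_k k (\<lambda>x. ((exp_cutoff (j + 2) (c + x \<bullet> v) - real j * exp_cutoff (j + 1) (c + x \<bullet> v)) *\<^sub>R v) \<bullet> b)"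
    for b
  proof -
    have "C_k k (\<lambda>x. (v \<bullet> b) * (exp_cutoff (j + 2) (c + x \<bullet> v) + (- real j) * exp_cutoff (j + 1) (c + x \<bullet> v)))"
      by (intro C_k_cmult C_k_add Suc)
    then show ?thesis by (simp add: algebra_simps)
  qed
  ultimately show ?case
    by (subst C_k.simps, intro exI[of _ "\<lambda>x. (exp_cutoff (j + 2) (c + x \<bullet> v) - real j * exp_cutoff (j + 1) (c + x \<bullet> v)) *\<^sub>R v"])
      blast
qed

text \<open>The parameter \<open>n\<close> steepens the flanks: all bumps with \<open>n > 0\<close>
  are supported on the same box, and as \<open>n\<close> grows they approach its indicator.\<close>

definition box_bump :: "nat \<Rightarrow> 'a::euclidean_space \<Rightarrow> 'a \<Rightarrow> 'a \<Rightarrow> real" where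
  "box_bump n l r x = (\<Prod>b\<in>Basis. exp_cutoff 0 (real n * (x \<bullet> b - l \<bullet> b)) * exp_cutoff 0 (real n * (r \<bullet> b - x \<bullet> b)))"

lemma C_k_box_bump: "C_k k (box_bump n l r)"
proof -
  have "C_k k (\<lambda>x. \<Prod>b\<in>Basis. exp_cutoff 0 ((- real n * (l \<bullet> b)) + x \<bullet> (real n *\<^sub>R b)) *
      exp_cutoff 0 (real n * (r \<bullet> b) + x \<bullet> (- real n *\<^sub>R b)))"
    by (intro C_k_prod C_k_mult C_k_exp_cutoff)
  also have "(\<lambda>x. \<Prod>b\<in>Basis. exp_cutoff 0 ((- real n * (l \<bullet> b)) + x \<bullet> (real n *\<^sub>R b)) *
      exp_cutoff 0 (real n * (r \<bullet> b) + x \<bullet> (- real n *\<^sub>R b))) = box_bump n l r"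
    by (auto simp: box_bump_def fun_eq_iff algebra_simps)
  finally show ?thesis .
qed

lemma exp_cutoff_0_bounds: "0 \<le> exp_cutoff 0 t" "exp_cutoff 0 t \<le> 1"
  by (auto simp: exp_cutoff_def)

lemma box_bump_bounds: "0 \<le> box_bump n l r x" "box_bump n l r x \<le> 1"
  unfolding box_bump_def
  by (auto intro!: prod_nonneg prod_le_1 mult_nonneg_nonneg mult_le_one exp_cutoff_0_bounds)

lemma box_bump_nonzero_iff: "n > 0 \<Longrightarrow> box_bump n l r x \<noteq> 0 \<longleftrightarrow> x \<in> box l r"
  by (auto simp: box_bump_def exp_cutoff_def mem_box zero_less_mult_iff)

lemma box_bump_tendsto: "(\<lambda>n. box_bump n l r x) \<longlonglongrightarrow> indicator (box l r) x"
proof (cases "x \<in> box l r")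
  case True
  have lim: "(\<lambda>n. exp_cutoff 0 (real n * t)) \<longlonglongrightarrow> 1" if "t > 0" for t
  proof -
    have "(\<lambda>n. exp (- (inverse (real n) * (1 / t)))) \<longlonglongrightarrow> exp (- (0 * (1 / t)))"
      by (intro tendsto_intros lim_inverse_n)
    then have "(\<lambda>n. exp (- (1 / (real n * t)))) \<longlonglongrightarrow> 1" by (simp add: field_simps)
    then show ?thesis
      by (rule Lim_transform_eventually)
        (use that in \<open>auto simp: exp_cutoff_def eventually_sequentially intro!: exI[of _ 1]\<close>)
  qed
  have "(\<lambda>n. box_bump n l r x) \<longlonglongrightarrow> (\<Prod>b\<in>(Basis::'a set). 1 * 1)"
    unfolding box_bump_def using True by (intro tendsto_intros lim) (auto simp: mem_box)
  then show ?thesis using True by simp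
next
  case False
  then have "box_bump n l r x = 0" if "n > 0" for n using box_bump_nonzero_iff that by blast
  then have "\<forall>\<^sub>F n in sequentially. box_bump n l r x = 0"
    by (auto simp: eventually_sequentially intro!: exI[of _ 1])
  then show ?thesis using False by (simp add: tendsto_eventually)
qed

lemma test_function_box_bump:
  assumes "cbox l r \<subseteq> \<Omega>" "n > 0"
  shows "test_function \<Omega> (box_bump n l r)"
proof -
  have "{x. box_bump n l r x \<noteq> 0} \<subseteq> cbox l r"
    using box_bump_nonzero_iff[OF assms(2)] box_subset_cbox by blast
  then have cl: "closure {x. box_bump n l r x \<noteq> 0} \<subseteq> cbox l r" by (rule closure_minimal) (rule closed_cbox)
  then have "compact (closure {x. box_bump n l r x \<noteq> 0})"
    using bounded_subset[OF bounded_cbox cl] by (simp add: compact_eq_bounded_closed)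
  then show ?thesis using cl assms(1) C_k_box_bump unfolding test_function_def by auto
qed

lemma test_function_mono: "test_function \<Omega> \<phi> \<Longrightarrow> \<Omega> \<subseteq> \<Omega>' \<Longrightarrow> test_function \<Omega>' \<phi>"
  by (auto simp: test_function_def)

lemma test_functionI:
  assumes "\<And>k. C_k k \<phi>" "compact K" "K \<subseteq> \<Omega>" "\<And>x. \<phi> x \<noteq> 0 \<Longrightarrow> x \<in> K"
  shows "test_function \<Omega> \<phi>"
proof -
  have cl: "closure {x. \<phi> x \<noteq> 0} \<subseteq> K"
    by (rule closure_minimal) (use assms in \<open>auto simp: compact_imp_closed\<close>)
  then have "compact (closure {x. \<phi> x \<noteq> 0})"
    using bounded_subset[OF compact_imp_bounded[OF assms(2)] cl] by (simp add: compact_eq_bounded_closed)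
  then show ?thesis using assms cl by (auto simp: test_function_def)
qed

lemma test_function_zero: "test_function \<Omega> (\<lambda>x. 0)"
  by (rule test_functionI[of _ "{}"]) (auto intro: C_k_const)

lemma test_function_support:
  assumes "test_function \<Omega> \<phi>"
  obtains K where "compact K" "K \<subseteq> \<Omega>" "\<And>x. x \<notin> K \<Longrightarrow> \<phi> x = 0" "\<And>x D. x \<notin> K \<Longrightarrow> GDERIV \<phi> x :> D \<Longrightarrow> D = 0"
proof (rule that[of "closure {x. \<phi> x \<noteq> 0}"])
  let ?K = "closure {x. \<phi> x \<noteq> 0}"
  show "compact ?K" "?K \<subseteq> \<Omega>" using assms by (auto simp: test_function_def)
  show "\<phi> x = 0" if "x \<notin> ?K" for x
    using that closure_subset[of "{x. \<phi> x \<noteq> 0}"] by blast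
  show "D = 0" if x: "x \<notin> ?K" and D: "GDERIV \<phi> x :> D" for x D
  proof -
    have "(\<phi> has_derivative (\<lambda>h. 0)) (at x)"
    proof (rule has_derivative_transform_within_open[of "\<lambda>_. 0" _ _ _ "- ?K"])
      show "0 = \<phi> y" if "y \<in> - ?K" for y
        using that closure_subset[of "{x. \<phi> x \<noteq> 0}"] by fastforce
    qed (use x in auto)
    then have "GDERIV \<phi> x :> 0" by (simp add: gderiv_def)
    then show ?thesis using D GDERIV_unique by blast
  qed
qed

lemma test_function_add:
  assumes "test_function \<Omega> \<phi>" "test_function \<Omega> \<theta>"
  shows "test_function \<Omega> (\<lambda>x. \<phi> x + \<theta> x)"
proof (rule test_functionI)
  show "compact (closure {x. \<phi> x \<noteq> 0} \<union> closure {x. \<theta> x \<noteq> 0})"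
    using assms by (auto simp: test_function_def)
  show "x \<in> closure {x. \<phi> x \<noteq> 0} \<union> closure {x. \<theta> x \<noteq> 0}" if "\<phi> x + \<theta> x \<noteq> 0" for x
    using that closure_subset[of "{x. \<phi> x \<noteq> 0}"] closure_subset[of "{x. \<theta> x \<noteq> 0}"] by fastforce
qed (use assms in \<open>auto simp: test_function_def intro: C_k_add\<close>)

lemma test_function_cmult:
  assumes "test_function \<Omega> \<phi>"
  shows "test_function \<Omega> (\<lambda>x. c * \<phi> x)"
proof (rule test_functionI)
  show "compact (closure {x. \<phi> x \<noteq> 0})" using assms by (auto simp: test_function_def)
  show "x \<in> closure {x. \<phi> x \<noteq> 0}" if "c * \<phi> x \<noteq> 0" for x
    using that closure_subset[of "{x. \<phi> x \<noteq> 0}"] by fastforce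
qed (use assms in \<open>auto simp: test_function_def intro: C_k_cmult\<close>)

lemma test_function_compose_orthogonal:
  fixes A :: "'a::euclidean_space \<Rightarrow> 'a"
  assumes A: "orthogonal_transformation A" and \<phi>: "test_function \<Omega> \<phi>"
    and \<Omega>': "\<And>x. c + A x \<in> \<Omega> \<Longrightarrow> x \<in> \<Omega>'"
  shows "test_function \<Omega>' (\<lambda>x. \<phi> (c + A x))"
proof -
  obtain K where K: "compact K" "K \<subseteq> \<Omega>" "\<And>x. x \<notin> K \<Longrightarrow> \<phi> x = 0"
    using test_function_support[OF \<phi>] by metis
  define B where "B = inv A"
  have B: "orthogonal_transformation B" unfolding B_def by (rule orthogonal_transformation_inv[OF A])
  have bij: "bij A" by (rule orthogonal_transformation_bij[OF A])
  have AB: "A (B y) = y" "B (A y) = y" for y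
    using bij by (auto simp: B_def bij_is_surj surj_f_inv_f bij_is_inj)
  show ?thesis
  proof (rule test_functionI)
    show "C_k k (\<lambda>x. \<phi> (c + A x))" for k
      by (rule C_k_compose_orthogonal[OF A]) (use \<phi> in \<open>auto simp: test_function_def\<close>)
    have cont: "continuous_on K (\<lambda>y. B (y - c))"
    proof (rule continuous_on_compose2[of UNIV B])
      have "bounded_linear B"
        using orthogonal_transformation_linear[OF B] by (simp only: linear_conv_bounded_linear)
      then show "continuous_on UNIV B" by (rule linear_continuous_on)
    qed (auto intro!: continuous_intros)
    show "compact ((\<lambda>y. B (y - c)) ` K)" by (rule compact_continuous_image[OF cont K(1)])
    show "(\<lambda>y. B (y - c)) ` K \<subseteq> \<Omega>'" using K(2) by (auto intro!: \<Omega>' simp: AB)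
    show "x \<in> (\<lambda>y. B (y - c)) ` K" if "\<phi> (c + A x) \<noteq> 0" for x
    proof -
      have "c + A x \<in> K" using that K(3) by blast
      then show ?thesis by (intro image_eqI[of _ _ "c + A x"]) (auto simp: AB)
    qed
  qed
qed

lemma test_function_translate:
  assumes "test_function A \<phi>" "\<And>x. x \<in> A \<Longrightarrow> x + h \<in> \<Omega>"
  shows "test_function \<Omega> (\<lambda>x. \<phi> (x - h))"
  using test_function_compose_orthogonal[OF orthogonal_transformation_id assms(1), of "-h" \<Omega>] assms(2)
  by (force simp: id_def)

lemma test_function_gradient:
  assumes "test_function \<Omega> \<phi>"
  obtains \<psi> where "\<And>x. GDERIV \<phi> x :> \<psi> x"
  using assms C_k.simps(2)[of 0 \<phi>] unfolding test_function_def by blast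

lemma test_function_gradient_continuous:
  assumes "test_function \<Omega> \<phi>" "\<And>x. GDERIV \<phi> x :> \<psi> x"
  shows "continuous_on UNIV \<psi>"
proof -
  obtain f' where f': "\<And>x. GDERIV \<phi> x :> f' x" "\<And>b. b \<in> Basis \<Longrightarrow> continuous_on UNIV (\<lambda>x. f' x \<bullet> b)"
    using assms(1) C_k.simps(2)[of 0 \<phi>] unfolding test_function_def by (metis C_k.simps(1))
  have "\<psi> = f'" using GDERIV_unique[OF assms(2) f'(1)] by (simp add: fun_eq_iff)
  then show ?thesis using f'(2) by (subst continuous_on_componentwise) auto
qed

lemma test_function_continuous: "test_function \<Omega> \<phi> \<Longrightarrow> continuous_on UNIV \<phi>"
  using C_k_continuous unfolding test_function_def by blast

section \<open>Integrals of compactly supported functions and integration by parts\<close>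

lemma compact_support_bounded:
  fixes f :: "'a::euclidean_space \<Rightarrow> 'b::real_normed_vector"
  assumes "continuous_on UNIV f" "compact K" "\<And>x. x \<notin> K \<Longrightarrow> f x = 0"
  obtains B where "B > 0" "\<And>x. norm (f x) \<le> B"
proof -
  have "bounded (f ` K)"
    using assms by (intro compact_imp_bounded compact_continuous_image) (auto intro: continuous_on_subset)
  then obtain B where B: "B > 0" "\<And>x. x \<in> K \<Longrightarrow> norm (f x) \<le> B" by (auto simp: bounded_pos)
  then have "norm (f x) \<le> B" for x using assms(3) by (cases "x \<in> K") auto
  then show ?thesis using that B by blast
qed

lemma compact_support_integrable:
  fixes f :: "'a::euclidean_space \<Rightarrow> 'b::euclidean_space"
  assumes "continuous_on UNIV f" "compact K" "\<And>x. x \<notin> K \<Longrightarrow> f x = 0"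
  shows "integrable lborel f"
proof -
  have "integrable lborel (\<lambda>x. indicator K x *\<^sub>R f x)"
    using assms by (intro borel_integrable_compact) (auto intro: continuous_on_subset)
  also have "(\<lambda>x. indicator K x *\<^sub>R f x) = f" using assms(3) by (auto simp: indicator_def fun_eq_iff)
  finally show ?thesis .
qed

lemma lborel_integral_translate:
  fixes f :: "'a::euclidean_space \<Rightarrow> 'b::euclidean_space"
  assumes "f \<in> borel_measurable borel"
  shows "(LINT x|lborel. f (x + h)) = (LINT x|lborel. f x)"
proof -
  have "(LINT x|lborel. f x) = (LINT x|distr lborel borel ((+) h). f x)" by (simp add: lborel_distr_plus)
  also have "\<dots> = (LINT x|lborel. f (h + x))" using assms by (intro integral_distr) auto
  finally show ?thesis by (simp add: add.commute)
qed

lemma DERIV_along_line: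
  assumes "GDERIV f (x + s *\<^sub>R v) :> D"
  shows "((\<lambda>s. f (x + s *\<^sub>R v)) has_real_derivative D \<bullet> v) (at s)"
proof -
  have "((\<lambda>s. x + s *\<^sub>R v) has_derivative (\<lambda>t. t *\<^sub>R v)) (at s)"
    by (auto intro!: derivative_eq_intros)
  from has_derivative_compose[OF this assms[unfolded gderiv_def]]
  have "((\<lambda>s. f (x + s *\<^sub>R v)) has_derivative (\<lambda>t. t *\<^sub>R v \<bullet> D)) (at s)" .
  moreover have "(\<lambda>t. t *\<^sub>R v \<bullet> D) = (*) (D \<bullet> v)" by (auto simp: inner_commute)
  ultimately show ?thesis by (simp add: has_field_derivative_def)
qed

lemma GDERIV_mvt:
  assumes "\<And>x. GDERIV f x :> g x"
  shows "\<exists>s. 0 < s \<and> s < 1 \<and> f (x + v) - f x = g (x + s *\<^sub>R v) \<bullet> v"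
  using MVT2[of 0 1 "\<lambda>s. f (x + s *\<^sub>R v)", OF _ DERIV_along_line[OF assms]] by auto

text \<open>Difference quotients of \<open>f\<close> integrate to 0 by translation invariance of
  \<open>lborel\<close>; dominated convergence carries this over to the partial derivatives.\<close>

lemma integral_gradient_zero:
  fixes f :: "'a::euclidean_space \<Rightarrow> real"
  assumes der: "\<And>x. GDERIV f x :> g x" and g: "continuous_on UNIV g"
    and K: "compact K" "\<And>x. x \<notin> K \<Longrightarrow> f x = 0" "\<And>x. x \<notin> K \<Longrightarrow> g x = 0"
  shows "(LINT x|lborel. g x) = 0"
proof -
  have f: "continuous_on UNIV f"
    using der GDERIV_continuous continuous_at_imp_continuous_on by blast
  have fi: "integrable lborel f" by (rule compact_support_integrable[OF f K(1,2)])
  have gi: "integrable lborel g" by (rule compact_support_integrable[OF g K(1,3)])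
  obtain B where B: "B > 0" "\<And>x. norm (g x) \<le> B" using compact_support_bounded[OF g K(1,3)] by metis
  have [measurable]: "f \<in> borel_measurable borel" "g \<in> borel_measurable borel"
    using f g by (auto intro: borel_measurable_continuous_onI)
  have "(LINT x|lborel. g x \<bullet> b) = 0" if b: "b \<in> Basis" for b
  proof -
    define D where "D n x = real (Suc n) * (f (x + (1 / real (Suc n)) *\<^sub>R b) - f x)" for n x
    have D0: "(LINT x|lborel. D n x) = 0" for n
    proof -
      have "integrable lborel (\<lambda>x. f (x + (1 / real (Suc n)) *\<^sub>R b))"
      proof (rule compact_support_integrable)
        show "continuous_on UNIV (\<lambda>x. f (x + (1 / real (Suc n)) *\<^sub>R b))"
          by (intro continuous_on_compose2[OF f] continuous_intros) auto
        show "compact ((\<lambda>x. x - (1 / real (Suc n)) *\<^sub>R b) ` K)"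
          by (intro compact_continuous_image continuous_intros K)
        show "f (x + (1 / real (Suc n)) *\<^sub>R b) = 0" if "x \<notin> (\<lambda>x. x - (1 / real (Suc n)) *\<^sub>R b) ` K" for x
        proof (rule K(2), rule notI)
          assume "x + (1 / real (Suc n)) *\<^sub>R b \<in> K"
          then have "x \<in> (\<lambda>x. x - (1 / real (Suc n)) *\<^sub>R b) ` K" by (rule rev_image_eqI) simp
          then show False using that by blast
        qed
      qed
      then show ?thesis unfolding D_def using fi lborel_integral_translate[of f] by simp
    qed
    \<comment> \<open>All displacements have length at most 1, so the unit neighbourhood of
      \<open>K\<close> contains the support of every difference quotient and carries the dominating
      function.\<close>
    define R where "R = (\<lambda>(x, y). x + y) ` (K \<times> cball (0::'a) 1)"
    have R: "compact R"
      unfolding R_def case_prod_beta by (intro compact_continuous_image compact_Times K continuous_intros) auto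
    have "(\<lambda>n. LINT x|lborel. D n x) \<longlonglongrightarrow> (LINT x|lborel. g x \<bullet> b)"
    proof (rule integral_dominated_convergence[where w="\<lambda>x. indicator R x *\<^sub>R B"])
      show "D n \<in> borel_measurable lborel" for n unfolding D_def by measurable
      show "(\<lambda>x. g x \<bullet> b) \<in> borel_measurable lborel" by measurable
      show "integrable lborel (\<lambda>x. indicator R x *\<^sub>R B)"
        by (rule borel_integrable_compact[OF R]) (rule continuous_on_const)
      show "AE x in lborel. (\<lambda>n. D n x) \<longlonglongrightarrow> g x \<bullet> b"
      proof (rule AE_I2)
        fix x
        have "((\<lambda>s. f (x + s *\<^sub>R b)) has_real_derivative g x \<bullet> b) (at 0)"
          by (rule DERIV_along_line) (simp add: der)
        then have lim: "((\<lambda>h. (f (x + h *\<^sub>R b) - f x) / h) \<longlongrightarrow> g x \<bullet> b) (at 0)" by (simp add: DERIV_def)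
        have "filterlim (\<lambda>n. 1 / real (Suc n)) (at 0) sequentially"
          unfolding filterlim_at using LIMSEQ_Suc[OF lim_1_over_n] by (auto intro!: always_eventually)
        from filterlim_compose[OF lim this] show "(\<lambda>n. D n x) \<longlonglongrightarrow> g x \<bullet> b"
          by (simp add: D_def field_simps)
      qed
      show "AE x in lborel. norm (D n x) \<le> indicator R x *\<^sub>R B" for n
      proof (rule AE_I2)
        fix x
        obtain s where s: "0 < s" "s < 1" and
          eq: "f (x + (1 / real (Suc n)) *\<^sub>R b) - f x = g (x + s *\<^sub>R ((1 / real (Suc n)) *\<^sub>R b)) \<bullet> ((1 / real (Suc n)) *\<^sub>R b)"
          using GDERIV_mvt[OF der] by blast
        let ?v = "s *\<^sub>R ((1 / real (Suc n)) *\<^sub>R b)"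
        let ?y = "x + ?v"
        have Dg: "D n x = g ?y \<bullet> b" unfolding D_def eq by simp
        show "norm (D n x) \<le> indicator R x *\<^sub>R B"
        proof (cases "?y \<in> K")
          case True
          have "norm ?v \<le> 1"
            using s b by (simp add: divide_le_eq)
          then have "- ?v \<in> cball 0 1" by simp
          moreover have "x = ?y + - ?v" by simp
          ultimately have "x \<in> R" unfolding R_def using True
            by (intro image_eqI[of _ _ "(?y, - ?v)"]) auto
          moreover have "\<bar>g ?y \<bullet> b\<bar> \<le> B" using Basis_le_norm[OF b, of "g ?y"] B(2)[of ?y] by linarith
          ultimately show ?thesis by (simp add: Dg)
        next
          case False
          then show ?thesis using K(3) B(1) by (simp add: Dg)
        qed
      qed
    qed
    then show ?thesis using D0 by (simp add: LIMSEQ_const_iff)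
  qed
  then show ?thesis
    using gi by (intro euclidean_eqI[where 'a='a]) simp
qed

lemma integral_lebesgue_on_eq_lborel:
  fixes f :: "'a::euclidean_space \<Rightarrow> 'b::euclidean_space"
  assumes "f \<in> borel_measurable borel" "\<And>x. x \<notin> \<Omega> \<Longrightarrow> f x = 0" "\<Omega> \<in> sets lebesgue"
  shows "(LINT x|lebesgue_on \<Omega>. f x) = (LINT x|lborel. f x)"
proof -
  have "(LINT x|lebesgue_on \<Omega>. f x) = (LINT x|lebesgue. indicator \<Omega> x *\<^sub>R f x)"
    using assms by (intro integral_restrict_space) auto
  also have "(\<lambda>x. indicator \<Omega> x *\<^sub>R f x) = f" using assms(2) by (auto simp: indicator_def fun_eq_iff)
  also have "(LINT x|lebesgue. f x) = (LINT x|lborel. f x)"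
    using assms by (intro integral_completion) simp
  finally show ?thesis .
qed

lemma integrable_lebesgue_on_of_lborel:
  fixes f :: "'a::euclidean_space \<Rightarrow> 'b::euclidean_space"
  assumes "integrable lborel f" "\<Omega> \<in> sets lebesgue"
  shows "integrable (lebesgue_on \<Omega>) f"
proof -
  have "integrable lebesgue f" using assms integrable_completion[of f lborel] by (simp add: borel_measurable_integrable)
  then have "integrable lebesgue (\<lambda>x. indicator \<Omega> x *\<^sub>R f x)" using assms(2) by (intro integrable_mult_indicator)
  then show ?thesis using assms(2) by (simp add: integrable_restrict_space)
qed

lemma compact_support_L2:
  fixes f :: "'a::euclidean_space \<Rightarrow> 'b::euclidean_space"
  assumes f: "continuous_on UNIV f" and K: "compact K" "\<And>x. x \<notin> K \<Longrightarrow> f x = 0" and \<Omega>: "\<Omega> \<in> sets lebesgue"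
  shows "f \<in> L2 (lebesgue_on \<Omega>)"
proof -
  have "f \<in> borel_measurable borel" using f by (rule borel_measurable_continuous_onI)
  then have "f \<in> borel_measurable lborel" by simp
  then have "f \<in> borel_measurable lebesgue" by (rule measurable_completion)
  then have "f \<in> borel_measurable (lebesgue_on \<Omega>)" by (rule measurable_restrict_space1)
  moreover have "integrable lborel (\<lambda>x. (norm (f x))\<^sup>2)"
    by (rule compact_support_integrable[OF _ K(1)]) (use f K in \<open>auto intro!: continuous_intros\<close>)
  ultimately show ?thesis using integrable_lebesgue_on_of_lborel[OF _ \<Omega>] by (auto simp: L2_def)
qed

text \<open>Integration by parts: the product of two test functions has compact support, so the
  integral of its gradient vanishes.\<close>

lemma weak_gradient_test_function:
  fixes \<phi> :: "'a::euclidean_space \<Rightarrow> real"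
  assumes \<Omega>: "open \<Omega>" and \<phi>: "test_function \<Omega> \<phi>" and \<psi>: "\<And>x. GDERIV \<phi> x :> \<psi> x"
  shows "weak_gradient \<Omega> \<phi> \<psi>"
proof -
  have \<Omega>m: "\<Omega> \<in> sets lebesgue" using \<Omega> by (simp add: borel_open sets_completionI_sets)
  obtain K where K: "compact K" "K \<subseteq> \<Omega>" "\<And>x. x \<notin> K \<Longrightarrow> \<phi> x = 0" "\<And>x. x \<notin> K \<Longrightarrow> \<psi> x = 0"
    using test_function_support[OF \<phi>] \<psi> by metis
  note c = test_function_continuous[OF \<phi>] test_function_gradient_continuous[OF \<phi> \<psi>]
  show ?thesis
    unfolding weak_gradient_def square_integrable_iff_L2
  proof (intro conjI allI impI)
    show "\<phi> \<in> L2 (lebesgue_on \<Omega>)" "\<psi> \<in> L2 (lebesgue_on \<Omega>)"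
      using compact_support_L2 c K \<Omega>m by blast+
    fix \<theta> \<xi> assume \<theta>: "test_function \<Omega> \<theta>" and \<xi>: "\<forall>x. GDERIV \<theta> x :> \<xi> x"
    have c': "continuous_on UNIV \<theta>" "continuous_on UNIV \<xi>"
      using test_function_continuous[OF \<theta>] test_function_gradient_continuous[OF \<theta>] \<xi> by auto
    have int: "integrable lborel (\<lambda>x. \<phi> x *\<^sub>R \<xi> x)" "integrable lborel (\<lambda>x. \<theta> x *\<^sub>R \<psi> x)"
      using c c' K by (auto intro!: compact_support_integrable[OF _ K(1)] continuous_intros)
    have "(LINT x|lborel. \<phi> x *\<^sub>R \<xi> x + \<theta> x *\<^sub>R \<psi> x) = 0"
    proof (rule integral_gradient_zero[where f="\<lambda>x. \<phi> x * \<theta> x", OF _ _ K(1)])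
      show "GDERIV (\<lambda>x. \<phi> x * \<theta> x) x :> \<phi> x *\<^sub>R \<xi> x + \<theta> x *\<^sub>R \<psi> x" for x
        using GDERIV_mult[OF \<psi> \<xi>[rule_format]] .
    qed (use c c' K in \<open>auto intro!: continuous_intros\<close>)
    then have eq: "(LINT x|lborel. \<phi> x *\<^sub>R \<xi> x) = - (LINT x|lborel. \<theta> x *\<^sub>R \<psi> x)"
      using int by (simp add: eq_neg_iff_add_eq_0)
    have "(LINT x|lebesgue_on \<Omega>. \<phi> x *\<^sub>R \<xi> x) = (LINT x|lborel. \<phi> x *\<^sub>R \<xi> x)"
      using K int by (intro integral_lebesgue_on_eq_lborel \<Omega>m) (auto dest: borel_measurable_integrable)
    moreover have "(LINT x|lebesgue_on \<Omega>. \<theta> x *\<^sub>R \<psi> x) = (LINT x|lborel. \<theta> x *\<^sub>R \<psi> x)"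
      using K int by (intro integral_lebesgue_on_eq_lborel \<Omega>m) (auto dest: borel_measurable_integrable)
    ultimately show "(LINT x|lebesgue_on \<Omega>. \<phi> x *\<^sub>R \<xi> x) = - (LINT x|lebesgue_on \<Omega>. \<theta> x *\<^sub>R \<psi> x)"
      using eq by simp
  qed
qed

section \<open>Weak gradients and density of test functions\<close>

text \<open>The Hilbert space projection onto the closure of \<open>S\<close>, for a complete
  semidefinite form. The point \<open>p\<close> is described as a limit of elements of
  \<open>S\<close>, since the form alone cannot single out a unique vector.\<close>

lemma (in psd_form) projection_exists:
  assumes S: "subspace S" "S \<subseteq> X" and w: "w \<in> X"
    and complete: "\<And>s. \<lbrakk>\<And>k::nat. s k \<in> X;
      \<And>\<epsilon>. \<epsilon> > 0 \<Longrightarrow> \<exists>N. \<forall>k\<ge>N. \<forall>l\<ge>N. b (s k - s l) (s k - s l) < \<epsilon>\<rbrakk>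
      \<Longrightarrow> \<exists>p\<in>X. (\<lambda>k. b (s k - p) (s k - p)) \<longlonglongrightarrow> 0"
  shows "\<exists>p\<in>X. (\<exists>s. (\<forall>k::nat. s k \<in> S) \<and> (\<lambda>k. b (s k - p) (s k - p)) \<longlonglongrightarrow> 0) \<and> (\<forall>v\<in>S. b (w - p) v = 0)"
proof -
  have SX: "s \<in> X" if "s \<in> S" for s using S that by auto
  define D where "D = (\<lambda>s. b (w - s) (w - s)) ` S"
  have wS: "w - s \<in> X" if "s \<in> S" for s using X w SX[OF that] by (simp add: subspace_diff)
  have Dne: "D \<noteq> {}" unfolding D_def using subspace_0[OF S(1)] by auto
  have Dbdd: "bdd_below D" unfolding D_def by (rule bdd_belowI[of _ 0]) (use nonneg wS in auto)
  define d where "d = Inf D"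
  have d_le: "d \<le> b (w - s) (w - s)" if "s \<in> S" for s
    unfolding d_def by (rule cInf_lower[OF _ Dbdd]) (use that in \<open>auto simp: D_def\<close>)
  have "\<exists>s. s \<in> S \<and> b (w - s) (w - s) < d + 1 / real (Suc k)" for k
  proof -
    have "\<exists>x\<in>D. x < d + 1 / real (Suc k)"
      by (rule cInf_lessD[OF Dne]) (simp add: d_def)
    then show ?thesis unfolding D_def by auto
  qed
  then obtain s where s: "\<And>k. s k \<in> S" "\<And>k. b (w - s k) (w - s k) < d + 1 / real (Suc k)" by metis
  have par: "b (s k - s l) (s k - s l) \<le> 2 / real (Suc k) + 2 / real (Suc l)" for k l
  proof -
    \<comment> \<open>Parallelogram law: the midpoint \<open>?h\<close> of two near-minimisers lies
      in \<open>S\<close> and is at squared distance at least \<open>d\<close>, which leaves little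
      room for their difference.\<close>
    let ?u = "w - s k" and ?v = "w - s l" and ?h = "(1/2) *\<^sub>R (s k + s l)"
    have u: "?u \<in> X" and v: "?v \<in> X" using wS s by auto
    have h: "?h \<in> S" using S s by (simp add: subspace_add subspace_scale)
    have eq: "?u + ?v = 2 *\<^sub>R (w - ?h)" by (simp add: algebra_simps scaleR_2)
    have "b (?u + ?v) (?u + ?v) = 4 * b (w - ?h) (w - ?h)"
      unfolding eq using wS[OF h] X by (simp add: scale_left scale_right subspace_scale)
    moreover have "?u - ?v = - (s k - s l)" by simp
    moreover have "b (- (s k - s l)) (- (s k - s l)) = b (s k - s l) (s k - s l)"
      using scale_left[of "s k - s l" "- (s k - s l)" "-1"] scale_right[of "s k - s l" "s k - s l" "-1"]
        X SX[OF s(1)] by (simp add: subspace_diff subspace_neg)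
    ultimately have "b (s k - s l) (s k - s l) + 4 * b (w - ?h) (w - ?h) = 2 * b ?u ?u + 2 * b ?v ?v"
      using add_expand[OF u v] diff_expand[OF u v] by simp
    then show ?thesis using d_le[OF h] s(2)[of k] s(2)[of l] by simp
  qed
  have "\<exists>p\<in>X. (\<lambda>k. b (s k - p) (s k - p)) \<longlonglongrightarrow> 0"
  proof (rule complete)
    show "s k \<in> X" for k using SX s by auto
    fix \<epsilon> :: real assume "\<epsilon> > 0"
    have "(\<lambda>k. 2 / real (Suc k)) \<longlonglongrightarrow> 0"
      using tendsto_mult_right_zero[OF LIMSEQ_Suc[OF lim_1_over_n], of 2] by simp
    then obtain N where N: "\<And>k. k \<ge> N \<Longrightarrow> 2 / real (Suc k) < \<epsilon> / 2"
      using order_tendstoD(2)[of _ 0 sequentially "\<epsilon> / 2"] \<open>\<epsilon> > 0\<close> by (fastforce simp: eventually_sequentially)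
    show "\<exists>N. \<forall>k\<ge>N. \<forall>l\<ge>N. b (s k - s l) (s k - s l) < \<epsilon>"
    proof (intro exI[of _ N] allI impI)
      fix k l assume kl: "N \<le> k" "N \<le> l"
      show "b (s k - s l) (s k - s l) < \<epsilon>"
        using par[of k l] N[OF kl(1)] N[OF kl(2)] by simp
    qed
  qed
  then obtain p where p: "p \<in> X" and lim: "(\<lambda>k. b (s k - p) (s k - p)) \<longlonglongrightarrow> 0" by blast
  have wp: "w - p \<in> X" using X w p by (simp add: subspace_diff)
  have "b (w - p) v = 0" if v: "v \<in> S" for v
  proof -
    have vX: "v \<in> X" using SX v .
    \<comment> \<open>First variation at \<open>p\<close>: the minimal value \<open>d\<close> is
      attained there in the limit, and \<open>s k - t *\<^sub>R v\<close> stays in \<open>S\<close>,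
      so moving by \<open>t *\<^sub>R v\<close> cannot go below \<open>d\<close>.\<close>
    have q: "0 \<le> 2 * t * b (w - p) v + t\<^sup>2 * b v v" for t
    proof -
      have tv: "t *\<^sub>R v \<in> X" using X vX by (simp add: subspace_scale)
      have tends: "(\<lambda>k. b (w - s k) (w - s k)) \<longlonglongrightarrow> b (w - p) (w - p)"
      proof (rule tendsto_quadratic[OF wS[OF s(1)] wp])
        have "b (w - s k - (w - p)) (w - s k - (w - p)) = b (s k - p) (s k - p)" for k
        proof -
          have "w - s k - (w - p) = (-1) *\<^sub>R (s k - p)" by simp
          then show ?thesis using X p SX[OF s(1)]
            by (simp only: scale_left scale_right subspace_diff subspace_scale)
        qed
        then show "(\<lambda>k. b (w - s k - (w - p)) (w - s k - (w - p))) \<longlonglongrightarrow> 0" using lim by simp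
      qed
      have "b (w - p) (w - p) \<le> d"
      proof (rule LIMSEQ_le[OF tends])
        have "(\<lambda>k. d + 1 / real (Suc k)) \<longlonglongrightarrow> d + 0" by (intro tendsto_intros LIMSEQ_Suc[OF lim_1_over_n])
        then show "(\<lambda>k. d + 1 / real (Suc k)) \<longlonglongrightarrow> d" by simp
        show "\<exists>N. \<forall>n\<ge>N. b (w - s n) (w - s n) \<le> d + 1 / real (Suc n)" using s(2) by (auto intro: less_imp_le)
      qed
      moreover have "d \<le> b (w - p + t *\<^sub>R v) (w - p + t *\<^sub>R v)"
      proof (rule LIMSEQ_le_const)
        have mem: "s k - t *\<^sub>R v \<in> S" for k using S s v by (simp add: subspace_diff subspace_scale)
        show "\<exists>N. \<forall>n\<ge>N. d \<le> b (w - (s n - t *\<^sub>R v)) (w - (s n - t *\<^sub>R v))" using d_le[OF mem] by blast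
        show "(\<lambda>k. b (w - (s k - t *\<^sub>R v)) (w - (s k - t *\<^sub>R v))) \<longlonglongrightarrow> b (w - p + t *\<^sub>R v) (w - p + t *\<^sub>R v)"
        proof (rule tendsto_quadratic[OF wS[OF mem]])
          show "w - p + t *\<^sub>R v \<in> X" using X wp tv by (simp add: subspace_add)
          have "b (w - (s k - t *\<^sub>R v) - (w - p + t *\<^sub>R v)) (w - (s k - t *\<^sub>R v) - (w - p + t *\<^sub>R v)) = b (s k - p) (s k - p)" for k
          proof -
            have "w - (s k - t *\<^sub>R v) - (w - p + t *\<^sub>R v) = (-1) *\<^sub>R (s k - p)" by simp
            then show ?thesis using X p SX[OF s(1)]
              by (simp only: scale_left scale_right subspace_diff subspace_scale)
          qed
          then show "(\<lambda>k. b (w - (s k - t *\<^sub>R v) - (w - p + t *\<^sub>R v)) (w - (s k - t *\<^sub>R v) - (w - p + t *\<^sub>R v))) \<longlonglongrightarrow> 0"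
            using lim by simp
        qed
      qed
      ultimately show ?thesis
        using add_expand[OF wp tv] by (simp add: scale_left scale_right wp vX tv power2_eq_square)
    qed
    show ?thesis
    proof (rule ccontr)
      assume ne: "b (w - p) v \<noteq> 0"
      define Q where "Q = b (w - p) v"
      define E where "E = b v v + 1"
      have E: "E > 0" "b v v < E" unfolding E_def using nonneg[OF vX] by auto
      have "0 \<le> 2 * (- Q / E) * Q + (- Q / E)\<^sup>2 * b v v" using q[of "- Q / E"] by (simp only: Q_def)
      also have "\<dots> \<le> 2 * (- Q / E) * Q + (- Q / E)\<^sup>2 * E"
        using E by (intro add_left_mono mult_left_mono) auto
      also have "\<dots> = - Q\<^sup>2 / E" using E by (simp add: power2_eq_square field_simps)
      finally show False using ne E by (simp add: Q_def[symmetric] divide_le_0_iff zero_le_divide_iff)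
    qed
  qed
  then show ?thesis using p lim s(1) by blast
qed

text \<open>Boxes form an intersection-stable generator of the Borel sets, so the sets of integral
  zero exhaust them by Dynkin's argument; \<open>h0\<close> is what closes these sets under
  complements.\<close>

lemma AE_zero_if_box_integrals_zero:
  fixes h :: "'a::euclidean_space \<Rightarrow> real"
  assumes h: "integrable lborel h" and h0: "(LINT x|lborel. h x) = 0"
    and box: "\<And>l r. (LINT x|lborel. indicator (box l r) x *\<^sub>R h x) = 0"
  shows "AE x in lborel. h x = 0"
proof (rule sigma_finite_measure.density_zero[OF sigma_finite_lborel h])
  fix A :: "'a set" assume "A \<in> sets lborel"
  then have A: "A \<in> sigma_sets UNIV (range (\<lambda>(a, b). box a b))" by (simp add: borel_eq_box)
  have "Int_stable (range (\<lambda>(a, b). box a b :: 'a set))"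
    by (auto simp: Int_stable_def box_Int_box)
  moreover have "range (\<lambda>(a, b). box a b :: 'a set) \<subseteq> Pow UNIV" by auto
  ultimately show "set_lebesgue_integral lborel A h = 0"
    using A
  proof (induction rule: sigma_sets_induct_disjoint)
    case (basic A)
    then show ?case using box by (auto simp: set_lebesgue_integral_def)
  next
    case empty
    then show ?case by (simp add: set_lebesgue_integral_def)
  next
    case (compl A)
    then have A: "A \<in> sets borel" by (simp add: borel_eq_box)
    have "integrable lborel (\<lambda>x. indicator A x *\<^sub>R h x)" using A h by (intro integrable_mult_indicator) auto
    then have "(LINT x|lborel. h x - indicator A x *\<^sub>R h x) = 0"
      using h h0 compl by (simp add: set_lebesgue_integral_def)
    moreover have "(\<lambda>x. h x - indicator A x *\<^sub>R h x) = (\<lambda>x. indicator (UNIV - A) x *\<^sub>R h x)"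
      by (auto simp: indicator_def fun_eq_iff)
    ultimately show ?case by (simp add: set_lebesgue_integral_def)
  next
    case (union A)
    have A: "A i \<in> sets borel" for i using union.hyps by (auto simp: borel_eq_box)
    have "(LINT x:(\<Union>i. A i)|lborel. h x) = (\<Sum>i. (LINT x:(A i)|lborel. h x))"
    proof (rule lebesgue_integral_countable_add)
      show "A i \<in> sets lborel" for i using A by simp
      show "A i \<inter> A j = {}" if "i \<noteq> j" for i j using union.hyps(1) that by (auto simp: disjoint_family_on_def)
      show "set_integrable lborel (\<Union>i. A i) h"
        unfolding set_integrable_def using A h by (intro integrable_mult_indicator) auto
    qed
    then show ?case using union.IH by simp
  qed
qed

lemma indicator_box_L2: "\<Omega> \<in> sets lebesgue \<Longrightarrow> indicat_real (box l r) \<in> L2 (lebesgue_on \<Omega>)"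
proof -
  assume \<Omega>: "\<Omega> \<in> sets lebesgue"
  have "indicat_real (box l r) \<in> borel_measurable lborel" by measurable
  then have "indicat_real (box l r) \<in> borel_measurable lebesgue" by (rule measurable_completion)
  then have "indicat_real (box l r) \<in> borel_measurable (lebesgue_on \<Omega>)"
    by (rule measurable_restrict_space1)
  moreover have "integrable (lebesgue_on \<Omega>) (indicat_real (box l r))"
  proof (rule integrable_lebesgue_on_of_lborel[OF _ \<Omega>])
    show "integrable lborel (indicat_real (box l r))"
      by (rule integrable_real_indicator) (use emeasure_lborel_box_finite[of l r] in auto)
  qed
  moreover have "(\<lambda>x. (norm (indicat_real (box l r) x))\<^sup>2) = indicat_real (box l r)"
    by (auto simp: indicator_def fun_eq_iff)
  ultimately show ?thesis by (simp add: L2_def)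
qed

text \<open>Bumps on the box converge boundedly to its indicator. The closed box must lie inside
  \<open>\<Omega>\<close> because it is the set that contains their closed supports.\<close>

lemma integral_test_zero_imp_box_zero:
  fixes f :: "'a::euclidean_space \<Rightarrow> real"
  assumes \<Omega>: "\<Omega> \<in> sets lebesgue" and f: "f \<in> L2 (lebesgue_on \<Omega>)"
    and zero: "\<And>\<phi>. test_function \<Omega> \<phi> \<Longrightarrow> (LINT x|lebesgue_on \<Omega>. f x * \<phi> x) = 0"
    and box: "cbox l r \<subseteq> \<Omega>"
  shows "(LINT x|lebesgue_on \<Omega>. f x * indicator (box l r) x) = 0"
proof -
  let ?M = "lebesgue_on \<Omega>"
  have fi: "integrable ?M (\<lambda>x. f x * indicator (box l r) x)"
    using L2_inner_integrable[OF f indicator_box_L2[OF \<Omega>]] by simp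
  have "(\<lambda>n. LINT x|?M. f x * box_bump (Suc n) l r x) \<longlonglongrightarrow> (LINT x|?M. f x * indicator (box l r) x)"
  proof (rule integral_dominated_convergence[where w="\<lambda>x. norm (f x * indicator (box l r) x)"])
    show "(\<lambda>x. f x * indicator (box l r) x) \<in> borel_measurable ?M" using fi by (rule borel_measurable_integrable)
    show "(\<lambda>x. f x * box_bump (Suc n) l r x) \<in> borel_measurable ?M" for n
    proof (intro borel_measurable_times L2_measurable[OF f])
      have "continuous_on UNIV (box_bump (Suc n) l r)" using C_k_continuous[OF C_k_box_bump] .
      then have "box_bump (Suc n) l r \<in> borel_measurable lborel" by (simp add: borel_measurable_continuous_onI)
      then show "box_bump (Suc n) l r \<in> borel_measurable ?M"
        by (intro measurable_restrict_space1 measurable_completion)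
    qed
    show "integrable ?M (\<lambda>x. norm (f x * indicator (box l r) x))" using fi by (rule integrable_norm)
    show "AE x in ?M. (\<lambda>n. f x * box_bump (Suc n) l r x) \<longlonglongrightarrow> f x * indicator (box l r) x"
      by (intro AE_I2 tendsto_intros LIMSEQ_Suc[OF box_bump_tendsto])
    show "AE x in ?M. norm (f x * box_bump (Suc n) l r x) \<le> norm (f x * indicator (box l r) x)" for n
    proof (rule AE_I2)
      fix x
      have "\<bar>box_bump (Suc n) l r x\<bar> \<le> indicator (box l r) x"
        using box_bump_bounds[of "Suc n" l r x] box_bump_nonzero_iff[of "Suc n" l r x]
        by (auto simp: indicator_def)
      then show "norm (f x * box_bump (Suc n) l r x) \<le> norm (f x * indicator (box l r) x)"
        by (auto simp: abs_mult intro: mult_left_mono)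
    qed
  qed
  moreover have "(LINT x|?M. f x * box_bump (Suc n) l r x) = 0" for n
    by (rule zero, rule test_function_box_bump[OF box]) simp
  ultimately show ?thesis by (simp add: LIMSEQ_const_iff)
qed

text \<open>The fundamental lemma of the calculus of variations. The argument runs on a Borel
  representative \<open>g\<close> of \<open>f\<close> extended by zero, where integrals over
  \<open>lborel\<close> are available.\<close>

lemma test_functions_separate:
  fixes f :: "'a::euclidean_space \<Rightarrow> real"
  assumes \<Omega>: "open \<Omega>" and f: "f \<in> L2 (lebesgue_on \<Omega>)"
    and zero: "\<And>\<phi>. test_function \<Omega> \<phi> \<Longrightarrow> (LINT x|lebesgue_on \<Omega>. f x * \<phi> x) = 0"
  shows "AE x in lebesgue_on \<Omega>. f x = 0"
proof -
  have \<Omega>b: "\<Omega> \<in> sets borel" using \<Omega> by simp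
  then have \<Omega>m: "\<Omega> \<in> sets lebesgue" by (simp add: sets_completionI_sets)
  have "(\<lambda>x. indicator \<Omega> x *\<^sub>R f x) \<in> borel_measurable lebesgue"
    using L2_measurable[OF f] borel_measurable_restrict_space_iff[of \<Omega> lebesgue f] \<Omega>m by simp
  then obtain g where g: "g \<in> borel_measurable lborel" and fg: "AE x in lborel. indicator \<Omega> x *\<^sub>R f x = g x"
    using completion_ex_borel_measurable_real by blast
  have fg': "AE x in lebesgue. indicator \<Omega> x *\<^sub>R f x = g x" using fg by (rule AE_completion)
  have restr: "integrable lborel (\<lambda>x. indicator (box c d) x *\<^sub>R g x)"
    "(LINT x|lborel. indicator (box c d) x *\<^sub>R g x) = (LINT x|lebesgue_on \<Omega>. f x * indicator (box c d) x)" for c d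
  proof -
    have m: "(\<lambda>x. indicator (box c d) x *\<^sub>R g x) \<in> borel_measurable lborel" using g by measurable
    have i: "integrable (lebesgue_on \<Omega>) (\<lambda>x. f x * indicator (box c d) x)"
      using L2_inner_integrable[OF f indicator_box_L2[OF \<Omega>m]] by simp
    then have i': "integrable lebesgue (\<lambda>x. indicator \<Omega> x *\<^sub>R (f x * indicator (box c d) x))"
      using \<Omega>m by (simp add: integrable_restrict_space)
    have ae: "AE x in lebesgue. indicator \<Omega> x *\<^sub>R (f x * indicator (box c d) x) = indicator (box c d) x *\<^sub>R g x"
      using fg' by eventually_elim (auto simp: indicator_def)
    have ml: "(\<lambda>x. indicator (box c d) x *\<^sub>R g x) \<in> borel_measurable lebesgue"
      using m by (rule measurable_completion)
    have "integrable lebesgue (\<lambda>x. indicator (box c d) x *\<^sub>R g x)"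
      by (rule iffD1[OF integrable_cong_AE[OF borel_measurable_integrable[OF i'] ml ae] i'])
    then show "integrable lborel (\<lambda>x. indicator (box c d) x *\<^sub>R g x)" using integrable_completion[OF m] by simp
    have "(LINT x|lebesgue_on \<Omega>. f x * indicator (box c d) x)
        = (LINT x|lebesgue. indicator \<Omega> x *\<^sub>R (f x * indicator (box c d) x))"
      using \<Omega>m by (intro integral_restrict_space) simp
    also have "\<dots> = (LINT x|lebesgue. indicator (box c d) x *\<^sub>R g x)"
      using i' ml ae by (intro integral_cong_AE) auto
    also have "\<dots> = (LINT x|lborel. indicator (box c d) x *\<^sub>R g x)"
      by (rule integral_completion[OF m])
    finally show "(LINT x|lborel. indicator (box c d) x *\<^sub>R g x) = (LINT x|lebesgue_on \<Omega>. f x * indicator (box c d) x)"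
      by simp
  qed
  have box0: "AE x in lborel. x \<in> cbox a b \<longrightarrow> g x = 0" if ab: "cbox a b \<subseteq> \<Omega>" for a b
  proof -
    \<comment> \<open>The bumps reach only boxes whose closure lies in \<open>\<Omega>\<close>.
      Fixing an outer box \<open>cbox a b\<close> inside \<open>\<Omega>\<close> guarantees this for
      all of its open subboxes.\<close>
    have z: "(LINT x|lborel. indicator (box c d) x *\<^sub>R g x) = 0" if "box c d \<subseteq> box a b" for c d
    proof (cases "box c d = {}")
      case False
      have "cbox c d = closure (box c d)" using False by (simp add: closure_box)
      also have "\<dots> \<subseteq> cbox a b"
        using that box_subset_cbox by (intro closure_minimal closed_cbox) blast
      finally have "cbox c d \<subseteq> \<Omega>" using ab by blast
      then show ?thesis unfolding restr using integral_test_zero_imp_box_zero[OF \<Omega>m f zero] by blast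
    qed simp
    have "AE x in lborel. indicator (box a b) x *\<^sub>R g x = 0"
    proof (rule AE_zero_if_box_integrals_zero)
      show "(LINT x|lborel. indicator (box l r) x *\<^sub>R (indicator (box a b) x *\<^sub>R g x)) = 0" for l r
      proof -
        obtain c d where cd: "box l r \<inter> box a b = box c d" using box_Int_box by blast
        have "(\<lambda>x. indicator (box l r) x *\<^sub>R (indicator (box a b) x *\<^sub>R g x)) = (\<lambda>x. indicator (box c d) x *\<^sub>R g x)"
          unfolding cd[symmetric] by (auto simp: indicator_def fun_eq_iff)
        moreover have "box c d \<subseteq> box a b" using cd by blast
        ultimately show ?thesis using z[of c d] by simp
      qed
    qed (use restr z in auto)
    \<comment> \<open>The open box leaves out the faces, which form a null set.\<close>
    moreover have "AE x in lborel. x \<notin> cbox a b - box a b"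
    proof -
      have "cbox a b - box a b \<in> null_sets lebesgue"
        using negligible_frontier_interval negligible_iff_null_sets by blast
      then have "cbox a b - box a b \<in> null_sets lborel" by (simp add: null_sets_completion_iff)
      then show ?thesis by (rule AE_not_in)
    qed
    ultimately show ?thesis by eventually_elim (auto simp: indicator_def)
  qed
  have "AE x in lborel. x \<in> \<Omega> \<longrightarrow> g x = 0"
  proof -
    \<comment> \<open>Countably many rational boxes cover \<open>\<Omega>\<close>, so the
      exceptional null sets of the individual boxes can be combined.\<close>
    define a' where "a' = (\<lambda>f. (\<Sum>(i::'a)\<in>Basis. fst (f i :: real \<times> real) *\<^sub>R i))"
    define b' where "b' = (\<lambda>f. (\<Sum>(i::'a)\<in>Basis. snd (f i :: real \<times> real) *\<^sub>R i))"
    define I where "I = {f\<in>Basis \<rightarrow>\<^sub>E \<rat> \<times> \<rat>. cbox (a' f) (b' f) \<subseteq> \<Omega>}"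
    have eq: "\<Omega> = (\<Union>f\<in>I. cbox (a' f) (b' f))"
      using open_UNION_cbox[OF \<Omega>] unfolding a'_def b'_def I_def by simp
    have "countable I" unfolding I_def
      by (rule countable_subset[of _ "Basis \<rightarrow>\<^sub>E \<rat> \<times> \<rat>"])
        (auto intro!: countable_PiE countable_rat)
    then have "AE x in lborel. \<forall>f\<in>I. x \<in> cbox (a' f) (b' f) \<longrightarrow> g x = 0"
      using box0 by (subst AE_ball_countable) (auto simp: I_def)
    then show ?thesis by eventually_elim (use eq in blast)
  qed
  then have "AE x in lebesgue. x \<in> \<Omega> \<longrightarrow> g x = 0" by (rule AE_completion)
  then have "AE x in lebesgue. x \<in> \<Omega> \<longrightarrow> f x = 0" using fg' by eventually_elim auto
  then show ?thesis using \<Omega>m by (simp add: AE_restrict_space_iff)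
qed

lemma test_function_L2:
  assumes "test_function \<Omega>' \<phi>" "\<Omega> \<in> sets lebesgue"
  shows "\<phi> \<in> L2 (lebesgue_on \<Omega>)"
proof -
  obtain K where "compact K" "\<And>x. x \<notin> K \<Longrightarrow> \<phi> x = 0"
    using test_function_support[OF assms(1)] by metis
  then show ?thesis using compact_support_L2 test_function_continuous assms by blast
qed

lemma test_gradient_L2:
  assumes "test_function \<Omega>' \<phi>" "\<And>x. GDERIV \<phi> x :> \<psi> x" "\<Omega> \<in> sets lebesgue"
  shows "\<psi> \<in> L2 (lebesgue_on \<Omega>)"
proof -
  obtain K where "compact K" "\<And>x. x \<notin> K \<Longrightarrow> \<psi> x = 0"
    using test_function_support[OF assms(1)] assms(2) by metis
  then show ?thesis using compact_support_L2 test_function_gradient_continuous assms by blast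
qed

text \<open>Project \<open>f\<close> onto the closure of the test functions: the residual is
  orthogonal to every test function and hence zero almost everywhere.\<close>

lemma test_functions_dense:
  fixes f :: "'a::euclidean_space \<Rightarrow> real"
  assumes \<Omega>: "open \<Omega>" and f: "f \<in> L2 (lebesgue_on \<Omega>)"
  shows "\<exists>\<phi>. (\<forall>n::nat. test_function \<Omega> (\<phi> n)) \<and> (\<lambda>n. ip (lebesgue_on \<Omega>) (\<phi> n - f) (\<phi> n - f)) \<longlonglongrightarrow> 0"
proof -
  let ?M = "lebesgue_on \<Omega>"
  have \<Omega>m: "\<Omega> \<in> sets lebesgue" using \<Omega> by (simp add: sets_completionI_sets)
  have "subspace {\<phi>. test_function \<Omega> \<phi>}"
    unfolding subspace_def
    using test_function_zero[of \<Omega>] test_function_add[of \<Omega>] test_function_cmult[of \<Omega>]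
    by (auto simp: zero_fun_def plus_fun_def scaleR_fun_def)
  moreover have "{\<phi>. test_function \<Omega> \<phi>} \<subseteq> L2 ?M" using test_function_L2 \<Omega>m by auto
  ultimately obtain p \<phi> where p: "p \<in> L2 ?M" and \<phi>: "\<And>k::nat. test_function \<Omega> (\<phi> k)"
    and lim: "(\<lambda>k. ip ?M (\<phi> k - p) (\<phi> k - p)) \<longlonglongrightarrow> 0"
    and orth: "\<And>v. test_function \<Omega> v \<Longrightarrow> ip ?M (f - p) v = 0"
    using L2.projection_exists[OF _ _ f L2_complete, of "{\<phi>. test_function \<Omega> \<phi>}"] by blast
  have fp: "f - p \<in> L2 ?M" using subspace_diff[OF subspace_L2 f p] .
  have "AE x in ?M. (f - p) x = 0"
    by (rule test_functions_separate[OF \<Omega> fp]) (use orth in \<open>auto simp: ip_def\<close>)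
  then have "ip ?M (f - p) (f - p) = 0" using L2_null_iff[OF fp] by simp
  moreover have L: "\<phi> k \<in> L2 ?M" for k using test_function_L2[OF \<phi> \<Omega>m] .
  have "ip ?M (\<phi> k - f) (\<phi> k - f) \<le> 2 * ip ?M (\<phi> k - p) (\<phi> k - p) + 2 * ip ?M (f - p) (f - p)" for k
    using L2.diff_le[OF subspace_diff[OF subspace_L2 L p] fp, of k] by simp
  ultimately have le: "ip ?M (\<phi> k - f) (\<phi> k - f) \<le> 2 * ip ?M (\<phi> k - p) (\<phi> k - p)" for k by simp
  have "(\<lambda>k. ip ?M (\<phi> k - f) (\<phi> k - f)) \<longlonglongrightarrow> 0"
  proof (rule tendsto_sandwich[OF _ _ tendsto_const])
    show "(\<lambda>k. 2 * ip ?M (\<phi> k - p) (\<phi> k - p)) \<longlonglongrightarrow> 0" using tendsto_mult_right_zero[OF lim] .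
  qed (use le L2.nonneg[OF subspace_diff[OF subspace_L2 L f]] in \<open>auto intro!: always_eventually\<close>)
  then show ?thesis using \<phi> by blast
qed

section \<open>Weak gradients: linearity, closedness and uniqueness\<close>

lemma L2_test_components:
  assumes \<phi>: "test_function \<Omega>' \<phi>" and \<psi>: "\<And>x. GDERIV \<phi> x :> \<psi> x" and \<Omega>: "\<Omega> \<in> sets lebesgue"
  shows "(\<lambda>x. \<psi> x \<bullet> v) \<in> L2 (lebesgue_on \<Omega>)" "(\<lambda>x. \<phi> x *\<^sub>R v) \<in> L2 (lebesgue_on \<Omega>)"
proof -
  obtain K where K: "compact K" "\<And>x. x \<notin> K \<Longrightarrow> \<phi> x = 0" "\<And>x. x \<notin> K \<Longrightarrow> \<psi> x = 0"
    using test_function_support[OF \<phi>] \<psi> by metis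
  note c = test_function_continuous[OF \<phi>] test_function_gradient_continuous[OF \<phi> \<psi>]
  show "(\<lambda>x. \<psi> x \<bullet> v) \<in> L2 (lebesgue_on \<Omega>)"
    by (rule compact_support_L2[OF _ K(1) _ \<Omega>]) (use c K in \<open>auto intro!: continuous_intros\<close>)
  show "(\<lambda>x. \<phi> x *\<^sub>R v) \<in> L2 (lebesgue_on \<Omega>)"
    by (rule compact_support_L2[OF _ K(1) _ \<Omega>]) (use c K in \<open>auto intro!: continuous_intros\<close>)
qed

text \<open>Pairing the vector identity with every \<open>v\<close> turns it into scalar identities
  between values of \<open>ip\<close>, to which bilinearity, Cauchy-Schwarz and L^2 limits apply
  directly.\<close>

lemma weak_gradient_iff:
  assumes \<Omega>: "\<Omega> \<in> sets lebesgue"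
  shows "weak_gradient \<Omega> u G \<longleftrightarrow> u \<in> L2 (lebesgue_on \<Omega>) \<and> G \<in> L2 (lebesgue_on \<Omega>) \<and>
    (\<forall>\<phi> \<psi> v. test_function \<Omega> \<phi> \<longrightarrow> (\<forall>x. GDERIV \<phi> x :> \<psi> x) \<longrightarrow>
       ip (lebesgue_on \<Omega>) u (\<lambda>x. \<psi> x \<bullet> v) = - ip (lebesgue_on \<Omega>) G (\<lambda>x. \<phi> x *\<^sub>R v))"
    (is "_ \<longleftrightarrow> ?u \<and> ?G \<and> ?R")
proof -
  have "(LINT x|lebesgue_on \<Omega>. u x *\<^sub>R \<psi> x) = - (LINT x|lebesgue_on \<Omega>. \<phi> x *\<^sub>R G x) \<longleftrightarrow>
     (\<forall>v. ip (lebesgue_on \<Omega>) u (\<lambda>x. \<psi> x \<bullet> v) = - ip (lebesgue_on \<Omega>) G (\<lambda>x. \<phi> x *\<^sub>R v))"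
    if u: ?u and G: ?G and \<phi>: "test_function \<Omega> \<phi>" and \<psi>: "\<forall>x. GDERIV \<phi> x :> \<psi> x" for \<phi> \<psi>
  proof -
    let ?M = "lebesgue_on \<Omega>"
    have i: "integrable ?M (\<lambda>x. u x *\<^sub>R \<psi> x)" "integrable ?M (\<lambda>x. \<phi> x *\<^sub>R G x)"
      using u G test_gradient_L2[OF \<phi> _ \<Omega>, of \<psi>] \<psi> test_function_L2[OF \<phi> \<Omega>]
      by (auto intro: L2_scaleR_integrable)
    have "ip ?M u (\<lambda>x. \<psi> x \<bullet> v) = (LINT x|?M. u x *\<^sub>R \<psi> x) \<bullet> v" for v
      using i(1) by (simp add: ip_def flip: integral_inner_left)
    moreover have "ip ?M G (\<lambda>x. \<phi> x *\<^sub>R v) = (LINT x|?M. \<phi> x *\<^sub>R G x) \<bullet> v" for v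
      using i(2) by (simp add: ip_def flip: integral_inner_left)
    ultimately show ?thesis
      using vector_eq_rdot[of "LINT x|?M. u x *\<^sub>R \<psi> x" "- (LINT x|?M. \<phi> x *\<^sub>R G x)"]
      by (simp only: inner_minus_left)
  qed
  then show ?thesis unfolding weak_gradient_def square_integrable_iff_L2 by blast
qed

lemma weak_gradient_L2:
  assumes "weak_gradient \<Omega> u G"
  shows "u \<in> L2 (lebesgue_on \<Omega>)" "G \<in> L2 (lebesgue_on \<Omega>)"
  using assms by (auto simp: weak_gradient_def square_integrable_iff_L2)

lemma subspace_weak_gradient:
  assumes \<Omega>: "\<Omega> \<in> sets lebesgue"
  shows "subspace {(u, G). weak_gradient \<Omega> u G}"
proof -
  let ?M = "lebesgue_on \<Omega>"
  have t: "(\<lambda>x. \<psi> x \<bullet> v) \<in> L2 ?M" "(\<lambda>x. \<phi> x *\<^sub>R v) \<in> L2 ?M"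
    if "test_function \<Omega> \<phi>" "\<forall>x. GDERIV \<phi> x :> \<psi> x" for \<phi> \<psi> v
    using L2_test_components[OF that(1) _ \<Omega>] that(2) by auto
  show ?thesis
    unfolding subspace_def
  proof (intro conjI ballI allI)
    show "0 \<in> {(u, G). weak_gradient \<Omega> u G}"
      unfolding zero_prod_def mem_Collect_eq case_prod_conv weak_gradient_iff[OF \<Omega>]
      using L2.zero_left[OF t(1)] L2.zero_left[OF t(2)] by (auto simp: subspace_0[OF subspace_L2])
    fix p q c assume "p \<in> {(u, G). weak_gradient \<Omega> u G}"
    then obtain u G where p: "p = (u, G)" and u: "u \<in> L2 ?M" "G \<in> L2 ?M"
      and eq: "\<And>\<phi> \<psi> v. test_function \<Omega> \<phi> \<Longrightarrow> \<forall>x. GDERIV \<phi> x :> \<psi> x \<Longrightarrow>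
         ip ?M u (\<lambda>x. \<psi> x \<bullet> v) = - ip ?M G (\<lambda>x. \<phi> x *\<^sub>R v)"
      by (auto simp: weak_gradient_iff[OF \<Omega>])
    show "c *\<^sub>R p \<in> {(u, G). weak_gradient \<Omega> u G}"
      unfolding p scaleR_Pair mem_Collect_eq case_prod_conv weak_gradient_iff[OF \<Omega>]
    proof (intro conjI allI impI)
      fix \<phi> \<psi> v assume \<phi>: "test_function \<Omega> \<phi>" "\<forall>x. GDERIV \<phi> x :> \<psi> x"
      show "ip ?M (c *\<^sub>R u) (\<lambda>x. \<psi> x \<bullet> v) = - ip ?M (c *\<^sub>R G) (\<lambda>x. \<phi> x *\<^sub>R v)"
        using eq[OF \<phi>] L2.scale_left[OF u(1) t(1)[OF \<phi>]] L2.scale_left[OF u(2) t(2)[OF \<phi>]] by simp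
    qed (use u subspace_scale[OF subspace_L2] in auto)
    assume "q \<in> {(u, G). weak_gradient \<Omega> u G}"
    then obtain u' G' where q: "q = (u', G')" and u': "u' \<in> L2 ?M" "G' \<in> L2 ?M"
      and eq': "\<And>\<phi> \<psi> v. test_function \<Omega> \<phi> \<Longrightarrow> \<forall>x. GDERIV \<phi> x :> \<psi> x \<Longrightarrow>
         ip ?M u' (\<lambda>x. \<psi> x \<bullet> v) = - ip ?M G' (\<lambda>x. \<phi> x *\<^sub>R v)"
      by (auto simp: weak_gradient_iff[OF \<Omega>])
    show "p + q \<in> {(u, G). weak_gradient \<Omega> u G}"
      unfolding p q add_Pair mem_Collect_eq case_prod_conv weak_gradient_iff[OF \<Omega>]
    proof (intro conjI allI impI)
      fix \<phi> \<psi> v assume \<phi>: "test_function \<Omega> \<phi>" "\<forall>x. GDERIV \<phi> x :> \<psi> x"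
      show "ip ?M (u + u') (\<lambda>x. \<psi> x \<bullet> v) = - ip ?M (G + G') (\<lambda>x. \<phi> x *\<^sub>R v)"
        using eq[OF \<phi>] eq'[OF \<phi>] L2.add_left[OF u(1) u'(1) t(1)[OF \<phi>]] L2.add_left[OF u(2) u'(2) t(2)[OF \<phi>]]
        by simp
    qed (use u u' subspace_add[OF subspace_L2] in auto)
  qed
qed

lemma weak_gradient_closed:
  assumes \<Omega>: "\<Omega> \<in> sets lebesgue" and wg: "\<And>k::nat. weak_gradient \<Omega> (u k) (G k)"
    and u: "v \<in> L2 (lebesgue_on \<Omega>)" "(\<lambda>k. ip (lebesgue_on \<Omega>) (u k - v) (u k - v)) \<longlonglongrightarrow> 0"
    and G: "H \<in> L2 (lebesgue_on \<Omega>)" "(\<lambda>k. ip (lebesgue_on \<Omega>) (G k - H) (G k - H)) \<longlonglongrightarrow> 0"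
  shows "weak_gradient \<Omega> v H"
  unfolding weak_gradient_iff[OF \<Omega>]
proof (intro conjI u(1) G(1) allI impI)
  let ?M = "lebesgue_on \<Omega>"
  fix \<phi> \<psi> c assume \<phi>: "test_function \<Omega> \<phi>" and \<psi>: "\<forall>x. GDERIV \<phi> x :> \<psi> x"
  have t: "(\<lambda>x. \<psi> x \<bullet> c) \<in> L2 ?M" "(\<lambda>x. \<phi> x *\<^sub>R c) \<in> L2 ?M"
    using L2_test_components[OF \<phi> _ \<Omega>] \<psi> by auto
  have "(\<lambda>k. ip ?M (u k) (\<lambda>x. \<psi> x \<bullet> c)) \<longlonglongrightarrow> ip ?M v (\<lambda>x. \<psi> x \<bullet> c)"
    using weak_gradient_L2[OF wg] u t by (intro L2.tendsto_left) auto
  moreover have "(\<lambda>k. - ip ?M (G k) (\<lambda>x. \<phi> x *\<^sub>R c)) \<longlonglongrightarrow> - ip ?M H (\<lambda>x. \<phi> x *\<^sub>R c)"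
    using weak_gradient_L2[OF wg] G t by (intro tendsto_minus L2.tendsto_left) auto
  moreover have "ip ?M (u k) (\<lambda>x. \<psi> x \<bullet> c) = - ip ?M (G k) (\<lambda>x. \<phi> x *\<^sub>R c)" for k
    using wg[of k] \<phi> \<psi> unfolding weak_gradient_iff[OF \<Omega>] by blast
  ultimately show "ip ?M v (\<lambda>x. \<psi> x \<bullet> c) = - ip ?M H (\<lambda>x. \<phi> x *\<^sub>R c)"
    using LIMSEQ_unique by fastforce
qed

text \<open>Every component of the difference is orthogonal to all test functions. Almost everywhere
  uniqueness makes the energy independent of the gradient that is carried along with a
  function.\<close>

lemma weak_gradient_unique:
  assumes \<Omega>: "open \<Omega>" and G: "weak_gradient \<Omega> u G" and H: "weak_gradient \<Omega> u H"
  shows "AE x in lebesgue_on \<Omega>. G x = H x"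
proof -
  let ?M = "lebesgue_on \<Omega>"
  have \<Omega>m: "\<Omega> \<in> sets lebesgue" using \<Omega> by (simp add: sets_completionI_sets)
  note L = weak_gradient_L2[OF G] weak_gradient_L2[OF H]
  have GH: "G - H \<in> L2 ?M" using subspace_diff[OF subspace_L2 L(2,4)] .
  have "AE x in ?M. (G - H) x \<bullet> b = 0" if "b \<in> Basis" for b
  proof (rule test_functions_separate[OF \<Omega>])
    have "(\<lambda>x. ((G - H) x \<bullet> b)) \<in> borel_measurable ?M" using L2_measurable[OF GH] by measurable
    moreover have "integrable ?M (\<lambda>x. (norm ((G - H) x \<bullet> b))\<^sup>2)"
    proof (rule Bochner_Integration.integrable_bound[OF L2_integrable_square[OF GH]])
      show "(\<lambda>x. (norm ((G - H) x \<bullet> b))\<^sup>2) \<in> borel_measurable ?M" using L2_measurable[OF GH] by measurable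
      show "AE x in ?M. norm ((norm ((G - H) x \<bullet> b))\<^sup>2) \<le> norm ((norm ((G - H) x))\<^sup>2)"
        using power_mono[OF Basis_le_norm[OF that], of _ 2] by (intro AE_I2) (simp del: minus_apply)
    qed
    ultimately show "(\<lambda>x. ((G - H) x \<bullet> b)) \<in> L2 ?M" by (simp add: L2_def)
    fix \<phi> assume \<phi>: "test_function \<Omega> \<phi>"
    obtain \<psi> where \<psi>: "\<And>x. GDERIV \<phi> x :> \<psi> x" using test_function_gradient[OF \<phi>] by blast
    have t: "(\<lambda>x. \<phi> x *\<^sub>R b) \<in> L2 ?M" using L2_test_components[OF \<phi> \<psi> \<Omega>m] by auto
    have "ip ?M G (\<lambda>x. \<phi> x *\<^sub>R b) = ip ?M H (\<lambda>x. \<phi> x *\<^sub>R b)"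
    proof -
      have "ip ?M u (\<lambda>x. \<psi> x \<bullet> b) = - ip ?M K (\<lambda>x. \<phi> x *\<^sub>R b)" if "weak_gradient \<Omega> u K" for K
        using that \<phi> \<psi> unfolding weak_gradient_iff[OF \<Omega>m] by blast
      from this[OF G] this[OF H] show ?thesis by simp
    qed
    then have "ip ?M (G - H) (\<lambda>x. \<phi> x *\<^sub>R b) = 0" using L2.diff_left[OF L(2,4) t] by simp
    then show "(LINT x|?M. ((G - H) x \<bullet> b) * \<phi> x) = 0" by (simp add: ip_def mult.commute)
  qed
  then have "AE x in ?M. \<forall>b\<in>Basis. (G - H) x \<bullet> b = 0" by (intro AE_finite_allI) auto
  then show ?thesis
  proof eventually_elim
    case (elim x)
    then show ?case by - (rule euclidean_eqI, simp add: inner_diff_left)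
  qed
qed

section \<open>The translation estimate\<close>

lemma test_function_vanishes: "test_function \<Omega> \<phi> \<Longrightarrow> x \<notin> \<Omega> \<Longrightarrow> \<phi> x = 0"
  using closure_subset[of "{x. \<phi> x \<noteq> 0}"] unfolding test_function_def by blast

lemma weak_gradientD:
  assumes "weak_gradient \<Omega> u G" "\<Omega> \<in> sets lebesgue" "test_function \<Omega> \<phi>" "\<And>x. GDERIV \<phi> x :> \<psi> x"
  shows "ip (lebesgue_on \<Omega>) u (\<lambda>x. \<psi> x \<bullet> v) = - ip (lebesgue_on \<Omega>) G (\<lambda>x. \<phi> x *\<^sub>R v)"
  using assms unfolding weak_gradient_iff[OF assms(2)] by blast

lemma ip_cong_AE:
  assumes "f \<in> borel_measurable M" "f' \<in> borel_measurable M" "g \<in> borel_measurable M" "g' \<in> borel_measurable M"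
    and "AE x in M. f x = f' x" "AE x in M. g x = g' x"
  shows "ip M f g = ip M f' g'"
  unfolding ip_def
proof (rule integral_cong_AE)
  show "AE x in M. f x \<bullet> g x = f' x \<bullet> g' x" using assms(5,6) by eventually_elim simp
qed (use assms in measurable)

lemma L2_cong_AE:
  assumes "f \<in> L2 M" "g \<in> borel_measurable M" "AE x in M. f x = g x"
  shows "g \<in> L2 M"
proof -
  have "integrable M (\<lambda>x. (norm (g x))\<^sup>2)"
  proof (rule iffD1[OF integrable_cong_AE L2_integrable_square[OF assms(1)]])
    show "AE x in M. (norm (f x))\<^sup>2 = (norm (g x))\<^sup>2" using assms(3) by eventually_elim simp
  qed (use assms L2_measurable[OF assms(1)] in measurable)
  then show ?thesis using assms(2) by (simp add: L2_def)
qed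

lemma weak_gradient_cong_AE:
  assumes "weak_gradient \<Omega> u G" and m: "v \<in> borel_measurable (lebesgue_on \<Omega>)"
    and ae: "AE x in lebesgue_on \<Omega>. u x = v x" and \<Omega>: "\<Omega> \<in> sets lebesgue"
  shows "weak_gradient \<Omega> v G"
  unfolding weak_gradient_iff[OF \<Omega>]
proof (intro conjI allI impI)
  note L = weak_gradient_L2[OF assms(1)]
  show v: "v \<in> L2 (lebesgue_on \<Omega>)" by (rule L2_cong_AE[OF L(1) m ae])
  show "G \<in> L2 (lebesgue_on \<Omega>)" by (rule L)
  fix \<phi> \<psi> c assume \<phi>: "test_function \<Omega> \<phi>" "\<forall>x. GDERIV \<phi> x :> \<psi> x"
  have t: "(\<lambda>x. \<psi> x \<bullet> c) \<in> L2 (lebesgue_on \<Omega>)" using L2_test_components[OF \<phi>(1) _ \<Omega>] \<phi>(2) by auto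
  have "ip (lebesgue_on \<Omega>) v (\<lambda>x. \<psi> x \<bullet> c) = ip (lebesgue_on \<Omega>) u (\<lambda>x. \<psi> x \<bullet> c)"
    using ae by (intro ip_cong_AE L2_measurable[OF v] L2_measurable[OF L(1)] L2_measurable[OF t]) auto
  also have "\<dots> = - ip (lebesgue_on \<Omega>) G (\<lambda>x. \<phi> x *\<^sub>R c)"
    using assms(1) \<phi> unfolding weak_gradient_iff[OF \<Omega>] by blast
  finally show "ip (lebesgue_on \<Omega>) v (\<lambda>x. \<psi> x \<bullet> c) = - ip (lebesgue_on \<Omega>) G (\<lambda>x. \<phi> x *\<^sub>R c)" .
qed

lemma borel_measurable_lebesgue_on:
  "f \<in> borel_measurable borel \<Longrightarrow> f \<in> borel_measurable (lebesgue_on \<Omega>)"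
  by (intro measurable_restrict_space1 measurable_completion) simp

lemma ip_lborel:
  fixes f :: "'a::euclidean_space \<Rightarrow> real"
  assumes "f \<in> borel_measurable borel" "g \<in> borel_measurable borel" "S \<in> sets borel"
  shows "ip (lebesgue_on S) f g = (LINT x|lborel. indicator S x * (f x * g x))"
proof -
  have S: "S \<in> sets lebesgue" using assms by (simp add: sets_completionI_sets)
  have "ip (lebesgue_on S) f g = (LINT x|lebesgue. indicator S x *\<^sub>R (f x * g x))"
    unfolding ip_def using S by (subst integral_restrict_space) auto
  also have "\<dots> = (LINT x|lborel. indicator S x *\<^sub>R (f x * g x))"
    using assms by (intro integral_completion) auto
  finally show ?thesis by simp
qed

lemma L2_lebesgue_onI:
  fixes f :: "'a::euclidean_space \<Rightarrow> real"
  assumes "f \<in> borel_measurable borel" "integrable lborel (\<lambda>x. (f x)\<^sup>2)" "S \<in> sets lebesgue"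
  shows "f \<in> L2 (lebesgue_on S)"
  using assms borel_measurable_lebesgue_on integrable_lebesgue_on_of_lborel by (auto simp: L2_def)

text \<open>Translation and Fubini are available for Borel functions on the whole space, so the
  estimates below are made for such a representative, extended by zero, and transferred
  back.\<close>

lemma L2_borel_representative:
  fixes f :: "'a::euclidean_space \<Rightarrow> real"
  assumes f: "f \<in> L2 (lebesgue_on \<Omega>)" and \<Omega>: "\<Omega> \<in> sets borel"
  obtains g where "g \<in> borel_measurable borel" "\<And>x. x \<notin> \<Omega> \<Longrightarrow> g x = 0"
    "AE x in lebesgue_on \<Omega>. f x = g x" "integrable lborel (\<lambda>x. (g x)\<^sup>2)"
proof -
  have \<Omega>m: "\<Omega> \<in> sets lebesgue" using \<Omega> by (simp add: sets_completionI_sets)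
  have "(\<lambda>x. indicator \<Omega> x *\<^sub>R f x) \<in> borel_measurable lebesgue"
    using L2_measurable[OF f] borel_measurable_restrict_space_iff[of \<Omega> lebesgue f] \<Omega>m by simp
  then obtain g where g: "g \<in> borel_measurable lborel" and fg: "AE x in lborel. indicator \<Omega> x *\<^sub>R f x = g x"
    using completion_ex_borel_measurable_real by blast
  define k where "k x = indicator \<Omega> x * g x" for x
  have k: "k \<in> borel_measurable borel" unfolding k_def using g \<Omega> by measurable
  have "AE x in lebesgue. indicator \<Omega> x *\<^sub>R f x = g x" using fg by (rule AE_completion)
  then have "AE x in lebesgue. x \<in> \<Omega> \<longrightarrow> f x = k x"
    by eventually_elim (auto simp: k_def)
  then have ae: "AE x in lebesgue_on \<Omega>. f x = k x"
    using \<Omega>m by (simp add: AE_restrict_space_iff)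
  have "k \<in> L2 (lebesgue_on \<Omega>)" by (rule L2_cong_AE[OF f borel_measurable_lebesgue_on[OF k] ae])
  then have "integrable lebesgue (\<lambda>x. indicator \<Omega> x *\<^sub>R (k x)\<^sup>2)"
    using \<Omega>m by (simp add: L2_def integrable_restrict_space)
  moreover have "(\<lambda>x. indicator \<Omega> x *\<^sub>R (k x)\<^sup>2) = (\<lambda>x. (k x)\<^sup>2)" by (auto simp: k_def indicator_def fun_eq_iff)
  ultimately have "integrable lebesgue (\<lambda>x. (k x)\<^sup>2)" by simp
  then have "integrable lborel (\<lambda>x. (k x)\<^sup>2)" using k by (subst (asm) integrable_completion) auto
  then show ?thesis using that[of k] k ae by (auto simp: k_def)
qed

lemma lborel_integrable_translate:
  fixes f :: "'a::euclidean_space \<Rightarrow> 'b::euclidean_space"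
  assumes "integrable lborel f"
  shows "integrable lborel (\<lambda>x. f (x + h))"
proof -
  have "integrable (distr lborel borel ((+) h)) f" using assms by (simp add: lborel_distr_plus)
  then have "integrable lborel (\<lambda>x. f (h + x))" by (rule integrable_distr[rotated]) simp
  then show ?thesis by (simp add: add.commute)
qed

text \<open>Norm by duality: letting test functions tend to \<open>w\<close> in the bound gives
  \<open>(ip w w)\<^sup>2 \<le> C * ip w w\<close>, from which one factor cancels unless it is
  zero.\<close>

lemma ip_le_of_dual_bound:
  fixes w :: "'a::euclidean_space \<Rightarrow> real"
  assumes A: "open A" and w: "w \<in> L2 (lebesgue_on A)"
    and C: "C \<ge> 0" and bound: "\<And>\<phi>. test_function A \<phi> \<Longrightarrow> (ip (lebesgue_on A) w \<phi>)\<^sup>2 \<le> C * ip (lebesgue_on A) \<phi> \<phi>"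
  shows "ip (lebesgue_on A) w w \<le> C"
proof -
  let ?M = "lebesgue_on A"
  have Am: "A \<in> sets lebesgue" using A by (simp add: sets_completionI_sets)
  obtain \<phi> where \<phi>: "\<And>n::nat. test_function A (\<phi> n)" and lim: "(\<lambda>n. ip ?M (\<phi> n - w) (\<phi> n - w)) \<longlonglongrightarrow> 0"
    using test_functions_dense[OF A w] by blast
  have L: "\<phi> n \<in> L2 ?M" for n using test_function_L2[OF \<phi> Am] .
  have "(\<lambda>n. (ip ?M w (\<phi> n))\<^sup>2) \<longlonglongrightarrow> (ip ?M w w)\<^sup>2"
    using tendsto_power[OF L2.tendsto_left[OF L w w lim], of 2] L2.sym[OF w L] by simp
  moreover have "(\<lambda>n. C * ip ?M (\<phi> n) (\<phi> n)) \<longlonglongrightarrow> C * ip ?M w w"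
    by (intro tendsto_intros L2.tendsto_quadratic[OF L w lim])
  ultimately have "(ip ?M w w)\<^sup>2 \<le> C * ip ?M w w"
    by (rule LIMSEQ_le) (use bound[OF \<phi>] in blast)
  then have *: "ip ?M w w * ip ?M w w \<le> C * ip ?M w w" by (simp add: power2_eq_square)
  show ?thesis
  proof (cases "ip ?M w w > 0")
    case True
    then show ?thesis using * by simp
  next
    case False
    then have z: "ip ?M w w = 0" using L2.nonneg[OF w] by simp
    then show ?thesis using C by simp
  qed
qed

text \<open>The translation acts on the smooth factor \<open>\<phi>\<close>, so the integral is
  differentiable in the shift although \<open>u\<close> is merely square integrable.\<close>

lemma DERIV_integral_translate:
  fixes u :: "'a::euclidean_space \<Rightarrow> real"
  assumes u: "u \<in> borel_measurable borel" "integrable lborel (\<lambda>x. (u x)\<^sup>2)"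
    and \<phi>: "test_function UNIV \<phi>" and \<psi>: "\<And>x. GDERIV \<phi> x :> \<psi> x"
  shows "((\<lambda>s. LINT y|lborel. u y * \<phi> (y - s *\<^sub>R h)) has_real_derivative
     - (LINT y|lborel. u y * (\<psi> (y - s *\<^sub>R h) \<bullet> h))) (at s)"
proof -
  obtain K where K: "compact K" "\<And>x. x \<notin> K \<Longrightarrow> \<phi> x = 0" "\<And>x. x \<notin> K \<Longrightarrow> \<psi> x = 0"
    using test_function_support[OF \<phi>] \<psi> by metis
  have c: "continuous_on UNIV \<phi>" "continuous_on UNIV \<psi>"
    using test_function_continuous[OF \<phi>] test_function_gradient_continuous[OF \<phi> \<psi>] by auto
  have [measurable]: "\<phi> \<in> borel_measurable borel" "\<psi> \<in> borel_measurable borel" "u \<in> borel_measurable borel"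
    using c u by (auto intro: borel_measurable_continuous_onI)
  obtain B where B: "B > 0" "\<And>x. norm (\<psi> x) \<le> B" using compact_support_bounded[OF c(2) K(1,3)] by metis
  \<comment> \<open>Contains every \<open>y\<close> for which \<open>y - r *\<^sub>R h\<close> meets
    the support, for all shifts \<open>r\<close> at distance at most 1 from \<open>s\<close>; the
    dominating function lives on this set.\<close>
  define R where "R = (\<lambda>(x, y). x + y) ` (K \<times> cball (0::'a) ((\<bar>s\<bar> + 1) * norm h))"
  have R: "compact R"
    unfolding R_def case_prod_beta by (intro compact_continuous_image compact_Times K continuous_intros) auto
  have [measurable]: "R \<in> sets borel" using R by (simp add: compact_imp_closed)
  have RI: "y \<in> R" if "y - r *\<^sub>R h \<in> K" "\<bar>r\<bar> \<le> \<bar>s\<bar> + 1" for y r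
    unfolding R_def
    by (rule image_eqI[of _ _ "(y - r *\<^sub>R h, r *\<^sub>R h)"]) (use that in \<open>auto intro: mult_right_mono\<close>)
  have indR: "integrable lborel (\<lambda>x. indicator R x * (B * norm h)\<^sup>2 :: real)"
    using borel_integrable_compact[OF R, of "\<lambda>_. (B * norm h)\<^sup>2"] by simp
  have dom: "integrable lborel (\<lambda>y. \<bar>u y\<bar> * (indicator R y * (B * norm h)))"
  proof (rule Bochner_Integration.integrable_bound[OF Bochner_Integration.integrable_add[OF u(2) indR]])
    show "AE y in lborel. norm (\<bar>u y\<bar> * (indicator R y * (B * norm h))) \<le> norm ((u y)\<^sup>2 + indicator R y * (B * norm h)\<^sup>2)"
    proof (rule AE_I2)
      fix y
      show "norm (\<bar>u y\<bar> * (indicator R y * (B * norm h))) \<le> norm ((u y)\<^sup>2 + indicator R y * (B * norm h)\<^sup>2)"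
        using mult_le_squares[of "\<bar>u y\<bar>" "B * norm h"] B(1) by (auto simp: indicator_def abs_mult)
    qed
  qed measurable
  define F where "F s = (LINT y|lborel. u y * \<phi> (y - s *\<^sub>R h))" for s
  have int: "integrable lborel (\<lambda>y. u y * \<phi> (y - r *\<^sub>R h))" for r
  proof -
    have "integrable lborel (\<lambda>y. (\<phi> y)\<^sup>2)"
      by (rule compact_support_integrable[OF _ K(1)]) (use c K in \<open>auto intro!: continuous_intros\<close>)
    from lborel_integrable_translate[OF this, of "- r *\<^sub>R h"]
    have "integrable lborel (\<lambda>y. (\<phi> (y - r *\<^sub>R h))\<^sup>2)" by simp
    from Bochner_Integration.integrable_add[OF u(2) this] show ?thesis
    proof (rule Bochner_Integration.integrable_bound)
      show "AE y in lborel. norm (u y * \<phi> (y - r *\<^sub>R h)) \<le> norm ((u y)\<^sup>2 + (\<phi> (y - r *\<^sub>R h))\<^sup>2)"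
      proof (rule AE_I2)
        fix y
        show "norm (u y * \<phi> (y - r *\<^sub>R h)) \<le> norm ((u y)\<^sup>2 + (\<phi> (y - r *\<^sub>R h))\<^sup>2)"
          using mult_le_squares[of "\<bar>u y\<bar>" "\<bar>\<phi> (y - r *\<^sub>R h)\<bar>"] by (simp add: abs_mult)
      qed
    qed measurable
  qed
  have dl: "((\<lambda>r. \<phi> (y - r *\<^sub>R h)) has_real_derivative - (\<psi> (y - r *\<^sub>R h) \<bullet> h)) (at r)" for y r
    using DERIV_along_line[of \<phi> y r "- h" "\<psi> (y - r *\<^sub>R h)"] \<psi> by simp
  have "((\<lambda>t. (F (s + t) - F s) / t) \<longlongrightarrow> - (LINT y|lborel. u y * (\<psi> (y - s *\<^sub>R h) \<bullet> h))) (at 0)"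
    unfolding tendsto_at_iff_sequentially comp_def
  proof (intro allI impI)
    fix t :: "nat \<Rightarrow> real" assume t: "\<forall>i. t i \<in> UNIV - {0}" and t0: "t \<longlonglongrightarrow> 0"
    have Fq: "(F (s + t n) - F s) / t n = (LINT y|lborel. u y * ((\<phi> (y - (s + t n) *\<^sub>R h) - \<phi> (y - s *\<^sub>R h)) / t n))" for n
    proof -
      have "(F (s + t n) - F s) / t n = (LINT y|lborel. (u y * \<phi> (y - (s + t n) *\<^sub>R h) - u y * \<phi> (y - s *\<^sub>R h)) / t n)"
        unfolding F_def using int[of "s + t n"] int[of s] by simp
      also have "(\<lambda>y. (u y * \<phi> (y - (s + t n) *\<^sub>R h) - u y * \<phi> (y - s *\<^sub>R h)) / t n)
        = (\<lambda>y. u y * ((\<phi> (y - (s + t n) *\<^sub>R h) - \<phi> (y - s *\<^sub>R h)) / t n))"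
        by (simp add: right_diff_distrib diff_divide_distrib)
      finally show ?thesis .
    qed
    \<comment> \<open>Domination holds only for increments below 1 in absolute value, so an initial
      segment of the sequence is dropped.\<close>
    obtain n0 where n0: "\<And>n. n \<ge> n0 \<Longrightarrow> \<bar>t n\<bar> < 1"
      using order_tendstoD(2)[OF tendsto_rabs_zero[OF t0], of 1] by (auto simp: eventually_sequentially)
    have "(\<lambda>n. LINT y|lborel. u y * ((\<phi> (y - (s + t (n + n0)) *\<^sub>R h) - \<phi> (y - s *\<^sub>R h)) / t (n + n0)))
      \<longlonglongrightarrow> (LINT y|lborel. u y * - (\<psi> (y - s *\<^sub>R h) \<bullet> h))"
    proof (rule integral_dominated_convergence[OF _ _ dom])
      show "AE y in lborel. (\<lambda>n. u y * ((\<phi> (y - (s + t (n + n0)) *\<^sub>R h) - \<phi> (y - s *\<^sub>R h)) / t (n + n0)))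
          \<longlonglongrightarrow> u y * - (\<psi> (y - s *\<^sub>R h) \<bullet> h)"
      proof (rule AE_I2)
        fix y
        have "((\<lambda>t. (\<phi> (y - (s + t) *\<^sub>R h) - \<phi> (y - s *\<^sub>R h)) / t) \<longlongrightarrow> - (\<psi> (y - s *\<^sub>R h) \<bullet> h)) (at 0)"
          using dl[of y s] by (simp add: DERIV_def)
        then have "(\<lambda>n. (\<phi> (y - (s + t n) *\<^sub>R h) - \<phi> (y - s *\<^sub>R h)) / t n) \<longlonglongrightarrow> - (\<psi> (y - s *\<^sub>R h) \<bullet> h)"
          unfolding tendsto_at_iff_sequentially comp_def using t t0 by blast
        from LIMSEQ_ignore_initial_segment[OF this, of n0]
        show "(\<lambda>n. u y * ((\<phi> (y - (s + t (n + n0)) *\<^sub>R h) - \<phi> (y - s *\<^sub>R h)) / t (n + n0)))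
          \<longlonglongrightarrow> u y * - (\<psi> (y - s *\<^sub>R h) \<bullet> h)"
          by (intro tendsto_mult tendsto_const)
      qed
      show "AE y in lborel. norm (u y * ((\<phi> (y - (s + t (n + n0)) *\<^sub>R h) - \<phi> (y - s *\<^sub>R h)) / t (n + n0)))
         \<le> \<bar>u y\<bar> * (indicator R y * (B * norm h))" for n
      proof (rule AE_I2)
        fix y
        let ?t = "t (n + n0)"
        have tn: "?t \<noteq> 0" "\<bar>?t\<bar> < 1" using t n0[of "n + n0"] by auto
        obtain z where z: "0 < z" "z < 1" and
          eq: "\<phi> (y - s *\<^sub>R h + (- ?t) *\<^sub>R h) - \<phi> (y - s *\<^sub>R h) = \<psi> (y - s *\<^sub>R h + z *\<^sub>R ((- ?t) *\<^sub>R h)) \<bullet> ((- ?t) *\<^sub>R h)"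
          using GDERIV_mvt[OF \<psi>] by blast
        let ?y = "y - (s + z * ?t) *\<^sub>R h"
        have eq': "\<phi> (y - (s + ?t) *\<^sub>R h) - \<phi> (y - s *\<^sub>R h) = - ?t * (\<psi> ?y \<bullet> h)"
          using eq by (simp add: algebra_simps)
        have "\<bar>(\<phi> (y - (s + ?t) *\<^sub>R h) - \<phi> (y - s *\<^sub>R h)) / ?t\<bar> = \<bar>\<psi> ?y \<bullet> h\<bar>"
          unfolding eq' using tn by simp
        also have "\<dots> \<le> indicator R y * (B * norm h)"
        proof (cases "?y \<in> K")
          case True
          have "\<bar>s + z * ?t\<bar> \<le> \<bar>s\<bar> + \<bar>z * ?t\<bar>" by (rule abs_triangle_ineq)
          also have "\<bar>z * ?t\<bar> \<le> 1" using z tn by (simp add: abs_mult mult_le_one)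
          finally have "y \<in> R" using RI[OF True] by simp
          moreover have "\<bar>\<psi> ?y \<bullet> h\<bar> \<le> B * norm h"
            by (rule order_trans[OF Cauchy_Schwarz_ineq2]) (intro mult_right_mono B, simp)
          ultimately show ?thesis by simp
        next
          case False
          then show ?thesis using K(3) B(1) by simp
        qed
        finally show "norm (u y * ((\<phi> (y - (s + ?t) *\<^sub>R h) - \<phi> (y - s *\<^sub>R h)) / ?t))
           \<le> \<bar>u y\<bar> * (indicator R y * (B * norm h))"
          by (simp only: real_norm_def abs_mult) (intro mult_left_mono, auto)
      qed
    qed measurable
    then have "(\<lambda>n. (F (s + t (n + n0)) - F s) / t (n + n0)) \<longlonglongrightarrow> (LINT y|lborel. u y * - (\<psi> (y - s *\<^sub>R h) \<bullet> h))"
      unfolding Fq .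
    then have "(\<lambda>n. (F (s + t n) - F s) / t n) \<longlonglongrightarrow> (LINT y|lborel. u y * - (\<psi> (y - s *\<^sub>R h) \<bullet> h))"
      by (rule LIMSEQ_offset)
    then show "(\<lambda>n. (F (s + t n) - F s) / t n) \<longlonglongrightarrow> - (LINT y|lborel. u y * (\<psi> (y - s *\<^sub>R h) \<bullet> h))"
      by simp
  qed
  then show ?thesis unfolding DERIV_def F_def .
qed

text \<open>The increment \<open>u (x + h) - u x\<close> is tested against \<open>\<phi>\<close>.
  The translation moves to \<open>\<phi>\<close>, the mean value theorem produces a derivative at
  one intermediate shift, and there the weak gradient of \<open>u\<close> applies. Cauchy-Schwarz
  and duality finish, with no smoothing of \<open>u\<close>.\<close>

lemma translation_estimate:
  fixes u :: "'a::euclidean_space \<Rightarrow> real"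
  assumes \<Omega>: "open \<Omega>" and wg: "weak_gradient \<Omega> u G"
    and u: "u \<in> borel_measurable borel" "\<And>x. x \<notin> \<Omega> \<Longrightarrow> u x = 0" "integrable lborel (\<lambda>x. (u x)\<^sup>2)"
    and A: "open A" "\<And>x s. x \<in> A \<Longrightarrow> 0 \<le> s \<Longrightarrow> s \<le> 1 \<Longrightarrow> x + s *\<^sub>R h \<in> \<Omega>"
  shows "(LINT x|lborel. indicator A x * (u (x + h) - u x)\<^sup>2) \<le> (norm h)\<^sup>2 * ip (lebesgue_on \<Omega>) G G"
proof -
  have \<Omega>b: "\<Omega> \<in> sets borel" using \<Omega> by simp
  then have \<Omega>m: "\<Omega> \<in> sets lebesgue" by (simp add: sets_completionI_sets)
  have Ab: "A \<in> sets borel" using A by simp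
  then have Am: "A \<in> sets lebesgue" by (simp add: sets_completionI_sets)
  note [measurable] = u(1)
  define w where "w x = u (x + h) - u x" for x
  have w: "w \<in> borel_measurable borel" unfolding w_def by measurable
  have uh: "integrable lborel (\<lambda>x. (u (x + h))\<^sup>2)" using lborel_integrable_translate[OF u(3)] .
  have uhb: "(\<lambda>x. u (x + h)) \<in> borel_measurable borel" by measurable
  have "w \<in> L2 (lebesgue_on A)"
    unfolding w_def by (rule L2_diff[OF L2_lebesgue_onI[OF uhb uh Am] L2_lebesgue_onI[OF u(1,3) Am]])
  moreover have "(ip (lebesgue_on A) w \<phi>)\<^sup>2 \<le> ((norm h)\<^sup>2 * ip (lebesgue_on \<Omega>) G G) * ip (lebesgue_on A) \<phi> \<phi>"
    if \<phi>: "test_function A \<phi>" for \<phi>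
  proof -
    obtain \<psi> where \<psi>: "\<And>x. GDERIV \<phi> x :> \<psi> x" using test_function_gradient[OF \<phi>] by blast
    have \<phi>U: "test_function UNIV \<phi>" using test_function_mono[OF \<phi>] by simp
    obtain K where K: "compact K" "K \<subseteq> A" "\<And>x. x \<notin> K \<Longrightarrow> \<phi> x = 0"
      using test_function_support[OF \<phi>] by metis
    have c: "continuous_on UNIV \<phi>" "continuous_on UNIV \<psi>"
      using test_function_continuous[OF \<phi>] test_function_gradient_continuous[OF \<phi> \<psi>] by auto
    have [measurable]: "\<phi> \<in> borel_measurable borel" "\<psi> \<in> borel_measurable borel"
      using c by (auto intro: borel_measurable_continuous_onI)
    have \<phi>2: "integrable lborel (\<lambda>y. (\<phi> y)\<^sup>2)"
      by (rule compact_support_integrable[OF _ K(1)]) (use c K in \<open>auto intro!: continuous_intros\<close>)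
    have \<phi>L: "\<phi> \<in> L2 lborel" using \<phi>2 by (simp add: L2_def)
    have uL: "u \<in> L2 lborel" "(\<lambda>x. u (x + h)) \<in> L2 lborel" using u uh by (simp_all add: L2_def)
    define F where "F s = (LINT y|lborel. u y * \<phi> (y - s *\<^sub>R h))" for s
    \<comment> \<open>Mean value theorem for the pairing of \<open>u\<close> with the test function
      shifted from 0 to \<open>h\<close>.\<close>
    have "\<exists>z>0. z < 1 \<and> F 1 - F 0 = (1 - 0) * (- (LINT y|lborel. u y * (\<psi> (y - z *\<^sub>R h) \<bullet> h)))"
      unfolding F_def by (rule MVT2) (use DERIV_integral_translate[OF u(1,3) \<phi>U \<psi>] in auto)
    then obtain z where z: "0 < z" "z < 1" and Fz: "F 1 - F 0 = - (LINT y|lborel. u y * (\<psi> (y - z *\<^sub>R h) \<bullet> h))"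
      by auto
    have F1: "F 1 = (LINT y|lborel. u (y + h) * \<phi> y)"
      unfolding F_def using lborel_integral_translate[of "\<lambda>y. u y * \<phi> (y - h)" h] by simp
    have ipw: "ip (lebesgue_on A) w \<phi> = F 1 - F 0"
    proof -
      have "ip (lebesgue_on A) w \<phi> = (LINT y|lborel. indicator A y * (w y * \<phi> y))"
        by (rule ip_lborel[OF w _ Ab]) measurable
      also have "\<dots> = (LINT y|lborel. u (y + h) * \<phi> y - u y * \<phi> y)"
        using K by (intro Bochner_Integration.integral_cong) (auto simp: w_def indicator_def left_diff_distrib)
      also have "\<dots> = F 1 - F 0"
        unfolding F1 unfolding F_def using L2_inner_integrable[OF uL(1) \<phi>L] L2_inner_integrable[OF uL(2) \<phi>L] by simp
      finally show ?thesis .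
    qed
    let ?\<phi> = "\<lambda>y. \<phi> (y - z *\<^sub>R h)" and ?\<psi> = "\<lambda>y. \<psi> (y - z *\<^sub>R h)"
    \<comment> \<open>The assumption on segments enters here: shifting a function supported in
      \<open>A\<close> by \<open>z *\<^sub>R h\<close> keeps its support inside
      \<open>\<Omega>\<close>.\<close>
    have tz: "test_function \<Omega> ?\<phi>" by (rule test_function_translate[OF \<phi>]) (use A(2) z in auto)
    have gz: "GDERIV ?\<phi> x :> ?\<psi> x" for x
      using GDERIV_compose_orthogonal[OF orthogonal_transformation_id, of "\<lambda>x. x" \<phi> "- (z *\<^sub>R h)" x "?\<psi> x"] \<psi>
      by (simp add: id_def)
    have t: "(\<lambda>y. ?\<phi> y *\<^sub>R h) \<in> L2 (lebesgue_on \<Omega>)" using L2_test_components[OF tz gz \<Omega>m] by auto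
    have "(LINT y|lborel. u y * (?\<psi> y \<bullet> h)) = ip (lebesgue_on \<Omega>) u (\<lambda>y. ?\<psi> y \<bullet> h)"
    proof -
      have "ip (lebesgue_on \<Omega>) u (\<lambda>y. ?\<psi> y \<bullet> h) = (LINT y|lborel. indicator \<Omega> y * (u y * (?\<psi> y \<bullet> h)))"
        by (rule ip_lborel[OF u(1) _ \<Omega>b]) measurable
      also have "\<dots> = (LINT y|lborel. u y * (?\<psi> y \<bullet> h))"
        by (rule Bochner_Integration.integral_cong) (auto simp: indicator_def u(2))
      finally show ?thesis by simp
    qed
    also have "\<dots> = - ip (lebesgue_on \<Omega>) G (\<lambda>y. ?\<phi> y *\<^sub>R h)"
      by (rule weak_gradientD[OF wg \<Omega>m tz gz])
    finally have "ip (lebesgue_on A) w \<phi> = ip (lebesgue_on \<Omega>) G (\<lambda>y. ?\<phi> y *\<^sub>R h)" using ipw Fz by simp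
    then have "(ip (lebesgue_on A) w \<phi>)\<^sup>2 \<le> ip (lebesgue_on \<Omega>) G G * ip (lebesgue_on \<Omega>) (\<lambda>y. ?\<phi> y *\<^sub>R h) (\<lambda>y. ?\<phi> y *\<^sub>R h)"
      using L2.cauchy_schwarz[OF weak_gradient_L2(2)[OF wg] t] by simp
    also have "ip (lebesgue_on \<Omega>) (\<lambda>y. ?\<phi> y *\<^sub>R h) (\<lambda>y. ?\<phi> y *\<^sub>R h) = (norm h)\<^sup>2 * ip (lebesgue_on \<Omega>) ?\<phi> ?\<phi>"
      by (simp add: ip_def power2_norm_eq_inner mult.commute mult.left_commute)
    also have "ip (lebesgue_on \<Omega>) ?\<phi> ?\<phi> = (LINT y|lborel. (?\<phi> y)\<^sup>2)"
    proof -
      have z0: "?\<phi> y = 0" if "y \<notin> \<Omega>" for y using test_function_vanishes[OF tz that] .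
      have "ip (lebesgue_on \<Omega>) ?\<phi> ?\<phi> = (LINT y|lborel. indicator \<Omega> y * (?\<phi> y * ?\<phi> y))"
        by (rule ip_lborel[OF _ _ \<Omega>b]) measurable
      also have "\<dots> = (LINT y|lborel. (?\<phi> y)\<^sup>2)"
        by (rule Bochner_Integration.integral_cong) (auto simp: indicator_def power2_eq_square z0)
      finally show ?thesis .
    qed
    also have "\<dots> = (LINT y|lborel. (\<phi> y)\<^sup>2)"
      using lborel_integral_translate[of "\<lambda>y. (\<phi> y)\<^sup>2" "- (z *\<^sub>R h)"] by simp
    also have "\<dots> = ip (lebesgue_on A) \<phi> \<phi>"
    proof -
      have "ip (lebesgue_on A) \<phi> \<phi> = (LINT y|lborel. indicator A y * (\<phi> y * \<phi> y))"
        by (rule ip_lborel[OF _ _ Ab]) measurable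
      also have "\<dots> = (LINT y|lborel. (\<phi> y)\<^sup>2)"
        by (rule Bochner_Integration.integral_cong)
          (auto simp: indicator_def power2_eq_square test_function_vanishes[OF \<phi>])
      finally show ?thesis by simp
    qed
    finally show ?thesis by (simp add: mult.commute mult.left_commute)
  qed
  ultimately have "ip (lebesgue_on A) w w \<le> (norm h)\<^sup>2 * ip (lebesgue_on \<Omega>) G G"
    using L2.nonneg[OF weak_gradient_L2(2)[OF wg]] by (intro ip_le_of_dual_bound[OF A(1)]) auto
  then show ?thesis by (subst (asm) ip_lborel[OF w w Ab]) (simp add: w_def power2_eq_square)
qed

section \<open>Compactness\<close>

lemma nn_integral_lborel_translate:
  fixes f :: "'a::euclidean_space \<Rightarrow> ennreal"
  assumes "f \<in> borel_measurable borel"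
  shows "(\<integral>\<^sup>+x. f (x + h) \<partial>lborel) = (\<integral>\<^sup>+x. f x \<partial>lborel)"
proof -
  have "(\<integral>\<^sup>+x. f x \<partial>lborel) = (\<integral>\<^sup>+x. f x \<partial>distr lborel borel ((+) h))" by (simp add: lborel_distr_plus)
  also have "\<dots> = (\<integral>\<^sup>+x. f (h + x) \<partial>lborel)" using assms by (intro nn_integral_distr) auto
  finally show ?thesis by (simp add: add.commute)
qed

lemma integrable_indicator_ball:
  "integrable lborel (indicat_real (ball (x::'a::euclidean_space) r))"
  using emeasure_lborel_ball_finite[of x r] by (intro integrable_real_indicator) auto

lemma L2_indicator_ball:
  "\<Omega> \<in> sets lebesgue \<Longrightarrow> (\<lambda>y. c * indicat_real (ball (x::'a::euclidean_space) r) y) \<in> L2 (lebesgue_on \<Omega>)"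
proof (rule L2_lebesgue_onI)
  have "(\<lambda>y. (c * indicat_real (ball x r) y)\<^sup>2) = (\<lambda>y. c\<^sup>2 * indicat_real (ball x r) y)"
    by (auto simp: indicator_def fun_eq_iff)
  then show "integrable lborel (\<lambda>y. (c * indicat_real (ball x r) y)\<^sup>2)"
    using integrable_indicator_ball[of x r] by simp
  have [measurable]: "ball x r \<in> sets borel" by simp
  show "(\<lambda>y. c * indicat_real (ball x r) y) \<in> borel_measurable borel" by measurable
qed

text \<open>The deviation of \<open>g x\<close> from the mean of \<open>g\<close> over a ball is at most the mean of the
  deviations \<open>g x - g y\<close>, and \<open>y - x\<close> stays in the ball of twice the radius.\<close>

lemma deviation_from_ball_mean:
  fixes g :: "'a::euclidean_space \<Rightarrow> real"
  assumes g: "g \<in> borel_measurable borel" "integrable lborel (\<lambda>x. (g x)\<^sup>2)"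
    and x: "x \<in> ball p \<delta>" and V: "V = measure lborel (ball p \<delta>)" "V > 0"
    and a: "a = (LINT y|lborel. indicator (ball p \<delta>) y * g y) / V"
  shows "ennreal (V * (g x - a)\<^sup>2) \<le> (\<integral>\<^sup>+h. ennreal (indicator (ball 0 (2 * \<delta>)) h * (g (x + h) - g x)\<^sup>2) \<partial>lborel)"
proof -
  let ?B = "ball p \<delta>"
  note [measurable] = g(1)
  have [measurable]: "?B \<in> sets borel" by simp
  have iB: "integrable lborel (indicat_real ?B)" by (rule integrable_indicator_ball)
  have ig2: "integrable lborel (\<lambda>y. indicator ?B y * (g y)\<^sup>2)"
    using integrable_mult_indicator[of ?B lborel "\<lambda>y. (g y)\<^sup>2"] g(2) by simp
  have ig: "integrable lborel (\<lambda>y. indicator ?B y * g y)"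
  proof (rule Bochner_Integration.integrable_bound[OF Bochner_Integration.integrable_add[OF iB ig2]])
    show "AE y in lborel. norm (indicator ?B y * g y) \<le> norm (indicat_real ?B y + indicator ?B y * (g y)\<^sup>2)"
    proof (rule AE_I2)
      fix y
      show "norm (indicator ?B y * g y) \<le> norm (indicat_real ?B y + indicator ?B y * (g y)\<^sup>2)"
        using mult_le_squares[of 1 "\<bar>g y\<bar>"] by (auto simp: indicator_def)
    qed
  qed measurable
  have mV: "(LINT y|lborel. indicat_real ?B y) = V" by (simp add: V)
  have expand: "(LINT y|lborel. indicator ?B y * (c - g y)\<^sup>2) = V * c\<^sup>2 - 2 * c * (V * a) + (LINT y|lborel. indicator ?B y * (g y)\<^sup>2)"
    and int: "integrable lborel (\<lambda>y. indicator ?B y * (c - g y)\<^sup>2)" for c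
  proof -
    have eq: "(\<lambda>y. indicator ?B y * (c - g y)\<^sup>2) =
       (\<lambda>y. c\<^sup>2 * indicat_real ?B y - 2 * c * (indicator ?B y * g y) + indicator ?B y * (g y)\<^sup>2)"
      by (auto simp: fun_eq_iff power2_eq_square algebra_simps)
    show "integrable lborel (\<lambda>y. indicator ?B y * (c - g y)\<^sup>2)"
      unfolding eq using iB ig ig2 by auto
    show "(LINT y|lborel. indicator ?B y * (c - g y)\<^sup>2) = V * c\<^sup>2 - 2 * c * (V * a) + (LINT y|lborel. indicator ?B y * (g y)\<^sup>2)"
      unfolding eq using iB ig ig2 mV V(2) by (simp add: a mult.commute)
  qed
  \<comment> \<open>Nonnegativity of the variance on the ball, that is
    \<open>V * a\<^sup>2 \<le> \<integral> g\<^sup>2\<close>; inserted into \<open>expand\<close> it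
    is Jensen's inequality for the square.\<close>
  have "0 \<le> (LINT y|lborel. indicator ?B y * (a - g y)\<^sup>2)" by (intro integral_nonneg_AE AE_I2) simp
  then have "V * a\<^sup>2 \<le> (LINT y|lborel. indicator ?B y * (g y)\<^sup>2)"
    unfolding expand by (simp add: power2_eq_square)
  then have "V * (g x - a)\<^sup>2 \<le> (LINT y|lborel. indicator ?B y * (g x - g y)\<^sup>2)"
    unfolding expand by (simp add: power2_eq_square algebra_simps)
  then have "ennreal (V * (g x - a)\<^sup>2) \<le> ennreal (LINT y|lborel. indicator ?B y * (g x - g y)\<^sup>2)"
    by (rule ennreal_leI)
  also have "\<dots> = (\<integral>\<^sup>+y. ennreal (indicator ?B y * (g x - g y)\<^sup>2) \<partial>lborel)"
    by (rule nn_integral_eq_integral[symmetric, OF int]) simp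
  also have "\<dots> \<le> (\<integral>\<^sup>+y. ennreal (indicator (ball 0 (2 * \<delta>)) (y - x) * (g y - g x)\<^sup>2) \<partial>lborel)"
  proof (rule nn_integral_mono)
    fix y
    have "indicat_real ?B y \<le> indicator (ball 0 (2 * \<delta>)) (y - x)"
    proof (cases "y \<in> ?B")
      case True
      then have "dist x y < 2 * \<delta>" using x dist_triangle2[of x y p] by (simp add: dist_commute)
      then have "y - x \<in> ball 0 (2 * \<delta>)" by (simp add: dist_norm norm_minus_commute)
      then show ?thesis by (simp add: indicator_def)
    qed simp
    then show "ennreal (indicator ?B y * (g x - g y)\<^sup>2) \<le> ennreal (indicator (ball 0 (2 * \<delta>)) (y - x) * (g y - g x)\<^sup>2)"
      by (intro ennreal_leI) (simp add: power2_commute mult_right_mono)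
  qed
  also have "\<dots> = (\<integral>\<^sup>+h. ennreal (indicator (ball 0 (2 * \<delta>)) h * (g (x + h) - g x)\<^sup>2) \<partial>lborel)"
  proof -
    have [measurable]: "ball (0::'a) (2 * \<delta>) \<in> sets borel" by simp
    have "(\<lambda>y. ennreal (indicator (ball 0 (2 * \<delta>)) (y - x) * (g y - g x)\<^sup>2)) \<in> borel_measurable borel"
      by measurable
    from nn_integral_lborel_translate[OF this, of x] show ?thesis by (simp add: add.commute)
  qed
  finally show ?thesis .
qed

lemma measure_ball_double:
  "0 \<le> \<delta> \<Longrightarrow> measure lborel (ball (0::'a::euclidean_space) (2 * \<delta>)) = 2 ^ DIM('a) * measure lborel (ball (p::'a) \<delta>)"
  using content_ball[of "2 * \<delta>" "0::'a"] content_ball[of \<delta> p] by (simp add: power_mult_distrib)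

text \<open>On each covering ball \<open>g\<close> splits into its mean, recorded by a functional,
  and its deviation. The mean square deviation is an average of translation differences, which
  Fubini and \<open>translation_estimate\<close> bound by the energy with a factor of order
  \<open>\<delta>\<^sup>2\<close>.\<close>

lemma interior_compactness:
  fixes \<Omega> K :: "'a::euclidean_space set"
  assumes \<Omega>: "open \<Omega>" and K: "compact K" "K \<subseteq> \<Omega>" and \<epsilon>: "\<epsilon> > 0"
  shows "\<exists>(N::nat) \<zeta>. (\<forall>i<N. \<zeta> i \<in> L2 (lebesgue_on \<Omega>)) \<and>
    (\<forall>u G. weak_gradient \<Omega> u G \<longrightarrow>
       ip (lebesgue_on K) u u \<le> \<epsilon> * ip (lebesgue_on \<Omega>) G G + (\<Sum>i<N. (ip (lebesgue_on \<Omega>) u (\<zeta> i))\<^sup>2))"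
proof -
  let ?d = "2 ^ DIM('a) :: real"
  have \<Omega>b: "\<Omega> \<in> sets borel" using \<Omega> by simp
  then have \<Omega>m: "\<Omega> \<in> sets lebesgue" by (simp add: sets_completionI_sets)
  have Kb: "K \<in> sets borel" using K by (simp add: compact_imp_closed)
  obtain \<eta> where \<eta>: "\<eta> > 0" "(\<Union>x\<in>K. ball x \<eta>) \<subseteq> \<Omega>"
    using compact_subset_open_imp_ball_epsilon_subset[OF K(1) \<Omega> K(2)] by blast
  \<comment> \<open>The first bound keeps the \<open>3 * \<delta>\<close> neighbourhood of
    \<open>K\<close> inside \<open>\<Omega>\<close>: up to \<open>\<delta>\<close> from
    \<open>K\<close> to \<open>A\<close> and less than \<open>2 * \<delta>\<close> for the
    displacement. The second makes the final energy coefficient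
    \<open>8 * 2 ^ DIM('a) * \<delta>\<^sup>2\<close> at most \<open>\<epsilon>\<close>.\<close>
  define \<delta> where "\<delta> = min (\<eta> / 4) (sqrt (\<epsilon> / (8 * ?d)))"
  have \<delta>: "\<delta> > 0" "3 * \<delta> < \<eta>" unfolding \<delta>_def using \<eta> \<epsilon> by auto
  have "\<delta>\<^sup>2 \<le> (sqrt (\<epsilon> / (8 * ?d)))\<^sup>2" using \<delta>(1) by (intro power_mono) (auto simp: \<delta>_def)
  then have \<delta>2: "8 * ?d * \<delta>\<^sup>2 \<le> \<epsilon>" using \<epsilon> by (simp add: field_simps)
  define A where "A = (\<Union>x\<in>K. ball x \<delta>)"
  have A: "open A" "K \<subseteq> A" unfolding A_def using \<delta> by auto
  have Ah: "x + s *\<^sub>R h \<in> \<Omega>" if xA: "x \<in> A" and "0 \<le> s" "s \<le> 1" "h \<in> ball 0 (2 * \<delta>)" for x s h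
  proof -
    obtain y where y: "y \<in> K" "dist y x < \<delta>" using xA unfolding A_def by auto
    have "norm (s *\<^sub>R h) \<le> norm h" using that by (simp add: mult_left_le_one_le)
    then have "dist x (x + s *\<^sub>R h) < 2 * \<delta>" using that by (simp add: dist_norm)
    then have "dist y (x + s *\<^sub>R h) < \<eta>" using y \<delta>(2) dist_triangle[of y "x + s *\<^sub>R h" x] by simp
    then have "x + s *\<^sub>R h \<in> ball y \<eta>" by simp
    then show ?thesis using y(1) \<eta>(2) by blast
  qed
  have "K \<subseteq> (\<Union>x\<in>K. ball x \<delta>)" using \<delta> by auto
  then obtain C where C: "C \<subseteq> K" "finite C" "K \<subseteq> (\<Union>x\<in>C. ball x \<delta>)"
    using compactE_image[OF K(1), of K "\<lambda>x. ball x \<delta>"] by auto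
  obtain N :: nat and p where p: "C = p ` {..<N}"
    using C(2) finite_imp_nat_seg_image_inj_on[of C] by (auto simp: lessThan_def)
  define V where "V = measure lborel (ball (0::'a) \<delta>)"
  have V: "measure lborel (ball q \<delta>) = V" for q :: 'a
    using \<delta> content_ball[of \<delta> q] content_ball[of \<delta> "0::'a"] by (simp add: V_def)
  have V0: "V > 0" unfolding V_def using content_ball_pos[OF \<delta>(1)] by simp
  \<comment> \<open>Normalised so that the squared product with \<open>g\<close> equals
    \<open>2 * (a i)\<^sup>2 * V\<close>, the mean term that remains after integrating over the
    ball.\<close>
  define \<zeta> where "\<zeta> i y = sqrt (2 / V) * indicat_real (ball (p i) \<delta>) y" for i y
  have \<zeta>L: "\<zeta> i \<in> L2 (lebesgue_on \<Omega>)" for i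
    unfolding \<zeta>_def[abs_def] by (rule L2_indicator_ball[OF \<Omega>m])
  have pB: "ball (p i) \<delta> \<subseteq> \<Omega>" if "i < N" for i
  proof -
    have "p i \<in> K" using that C(1) p by auto
    then show ?thesis using \<eta>(2) \<delta> by (force simp: subset_iff)
  qed
  have main: "ip (lebesgue_on K) u u \<le> \<epsilon> * ip (lebesgue_on \<Omega>) G G + (\<Sum>i<N. (ip (lebesgue_on \<Omega>) u (\<zeta> i))\<^sup>2)"
    if wg: "weak_gradient \<Omega> u G" for u G
  proof -
    let ?E = "ip (lebesgue_on \<Omega>) G G"
    note L = weak_gradient_L2[OF wg]
    have E0: "?E \<ge> 0" using L2.nonneg[OF L(2)] .
    obtain g where g: "g \<in> borel_measurable borel" "\<And>x. x \<notin> \<Omega> \<Longrightarrow> g x = 0"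
      "AE x in lebesgue_on \<Omega>. u x = g x" "integrable lborel (\<lambda>x. (g x)\<^sup>2)"
      by (rule L2_borel_representative[OF L(1) \<Omega>b]) (rule that)
    note [measurable] = g(1)
    have wgg: "weak_gradient \<Omega> g G"
      by (rule weak_gradient_cong_AE[OF wg borel_measurable_lebesgue_on[OF g(1)] g(3) \<Omega>m])
    have [measurable]: "K \<in> sets borel" "A \<in> sets borel" using Kb A by auto
    define a where "a i = (LINT y|lborel. indicator (ball (p i) \<delta>) y * g y) / V" for i
    define D where "D x = (\<integral>\<^sup>+h. ennreal (indicator (ball 0 (2 * \<delta>)) h * (g (x + h) - g x)\<^sup>2) \<partial>lborel)" for x
    have [measurable]: "ball (0::'a) (2 * \<delta>) \<in> sets borel" by simp
    have "(\<lambda>(x, h). ennreal (indicator (ball 0 (2 * \<delta>)) h * (g (x + h) - g x)\<^sup>2)) \<in> borel_measurable (lborel \<Otimes>\<^sub>M lborel)"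
      by measurable
    from lborel.borel_measurable_nn_integral_fst[OF this]
    have [measurable]: "D \<in> borel_measurable borel" unfolding D_def by simp
    have "(\<integral>\<^sup>+x. indicator K x * D x \<partial>lborel)
       = (\<integral>\<^sup>+x. (\<integral>\<^sup>+h. ennreal (indicator K x * (indicator (ball 0 (2 * \<delta>)) h * (g (x + h) - g x)\<^sup>2)) \<partial>lborel) \<partial>lborel)"
      unfolding D_def
      by (intro nn_integral_cong) (auto simp: indicator_def)
    \<comment> \<open>Exchanging the order makes the displacement \<open>h\<close> the outer
      variable, so that the translation estimate can be used for each fixed
      \<open>h\<close>.\<close>
    also have "\<dots> = (\<integral>\<^sup>+h. (\<integral>\<^sup>+x. ennreal (indicator K x * (indicator (ball 0 (2 * \<delta>)) h * (g (x + h) - g x)\<^sup>2)) \<partial>lborel) \<partial>lborel)"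
      by (rule lborel_pair.Fubini') measurable
    also have "\<dots> \<le> (\<integral>\<^sup>+h. ennreal ((4 * \<delta>\<^sup>2 * ?E) * indicator (ball 0 (2 * \<delta>)) (h::'a)) \<partial>lborel)"
    proof (rule nn_integral_mono)
      fix h :: 'a
      show "(\<integral>\<^sup>+x. ennreal (indicator K x * (indicator (ball 0 (2 * \<delta>)) h * (g (x + h) - g x)\<^sup>2)) \<partial>lborel)
         \<le> ennreal ((4 * \<delta>\<^sup>2 * ?E) * indicator (ball 0 (2 * \<delta>)) h)"
      proof (cases "h \<in> ball 0 (2 * \<delta>)")
        case True
        have gL: "g \<in> L2 lborel" "(\<lambda>x. g (x + h)) \<in> L2 lborel"
          using g lborel_integrable_translate[OF g(4)] by (simp_all add: L2_def)
        have "integrable lborel (\<lambda>x. (g (x + h) - g x)\<^sup>2)"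
          using L2_integrable_square[OF L2_diff[OF gL(2,1)]] by simp
        then have int: "integrable lborel (\<lambda>x. indicator A x * (g (x + h) - g x)\<^sup>2)"
          using integrable_mult_indicator[of A lborel "\<lambda>x. (g (x + h) - g x)\<^sup>2"] by simp
        have "(\<integral>\<^sup>+x. ennreal (indicator K x * (indicator (ball 0 (2 * \<delta>)) h * (g (x + h) - g x)\<^sup>2)) \<partial>lborel)
          \<le> (\<integral>\<^sup>+x. ennreal (indicator A x * (g (x + h) - g x)\<^sup>2) \<partial>lborel)"
          using True A(2) by (intro nn_integral_mono ennreal_leI) (auto simp: indicator_def)
        also have "\<dots> = ennreal (LINT x|lborel. indicator A x * (g (x + h) - g x)\<^sup>2)"
          by (rule nn_integral_eq_integral[OF int]) simp
        also have "\<dots> \<le> ennreal ((norm h)\<^sup>2 * ?E)"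
          by (rule ennreal_leI, rule translation_estimate[OF \<Omega> wgg g(1,2,4) A(1)]) (use Ah True in auto)
        also have "\<dots> \<le> ennreal ((2 * \<delta>)\<^sup>2 * ?E)"
          using True E0 by (intro ennreal_leI mult_right_mono power_mono) auto
        finally show ?thesis using True by (simp add: power_mult_distrib)
      qed simp
    qed
    also have "\<dots> = ennreal ((4 * \<delta>\<^sup>2 * ?E) * (?d * V))"
    proof -
      have "(\<integral>\<^sup>+h. ennreal ((4 * \<delta>\<^sup>2 * ?E) * indicator (ball 0 (2 * \<delta>)) (h::'a)) \<partial>lborel)
        = ennreal (LINT h|lborel. (4 * \<delta>\<^sup>2 * ?E) * indicator (ball 0 (2 * \<delta>)) (h::'a))"
        using integrable_indicator_ball[of "0::'a" "2 * \<delta>"] E0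
        by (intro nn_integral_eq_integral integrable_mult_right AE_I2) auto
      also have "(LINT h|lborel. (4 * \<delta>\<^sup>2 * ?E) * indicator (ball 0 (2 * \<delta>)) (h::'a)) = (4 * \<delta>\<^sup>2 * ?E) * (?d * V)"
        using measure_ball_double[of \<delta> "0::'a"] \<delta> by (simp add: V_def)
      finally show ?thesis .
    qed
    finally have Dint: "(\<integral>\<^sup>+x. indicator K x * D x \<partial>lborel) \<le> ennreal ((4 * \<delta>\<^sup>2 * ?E) * (?d * V))" .
    have intS: "integrable lborel (\<lambda>x. \<Sum>i<N. 2 * (a i)\<^sup>2 * indicat_real (ball (p i) \<delta>) x)"
      by (intro Bochner_Integration.integrable_sum integrable_mult_right integrable_indicator_ball)
    have "(LINT x|lborel. (\<Sum>i<N. 2 * (a i)\<^sup>2 * indicat_real (ball (p i) \<delta>) x))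
       = (\<Sum>i<N. (LINT x|lborel. 2 * (a i)\<^sup>2 * indicat_real (ball (p i) \<delta>) x))"
      by (intro Bochner_Integration.integral_sum integrable_mult_right integrable_indicator_ball)
    then have S: "(LINT x|lborel. (\<Sum>i<N. 2 * (a i)\<^sup>2 * indicat_real (ball (p i) \<delta>) x)) = (\<Sum>i<N. 2 * (a i)\<^sup>2 * V)"
      by (simp add: V)
    have pw: "ennreal (indicator K x * (g x)\<^sup>2) \<le> ennreal (2 / V) * (indicator K x * D x) +
       ennreal (\<Sum>i<N. 2 * (a i)\<^sup>2 * indicat_real (ball (p i) \<delta>) x)" for x
    proof (cases "x \<in> K")
      case True
      then obtain i where i: "i < N" "x \<in> ball (p i) \<delta>" using C(3) p by blast
      \<comment> \<open>The square of a sum is at most twice the sum of the squares; the factor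
        \<open>V\<close> is inserted to match the bound on deviations from the ball mean.\<close>
      have "(g x)\<^sup>2 \<le> 2 / V * (V * (g x - a i)\<^sup>2) + 2 * (a i)\<^sup>2"
      proof -
        have "0 \<le> ((g x - a i) - a i)\<^sup>2" by simp
        then show ?thesis using V0 by (simp add: power2_eq_square algebra_simps)
      qed
      also have "2 * (a i)\<^sup>2 \<le> (\<Sum>j<N. 2 * (a j)\<^sup>2 * indicat_real (ball (p j) \<delta>) x)"
        using member_le_sum[of i "{..<N}" "\<lambda>j. 2 * (a j)\<^sup>2 * indicat_real (ball (p j) \<delta>) x"] i by simp
      finally have "ennreal ((g x)\<^sup>2) \<le> ennreal (2 / V * (V * (g x - a i)\<^sup>2) + (\<Sum>j<N. 2 * (a j)\<^sup>2 * indicat_real (ball (p j) \<delta>) x))"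
        by (intro ennreal_leI) simp
      also have "\<dots> = ennreal (2 / V) * ennreal (V * (g x - a i)\<^sup>2) + ennreal (\<Sum>j<N. 2 * (a j)\<^sup>2 * indicat_real (ball (p j) \<delta>) x)"
        using V0 by (subst ennreal_plus) (auto intro!: sum_nonneg simp del: times_divide_eq_left simp: ennreal_mult)
      also have "ennreal (V * (g x - a i)\<^sup>2) \<le> D x"
        unfolding D_def by (rule deviation_from_ball_mean[OF g(1,4) i(2)]) (auto simp: V V0 a_def)
      finally show ?thesis using True by (simp add: add_mono mult_left_mono)
    qed simp
    have mKD: "(\<lambda>x. indicator K x * D x) \<in> borel_measurable lborel"
      and mD: "(\<lambda>x. ennreal (2 / V) * (indicator K x * D x)) \<in> borel_measurable lborel"
      by measurable
    have mS: "(\<lambda>x. ennreal (\<Sum>i<N. 2 * (a i)\<^sup>2 * indicat_real (ball (p i) \<delta>) x)) \<in> borel_measurable lborel"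
      by (rule measurable_compose[OF borel_measurable_integrable[OF intS] measurable_ennreal])
    have intK: "integrable lborel (\<lambda>x. indicator K x * (g x)\<^sup>2)"
      using integrable_mult_indicator[of K lborel "\<lambda>y. (g y)\<^sup>2"] g(4) by simp
    have "ennreal (LINT x|lborel. indicator K x * (g x)\<^sup>2) = (\<integral>\<^sup>+x. ennreal (indicator K x * (g x)\<^sup>2) \<partial>lborel)"
      by (rule nn_integral_eq_integral[symmetric, OF intK]) simp
    also have "\<dots> \<le> (\<integral>\<^sup>+x. ennreal (2 / V) * (indicator K x * D x) +
       ennreal (\<Sum>i<N. 2 * (a i)\<^sup>2 * indicat_real (ball (p i) \<delta>) x) \<partial>lborel)"
      by (rule nn_integral_mono) (rule pw)
    also have "\<dots> = ennreal (2 / V) * (\<integral>\<^sup>+x. indicator K x * D x \<partial>lborel) +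
       (\<integral>\<^sup>+x. ennreal (\<Sum>i<N. 2 * (a i)\<^sup>2 * indicat_real (ball (p i) \<delta>) x) \<partial>lborel)"
      unfolding nn_integral_add[OF mD mS] nn_integral_cmult[OF mKD] ..
    also have "(\<integral>\<^sup>+x. ennreal (\<Sum>i<N. 2 * (a i)\<^sup>2 * indicat_real (ball (p i) \<delta>) x) \<partial>lborel) = ennreal (\<Sum>i<N. 2 * (a i)\<^sup>2 * V)"
      unfolding S[symmetric] by (rule nn_integral_eq_integral[OF intS]) (auto intro!: sum_nonneg)
    also have "ennreal (2 / V) * (\<integral>\<^sup>+x. indicator K x * D x \<partial>lborel) \<le> ennreal (2 / V) * ennreal ((4 * \<delta>\<^sup>2 * ?E) * (?d * V))"
      by (rule mult_left_mono[OF Dint]) simp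
    also have "ennreal (2 / V) * ennreal ((4 * \<delta>\<^sup>2 * ?E) * (?d * V)) = ennreal (8 * ?d * \<delta>\<^sup>2 * ?E)"
      using V0 E0 by (subst ennreal_mult[symmetric]) (auto simp: field_simps)
    also have "ennreal (8 * ?d * \<delta>\<^sup>2 * ?E) + ennreal (\<Sum>i<N. 2 * (a i)\<^sup>2 * V) = ennreal (8 * ?d * \<delta>\<^sup>2 * ?E + (\<Sum>i<N. 2 * (a i)\<^sup>2 * V))"
      using V0 E0 by (intro ennreal_plus[symmetric]) (auto intro!: sum_nonneg)
    finally have "ennreal (LINT x|lborel. indicator K x * (g x)\<^sup>2) \<le> ennreal (8 * ?d * \<delta>\<^sup>2 * ?E + (\<Sum>i<N. 2 * (a i)\<^sup>2 * V))"
      by (auto intro: add_right_mono)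
    then have "(LINT x|lborel. indicator K x * (g x)\<^sup>2) \<le> 8 * ?d * \<delta>\<^sup>2 * ?E + (\<Sum>i<N. 2 * (a i)\<^sup>2 * V)"
      using V0 E0 by (subst (asm) ennreal_le_iff) (auto intro!: sum_nonneg add_nonneg_nonneg)
    also have "8 * ?d * \<delta>\<^sup>2 * ?E \<le> \<epsilon> * ?E" using \<delta>2 E0 by (rule mult_right_mono)
    also have "(\<Sum>i<N. 2 * (a i)\<^sup>2 * V) = (\<Sum>i<N. (ip (lebesgue_on \<Omega>) u (\<zeta> i))\<^sup>2)"
    proof (rule sum.cong)
      fix i assume "i \<in> {..<N}"
      then have i: "i < N" by simp
      have "ip (lebesgue_on \<Omega>) u (\<zeta> i) = ip (lebesgue_on \<Omega>) g (\<zeta> i)"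
        by (rule ip_cong_AE[OF L2_measurable[OF L(1)] borel_measurable_lebesgue_on[OF g(1)]
            L2_measurable[OF \<zeta>L] L2_measurable[OF \<zeta>L] g(3)]) simp
      also have "\<dots> = (LINT x|lborel. indicator \<Omega> x * (g x * \<zeta> i x))"
      proof (rule ip_lborel[OF g(1) _ \<Omega>b])
        have [measurable]: "ball (p i) \<delta> \<in> sets borel" by simp
        show "\<zeta> i \<in> borel_measurable borel" unfolding \<zeta>_def[abs_def] by measurable
      qed
      also have "(\<lambda>x. indicator \<Omega> x * (g x * \<zeta> i x)) = (\<lambda>x. sqrt (2 / V) * (indicator (ball (p i) \<delta>) x * g x))"
        using pB[OF i] by (auto simp: \<zeta>_def indicator_def fun_eq_iff)
      also have "(LINT x|lborel. sqrt (2 / V) * (indicator (ball (p i) \<delta>) x * g x)) = sqrt (2 / V) * (V * a i)"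
        using V0 by (simp add: a_def)
      finally show "2 * (a i)\<^sup>2 * V = (ip (lebesgue_on \<Omega>) u (\<zeta> i))\<^sup>2"
        using V0 by (simp add: power_mult_distrib power2_eq_square field_simps)
    qed simp
    also have "(LINT x|lborel. indicator K x * (g x)\<^sup>2) = ip (lebesgue_on K) g g"
      by (simp add: ip_lborel[OF g(1) g(1) Kb] power2_eq_square)
    also have "ip (lebesgue_on K) g g = ip (lebesgue_on K) u u"
    proof -
      have "AE x in lebesgue_on K. u x = g x"
        using g(3) K(2) \<Omega>m Kb by (auto simp: AE_restrict_space_iff sets_completionI_sets)
      moreover have "u \<in> borel_measurable (lebesgue_on K)"
        by (rule measurable_restrict_mono[OF L2_measurable[OF L(1)] K(2)])
      ultimately show ?thesis
        using borel_measurable_lebesgue_on[OF g(1)] by (intro ip_cong_AE) (auto elim: eventually_mono)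
    qed
    finally show ?thesis by simp
  qed
  show ?thesis using \<zeta>L main by blast
qed

text \<open>Near the boundary, a small displacement in the direction \<open>e\<close> of the epigraph moves the
  domain into a compact subset of itself.\<close>

lemma lipschitz_boundary_shift:
  fixes \<Omega> :: "'a::euclidean_space set"
  assumes "lipschitz_boundary \<Omega>" "p \<in> frontier \<Omega>"
  shows "\<exists>r e. r > 0 \<and> norm e = 1 \<and> (\<forall>h. 0 < h \<longrightarrow> h < r \<longrightarrow>
     (\<forall>x\<in>\<Omega> \<inter> ball p r. \<forall>s. 0 \<le> s \<longrightarrow> s \<le> 1 \<longrightarrow> x + s *\<^sub>R (h *\<^sub>R e) \<in> \<Omega>) \<and>
     (\<lambda>x. x + h *\<^sub>R e) ` closure (\<Omega> \<inter> ball p r) \<subseteq> \<Omega>)"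
proof -
  obtain r e L g where r: "r > 0" and e: "norm e = 1" and lip: "L-lipschitz_on {y. y \<bullet> e = 0} g"
    and epi: "\<And>x. x \<in> ball p r \<Longrightarrow> x \<in> \<Omega> \<longleftrightarrow> g (x - (x \<bullet> e) *\<^sub>R e) < x \<bullet> e"
    using assms unfolding lipschitz_boundary_def by metis
  have ee: "e \<bullet> e = 1" using e by (simp add: norm_eq_1)
  define Q where "Q x = x - (x \<bullet> e) *\<^sub>R e" for x
  note epi = epi[folded Q_def]
  have P: "Q (x + t *\<^sub>R e) = Q x" "(x + t *\<^sub>R e) \<bullet> e = x \<bullet> e + t" for x t
    using ee by (auto simp: Q_def inner_add_left algebra_simps)
  have Pm: "Q x \<in> {y. y \<bullet> e = 0}" for x using ee by (simp add: Q_def inner_diff_left)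
  have contP: "continuous_on UNIV (\<lambda>x. g (Q x))"
    by (rule continuous_on_compose2[OF lipschitz_on_continuous_on[OF lip]])
      (use Pm in \<open>auto simp: Q_def intro!: continuous_intros\<close>)
  \<comment> \<open>The radius is halved so that displaced points remain in the ball where the
    epigraph description holds.\<close>
  have inball: "x + t *\<^sub>R e \<in> ball p r" if "x \<in> cball p (r/2)" "0 \<le> t" "t < r/2" for x t
  proof -
    have "dist x (x + t *\<^sub>R e) = t" using that e by (simp add: dist_norm)
    then show ?thesis using that dist_triangle[of p "x + t *\<^sub>R e" x] by simp
  qed
  show ?thesis
  proof (intro exI[of _ "r/2"] exI[of _ e] conjI allI impI ballI)
    fix h x s :: real and y assume h: "0 < h" "h < r / 2"
    assume y: "y \<in> \<Omega> \<inter> ball p (r / 2)" and s: "0 \<le> s" "s \<le> 1"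
    have "s * h \<le> h" using h s by (intro mult_left_le_one_le) auto
    then have "s * h < r / 2" using h by linarith
    moreover have "0 \<le> s * h" using h s by simp
    ultimately have sh: "0 \<le> s * h" "s * h < r / 2" by blast+
    have "y \<in> ball p r" using y r by auto
    then have "g (Q y) < y \<bullet> e" using epi y by auto
    then have "g (Q (y + (s * h) *\<^sub>R e)) < (y + (s * h) *\<^sub>R e) \<bullet> e" unfolding P using sh by simp
    moreover have "y + (s * h) *\<^sub>R e \<in> ball p r" using inball[of y "s * h"] y sh by auto
    ultimately show "y + s *\<^sub>R h *\<^sub>R e \<in> \<Omega>" using epi by simp
  next
    fix h assume h: "0 < h" "h < r / 2"
    show "(\<lambda>x. x + h *\<^sub>R e) ` closure (\<Omega> \<inter> ball p (r / 2)) \<subseteq> \<Omega>"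
    proof clarify
      fix x assume x: "x \<in> closure (\<Omega> \<inter> ball p (r / 2))"
      have "closure (\<Omega> \<inter> ball p (r / 2)) \<subseteq> cball p (r / 2) \<inter> {x. g (Q x) \<le> x \<bullet> e}"
      proof (rule closure_minimal)
        show "\<Omega> \<inter> ball p (r / 2) \<subseteq> cball p (r / 2) \<inter> {x. g (Q x) \<le> x \<bullet> e}"
        proof
          fix y assume y: "y \<in> \<Omega> \<inter> ball p (r / 2)"
          then have "y \<in> ball p r" using r by auto
          then have "g (Q y) < y \<bullet> e" using epi y by auto
          then show "y \<in> cball p (r / 2) \<inter> {x. g (Q x) \<le> x \<bullet> e}" using y by auto
        qed
        show "closed (cball p (r / 2) \<inter> {x. g (Q x) \<le> x \<bullet> e})"
          by (intro closed_Int closed_cball closed_Collect_le contP continuous_intros)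
      qed
      then have x': "x \<in> cball p (r / 2)" "g (Q x) \<le> x \<bullet> e" using x by auto
      then have "g (Q (x + h *\<^sub>R e)) < (x + h *\<^sub>R e) \<bullet> e" unfolding P using h by simp
      then show "x + h *\<^sub>R e \<in> \<Omega>" using epi inball[OF x'(1)] h by auto
    qed
  qed (use r e in auto)
qed

text \<open>On a piece near the boundary, the mass of \<open>u\<close> is bounded by a translation
  difference, small in energy, plus the mass of the shifted piece, which lies in a compact subset of
  \<open>\<Omega>\<close>. There the interior estimate applies.\<close>

lemma neumann_compactness:
  fixes \<Omega> :: "'a::euclidean_space set"
  assumes \<Omega>: "open \<Omega>" "bounded \<Omega>" and lip: "lipschitz_boundary \<Omega>" and \<epsilon>: "\<epsilon> > 0"
  shows "\<exists>(N::nat) \<zeta>. (\<forall>i<N. \<zeta> i \<in> L2 (lebesgue_on \<Omega>)) \<and>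
    (\<forall>u G. weak_gradient \<Omega> u G \<longrightarrow>
       ip (lebesgue_on \<Omega>) u u \<le> \<epsilon> * ip (lebesgue_on \<Omega>) G G + (\<Sum>i<N. (ip (lebesgue_on \<Omega>) u (\<zeta> i))\<^sup>2))"
proof -
  have \<Omega>b: "\<Omega> \<in> sets borel" using \<Omega> by simp
  then have \<Omega>m: "\<Omega> \<in> sets lebesgue" by (simp add: sets_completionI_sets)
  define Q where "Q p r e \<longleftrightarrow> r > 0 \<and> norm e = 1 \<and> (\<forall>h. 0 < h \<longrightarrow> h < r \<longrightarrow>
     (\<forall>x\<in>\<Omega> \<inter> ball p r. \<forall>s. 0 \<le> s \<longrightarrow> s \<le> 1 \<longrightarrow> x + s *\<^sub>R (h *\<^sub>R e) \<in> \<Omega>) \<and>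
     (\<lambda>x. x + h *\<^sub>R e) ` closure (\<Omega> \<inter> ball p r) \<subseteq> \<Omega>)" for p r and e :: 'a
  have "\<forall>p\<in>frontier \<Omega>. \<exists>r e. Q p r e" unfolding Q_def using lipschitz_boundary_shift[OF lip] by blast
  then obtain r e where Q: "\<And>p. p \<in> frontier \<Omega> \<Longrightarrow> Q p (r p) (e p)" by metis
  have r0: "r p > 0" if "p \<in> frontier \<Omega>" for p using Q[OF that] by (simp add: Q_def)
  have "compact (frontier \<Omega>)" using \<Omega> by (simp add: compact_frontier_bounded)
  moreover have "frontier \<Omega> \<subseteq> (\<Union>p\<in>frontier \<Omega>. ball p (r p))" using r0 by force
  ultimately obtain P where P: "P \<subseteq> frontier \<Omega>" "finite P" "frontier \<Omega> \<subseteq> (\<Union>p\<in>P. ball p (r p))"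
    using compactE_image[of "frontier \<Omega>" "frontier \<Omega>" "\<lambda>p. ball p (r p)"] by auto
  define M where "M = real (card P)"
  \<comment> \<open>One displacement for all boundary pieces: below every radius of validity, and so
    small that the \<open>M\<close> translation terms contribute at most
    \<open>\<epsilon> / 2\<close> of the energy. The \<open>M + 1\<close> avoids a division by
    zero.\<close>
  define h where "h = Min (insert (sqrt (\<epsilon> / (4 * (M + 1)))) ((\<lambda>p. r p / 2) ` P))"
  have M0: "M \<ge> 0" by (simp add: M_def)
  have h0: "h > 0" unfolding h_def using P r0 \<epsilon> M0 by (subst Min_gr_iff) (auto simp: add_nonneg_pos)
  have hr: "h < r p" if "p \<in> P" for p
  proof -
    have "h \<le> r p / 2" unfolding h_def using P that by (intro Min_le) auto
    then show ?thesis using r0[of p] P that by auto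
  qed
  have "h \<le> sqrt (\<epsilon> / (4 * (M + 1)))" unfolding h_def using P by (intro Min_le) auto
  then have "h\<^sup>2 \<le> (sqrt (\<epsilon> / (4 * (M + 1))))\<^sup>2" using h0 by (intro power_mono) auto
  then have "h\<^sup>2 \<le> \<epsilon> / (4 * (M + 1))" using \<epsilon> M0 by simp
  then have "4 * (M + 1) * h\<^sup>2 \<le> \<epsilon>" using M0 by (simp add: field_simps)
  then have h2: "2 * M * h\<^sup>2 \<le> \<epsilon> / 2" 
  proof -
    have "4 * (M + 1) * h\<^sup>2 = 4 * h\<^sup>2 + 2 * (2 * M * h\<^sup>2)" by (simp add: algebra_simps)
    then show ?thesis using \<open>4 * (M + 1) * h\<^sup>2 \<le> \<epsilon>\<close> zero_le_power2[of h] by linarith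
  qed
  define A where "A p = \<Omega> \<inter> ball p (r p)" for p
  define K0 where "K0 = closure \<Omega> - (\<Union>p\<in>P. ball p (r p))"
  \<comment> \<open>What the boundary balls leave over, together with the displaced boundary pieces:
    compact and inside \<open>\<Omega>\<close>.\<close>
  define K where "K = K0 \<union> (\<Union>p\<in>P. (\<lambda>x. x + h *\<^sub>R e p) ` closure (A p))"
  have "compact K0"
    unfolding K0_def using \<Omega> by (intro compact_diff) auto
  moreover have "compact ((\<lambda>x. x + h *\<^sub>R e p) ` closure (A p))" for p
    using \<Omega>(2) by (intro compact_continuous_image continuous_intros)
      (auto simp: A_def compact_closure intro: bounded_subset)
  ultimately have Kc: "compact K" unfolding K_def using P by (intro compact_Un compact_UN) auto
  have K0\<Omega>: "K0 \<subseteq> \<Omega>" unfolding K0_def using P(3) \<Omega>(1) by (auto simp: frontier_def interior_open)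
  have K\<Omega>: "K \<subseteq> \<Omega>"
  proof -
    have "(\<lambda>x. x + h *\<^sub>R e p) ` closure (A p) \<subseteq> \<Omega>" if "p \<in> P" for p
      using Q[of p] P(1) that h0 hr[OF that] unfolding Q_def A_def by blast
    then show ?thesis unfolding K_def using K0\<Omega> by blast
  qed
  \<comment> \<open>The mass on \<open>K\<close> is counted once for \<open>K0\<close> and twice for
    each of the \<open>M\<close> pieces, so the interior estimate is applied with the remaining
    \<open>\<epsilon> / 2\<close> divided by \<open>1 + 2 * M\<close>. The same factor is put into
    \<open>\<zeta>'\<close> as a square root.\<close>
  define \<epsilon>' where "\<epsilon>' = \<epsilon> / (2 * (1 + 2 * M))"
  have \<epsilon>': "\<epsilon>' > 0" "(1 + 2 * M) * \<epsilon>' = \<epsilon> / 2" unfolding \<epsilon>'_def using \<epsilon> M0 by (auto simp: field_simps)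
  obtain N :: nat and \<zeta> where \<zeta>: "\<And>i. i < N \<Longrightarrow> \<zeta> i \<in> L2 (lebesgue_on \<Omega>)"
    and int: "\<And>u G. weak_gradient \<Omega> u G \<Longrightarrow>
       ip (lebesgue_on K) u u \<le> \<epsilon>' * ip (lebesgue_on \<Omega>) G G + (\<Sum>i<N. (ip (lebesgue_on \<Omega>) u (\<zeta> i))\<^sup>2)"
    using interior_compactness[OF \<Omega>(1) Kc K\<Omega> \<epsilon>'(1)] by blast
  define \<zeta>' where "\<zeta>' i = sqrt (1 + 2 * M) *\<^sub>R \<zeta> i" for i
  have \<zeta>': "\<zeta>' i \<in> L2 (lebesgue_on \<Omega>)" if "i < N" for i
    unfolding \<zeta>'_def using subspace_scale[OF subspace_L2 \<zeta>[OF that]] .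
  have main: "ip (lebesgue_on \<Omega>) u u \<le> \<epsilon> * ip (lebesgue_on \<Omega>) G G + (\<Sum>i<N. (ip (lebesgue_on \<Omega>) u (\<zeta>' i))\<^sup>2)"
    if wg: "weak_gradient \<Omega> u G" for u G
  proof -
    let ?E = "ip (lebesgue_on \<Omega>) G G"
    note L = weak_gradient_L2[OF wg]
    have E0: "?E \<ge> 0" using L2.nonneg[OF L(2)] .
    obtain g where g: "g \<in> borel_measurable borel" "\<And>x. x \<notin> \<Omega> \<Longrightarrow> g x = 0"
      "AE x in lebesgue_on \<Omega>. u x = g x" "integrable lborel (\<lambda>x. (g x)\<^sup>2)"
      by (rule L2_borel_representative[OF L(1) \<Omega>b]) (rule that)
    note [measurable] = g(1)
    have wgg: "weak_gradient \<Omega> g G"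
      by (rule weak_gradient_cong_AE[OF wg borel_measurable_lebesgue_on[OF g(1)] g(3) \<Omega>m])
    have Kb: "K \<in> sets borel" "K0 \<in> sets borel" using Kc \<open>compact K0\<close> by (auto simp: compact_imp_closed)
    have Ao: "open (A p)" for p unfolding A_def using \<Omega> by auto
    have Ab: "A p \<in> sets borel" for p using Ao by simp
    have intS: "integrable lborel (\<lambda>x. indicator S x * (g x)\<^sup>2)" if "S \<in> sets borel" for S
      using integrable_mult_indicator[of S lborel "\<lambda>y. (g y)\<^sup>2"] g(4) that by simp
    define J where "J S = (LINT x|lborel. indicator S x * (g x)\<^sup>2)" for S
    have J_mono: "J S \<le> J T" if "S \<subseteq> T" "S \<in> sets borel" "T \<in> sets borel" for S T
      unfolding J_def using that by (intro integral_mono intS) (auto simp: indicator_def)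
    \<comment> \<open>Compare \<open>g\<close> with its translate: twice the squared difference is
      bounded by the energy, and the translate sees only values of \<open>g\<close> on
      \<open>K\<close>.\<close>
    have JA: "J (A p) \<le> 2 * h\<^sup>2 * ?E + 2 * J K" if p: "p \<in> P" for p
    proof -
      let ?h = "h *\<^sub>R e p"
      have e1: "norm (e p) = 1" using Q[of p] P(1) p by (auto simp: Q_def)
      have gh: "integrable lborel (\<lambda>x. (g (x + ?h))\<^sup>2)" using lborel_integrable_translate[OF g(4)] .
      have gL: "g \<in> L2 lborel" "(\<lambda>x. g (x + ?h)) \<in> L2 lborel" using g gh by (simp_all add: L2_def)
      have i1: "integrable lborel (\<lambda>x. indicator (A p) x * (g (x + ?h) - g x)\<^sup>2)"
        using integrable_mult_indicator[of "A p" lborel "\<lambda>x. (g (x + ?h) - g x)\<^sup>2"]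
          L2_integrable_square[OF L2_diff[OF gL(2,1)]] Ab by simp
      have i2: "integrable lborel (\<lambda>x. indicator (A p) x * (g (x + ?h))\<^sup>2)"
        using integrable_mult_indicator[of "A p" lborel "\<lambda>x. (g (x + ?h))\<^sup>2"] gh Ab by simp
      have "J (A p) \<le> (LINT x|lborel. 2 * (indicator (A p) x * (g (x + ?h) - g x)\<^sup>2) + 2 * (indicator (A p) x * (g (x + ?h))\<^sup>2))"
        unfolding J_def
      proof (intro integral_mono intS Ab Bochner_Integration.integrable_add integrable_mult_right i1 i2)
        fix x
        have "0 \<le> ((g (x + ?h) - g x) + g (x + ?h))\<^sup>2" by simp
        then have "(g x)\<^sup>2 \<le> 2 * (g (x + ?h) - g x)\<^sup>2 + 2 * (g (x + ?h))\<^sup>2"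
          by (simp add: power2_eq_square algebra_simps)
        then show "indicator (A p) x * (g x)\<^sup>2 \<le> 2 * (indicator (A p) x * (g (x + ?h) - g x)\<^sup>2) + 2 * (indicator (A p) x * (g (x + ?h))\<^sup>2)"
          by (auto simp: indicator_def)
      qed
      also have "\<dots> = 2 * (LINT x|lborel. indicator (A p) x * (g (x + ?h) - g x)\<^sup>2) + 2 * (LINT x|lborel. indicator (A p) x * (g (x + ?h))\<^sup>2)"
        using i1 i2 by simp
      also have "(LINT x|lborel. indicator (A p) x * (g (x + ?h) - g x)\<^sup>2) \<le> (norm ?h)\<^sup>2 * ?E"
      proof (rule translation_estimate[OF \<Omega>(1) wgg g(1,2,4) Ao])
        show "x + s *\<^sub>R ?h \<in> \<Omega>" if "x \<in> A p" "0 \<le> s" "s \<le> 1" for x s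
          using Q[of p] P(1) p that h0 hr[OF p] unfolding Q_def A_def by blast
      qed
      also have "(norm ?h)\<^sup>2 * ?E = h\<^sup>2 * ?E" using e1 by (simp add: power_mult_distrib)
      also have "(LINT x|lborel. indicator (A p) x * (g (x + ?h))\<^sup>2) \<le> (LINT x|lborel. indicator K (x + ?h) * (g (x + ?h))\<^sup>2)"
      proof (rule integral_mono[OF i2])
        show "integrable lborel (\<lambda>x. indicator K (x + ?h) * (g (x + ?h))\<^sup>2)"
          using lborel_integrable_translate[OF intS[OF Kb(1)]] .
        fix x
        have "x + ?h \<in> K" if "x \<in> A p" using that p closure_subset[of "A p"] unfolding K_def by blast
        then show "indicator (A p) x * (g (x + ?h))\<^sup>2 \<le> indicator K (x + ?h) * (g (x + ?h))\<^sup>2"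
          by (auto simp: indicator_def)
      qed
      also have "\<dots> = J K"
      proof -
        have [measurable]: "K \<in> sets borel" by (rule Kb)
        have "(\<lambda>x. indicator K x * (g x)\<^sup>2) \<in> borel_measurable borel" by measurable
        then show ?thesis unfolding J_def by (rule lborel_integral_translate)
      qed
      finally show ?thesis by simp
    qed
    have "ip (lebesgue_on \<Omega>) u u = ip (lebesgue_on \<Omega>) g g"
      by (rule ip_cong_AE[OF L2_measurable[OF L(1)] borel_measurable_lebesgue_on[OF g(1)]
          L2_measurable[OF L(1)] borel_measurable_lebesgue_on[OF g(1)] g(3) g(3)])
    also have "\<dots> = J \<Omega>" by (simp add: J_def ip_lborel[OF g(1) g(1) \<Omega>b] power2_eq_square)
    also have "J \<Omega> \<le> (LINT x|lborel. indicator K0 x * (g x)\<^sup>2 + (\<Sum>p\<in>P. indicator (A p) x * (g x)\<^sup>2))"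
      unfolding J_def
    proof (intro integral_mono intS Bochner_Integration.integrable_add Bochner_Integration.integrable_sum \<Omega>b Kb Ab)
      fix x
      show "indicator \<Omega> x * (g x)\<^sup>2 \<le> indicator K0 x * (g x)\<^sup>2 + (\<Sum>p\<in>P. indicator (A p) x * (g x)\<^sup>2)"
      proof (cases "x \<in> \<Omega> \<and> x \<notin> K0")
        case True
        then obtain p where p: "p \<in> P" "x \<in> A p"
          using closure_subset[of \<Omega>] unfolding K0_def A_def by blast
        have "(g x)\<^sup>2 = indicator (A p) x * (g x)\<^sup>2" using p by simp
        also have "\<dots> \<le> (\<Sum>p\<in>P. indicator (A p) x * (g x)\<^sup>2)"
          by (rule member_le_sum) (use p P in auto)
        finally show ?thesis using True by simp
      next
        case False
        then show ?thesis using K0\<Omega> by (auto simp: indicator_def intro!: sum_nonneg add_nonneg_nonneg)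
      qed
    qed
    also have "\<dots> = J K0 + (\<Sum>p\<in>P. J (A p))"
      unfolding J_def using intS Kb Ab by simp
    also have "\<dots> \<le> J K + (\<Sum>p\<in>P. 2 * h\<^sup>2 * ?E + 2 * J K)"
      using JA Kb by (intro add_mono sum_mono J_mono) (auto simp: K_def)
    also have "\<dots> = (2 * M * h\<^sup>2) * ?E + (1 + 2 * M) * J K"
      by (simp add: M_def algebra_simps)
    also have "\<dots> \<le> \<epsilon> / 2 * ?E + (1 + 2 * M) * J K"
      using h2 E0 by (intro add_right_mono mult_right_mono)
    also have "J K = ip (lebesgue_on K) g g" by (simp add: J_def ip_lborel[OF g(1) g(1) Kb(1)] power2_eq_square)
    also have "ip (lebesgue_on K) g g \<le> \<epsilon>' * ?E + (\<Sum>i<N. (ip (lebesgue_on \<Omega>) g (\<zeta> i))\<^sup>2)"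
      by (rule int[OF wgg])
    also have "(\<Sum>i<N. (ip (lebesgue_on \<Omega>) g (\<zeta> i))\<^sup>2) = (\<Sum>i<N. (ip (lebesgue_on \<Omega>) u (\<zeta> i))\<^sup>2)"
    proof (rule sum.cong[OF refl])
      fix i assume i: "i \<in> {..<N}"
      have "ip (lebesgue_on \<Omega>) u (\<zeta> i) = ip (lebesgue_on \<Omega>) g (\<zeta> i)"
        by (rule ip_cong_AE[OF L2_measurable[OF L(1)] borel_measurable_lebesgue_on[OF g(1)]
            L2_measurable[OF \<zeta>] L2_measurable[OF \<zeta>] g(3)]) (use i in auto)
      then show "(ip (lebesgue_on \<Omega>) g (\<zeta> i))\<^sup>2 = (ip (lebesgue_on \<Omega>) u (\<zeta> i))\<^sup>2" by simp
    qed
    finally have "ip (lebesgue_on \<Omega>) u u \<le> \<epsilon> / 2 * ?E + (1 + 2 * M) * (\<epsilon>' * ?E + (\<Sum>i<N. (ip (lebesgue_on \<Omega>) u (\<zeta> i))\<^sup>2))"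
      using M0 by (simp add: mult_left_mono)
    also have "\<dots> = \<epsilon> / 2 * ?E + ((1 + 2 * M) * \<epsilon>') * ?E + (1 + 2 * M) * (\<Sum>i<N. (ip (lebesgue_on \<Omega>) u (\<zeta> i))\<^sup>2)"
      by (simp add: algebra_simps)
    also have "\<dots> = \<epsilon> * ?E + (\<Sum>i<N. (1 + 2 * M) * (ip (lebesgue_on \<Omega>) u (\<zeta> i))\<^sup>2)"
      unfolding \<epsilon>'(2) by (simp add: sum_distrib_left)
    also have "(\<Sum>i<N. (1 + 2 * M) * (ip (lebesgue_on \<Omega>) u (\<zeta> i))\<^sup>2) = (\<Sum>i<N. (ip (lebesgue_on \<Omega>) u (\<zeta>' i))\<^sup>2)"
      using M0 by (intro sum.cong refl) (simp add: \<zeta>'_def L2.scale_right[OF \<zeta> L(1)] power_mult_distrib)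
    finally show ?thesis .
  qed
  show ?thesis using \<zeta>' main by blast
qed

section \<open>Sobolev spaces as spaces of pairs\<close>

text \<open>Closure for the seminorm given by \<open>b\<close>. The epsilon form transfers directly
  along maps that preserve \<open>b\<close>, such as zero extension and isometric pullback.\<close>

definition (in psd_form) adherence :: "'v set \<Rightarrow> 'v set" where
  "adherence S = {p \<in> X. \<forall>\<epsilon>>0. \<exists>t\<in>S. b (p - t) (p - t) < \<epsilon>}"

lemma (in psd_form) subset_adherence: "S \<subseteq> X \<Longrightarrow> S \<subseteq> adherence S"
proof
  fix p assume "S \<subseteq> X" "p \<in> S"
  then show "p \<in> adherence S"
    unfolding adherence_def using zero_left[OF subspace_0[OF X]] by (auto intro!: bexI[of _ p])
qed

lemma (in psd_form) scale_quadratic: "p \<in> X \<Longrightarrow> b (c *\<^sub>R p) (c *\<^sub>R p) = c\<^sup>2 * b p p"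
  using subspace_scale[OF X, of p c] by (simp add: scale_left scale_right power2_eq_square)

lemma (in psd_form) subspace_adherence:
  assumes S: "subspace S" "S \<subseteq> X"
  shows "subspace (adherence S)"
  unfolding subspace_def
proof (intro conjI ballI allI)
  show "0 \<in> adherence S" using subset_adherence[OF S(2)] subspace_0[OF S(1)] by blast
  fix p q assume p: "p \<in> adherence S"
  have pX: "p \<in> X" using p by (simp add: adherence_def)
  show "c *\<^sub>R p \<in> adherence S" for c
    unfolding adherence_def
  proof (intro CollectI conjI allI impI)
    show "c *\<^sub>R p \<in> X" using X pX by (rule subspace_scale)
    fix \<epsilon> :: real assume "\<epsilon> > 0"
    then have "\<epsilon> / (c\<^sup>2 + 1) > 0" by (simp add: add_nonneg_pos)
    then obtain t where t: "t \<in> S" "b (p - t) (p - t) < \<epsilon> / (c\<^sup>2 + 1)" using p unfolding adherence_def by blast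
    have tX: "p - t \<in> X" using X pX S t by (auto intro: subspace_diff)
    have "b (c *\<^sub>R p - c *\<^sub>R t) (c *\<^sub>R p - c *\<^sub>R t) = c\<^sup>2 * b (p - t) (p - t)"
      unfolding scaleR_diff_right[symmetric] by (rule scale_quadratic[OF tX])
    also have "\<dots> \<le> (c\<^sup>2 + 1) * b (p - t) (p - t)" using nonneg[OF tX] by (simp add: mult_right_mono)
    also have "\<dots> < \<epsilon>" using t(2) by (simp add: pos_less_divide_eq add_nonneg_pos mult.commute)
    finally show "\<exists>t\<in>S. b (c *\<^sub>R p - t) (c *\<^sub>R p - t) < \<epsilon>"
      using subspace_scale[OF S(1) t(1)] by blast
  qed
  assume q: "q \<in> adherence S"
  have qX: "q \<in> X" using q by (simp add: adherence_def)
  show "p + q \<in> adherence S"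
    unfolding adherence_def
  proof (intro CollectI conjI allI impI)
    show "p + q \<in> X" using X pX qX by (rule subspace_add)
    fix \<epsilon> :: real assume "\<epsilon> > 0"
    then have "\<epsilon> / 4 > 0" by simp
    then obtain s t where s: "s \<in> S" "b (p - s) (p - s) < \<epsilon> / 4" and t: "t \<in> S" "b (q - t) (q - t) < \<epsilon> / 4"
      using p q unfolding adherence_def by blast
    have mem: "p - s \<in> X" "q - t \<in> X" using X pX qX S s t by (auto intro: subspace_diff)
    have "b (p + q - (s + t)) (p + q - (s + t)) = b ((p - s) + (q - t)) ((p - s) + (q - t))"
      by (simp add: algebra_simps)
    also have "\<dots> < \<epsilon>" using add_le[OF mem] s t by simp
    finally show "\<exists>t\<in>S. b (p + q - t) (p + q - t) < \<epsilon>" using subspace_add[OF S(1) s(1) t(1)] by blast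
  qed
qed

lemma (in psd_form) adherence_closed:
  assumes S: "S \<subseteq> X" and s: "\<And>k::nat. s k \<in> adherence S" and p: "p \<in> X"
    and lim: "(\<lambda>k. b (s k - p) (s k - p)) \<longlonglongrightarrow> 0"
  shows "p \<in> adherence S"
  unfolding adherence_def
proof (intro CollectI conjI allI impI p)
  fix \<epsilon> :: real assume "\<epsilon> > 0"
  then obtain k where k: "b (s k - p) (s k - p) < \<epsilon> / 4"
    using order_tendstoD(2)[OF lim, of "\<epsilon> / 4"] by (auto simp: eventually_sequentially)
  have "\<epsilon> / 4 > 0" using \<open>\<epsilon> > 0\<close> by simp
  then obtain t where t: "t \<in> S" "b (s k - t) (s k - t) < \<epsilon> / 4"
    using s[of k] unfolding adherence_def by blast
  have sX: "s k \<in> X" using s[of k] by (simp add: adherence_def)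
  have mem: "s k - t \<in> X" "s k - p \<in> X" using X sX S t p by (auto intro: subspace_diff)
  have "b (p - t) (p - t) = b ((s k - t) - (s k - p)) ((s k - t) - (s k - p))" by simp
  also have "\<dots> < \<epsilon>" using diff_le[OF mem] k t by simp
  finally show "\<exists>t\<in>S. b (p - t) (p - t) < \<epsilon>" using t(1) by blast
qed

text \<open>Carrying a gradient along with the function makes the energy a bilinear form on a vector
  space, with no choice among the gradients that agree almost everywhere.\<close>

type_synonym 'a gradient_pair = "('a \<Rightarrow> real) \<times> ('a \<Rightarrow> 'a)"

definition mass :: "'a::euclidean_space set \<Rightarrow> 'a gradient_pair \<Rightarrow> 'a gradient_pair \<Rightarrow> real" where
  "mass \<Omega> p q = ip (lebesgue_on \<Omega>) (fst p) (fst q)"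

definition energy :: "'a::euclidean_space set \<Rightarrow> 'a gradient_pair \<Rightarrow> 'a gradient_pair \<Rightarrow> real" where
  "energy \<Omega> p q = ip (lebesgue_on \<Omega>) (snd p) (snd q)"

definition sobolev_form :: "'a::euclidean_space set \<Rightarrow> 'a gradient_pair \<Rightarrow> 'a gradient_pair \<Rightarrow> real" where
  "sobolev_form \<Omega> p q = mass \<Omega> p q + energy \<Omega> p q"

abbreviation L2_pairs :: "'a::euclidean_space set \<Rightarrow> 'a gradient_pair set" where
  "L2_pairs \<Omega> \<equiv> L2 (lebesgue_on \<Omega>) \<times> L2 (lebesgue_on \<Omega>)"

definition W1 :: "'a::euclidean_space set \<Rightarrow> 'a gradient_pair set" where
  "W1 \<Omega> = {(u, G). weak_gradient \<Omega> u G}"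

definition test_pairs :: "'a::euclidean_space set \<Rightarrow> 'a gradient_pair set" where
  "test_pairs \<Omega> = {(\<phi>, \<psi>). test_function \<Omega> \<phi> \<and> (\<forall>x. GDERIV \<phi> x :> \<psi> x)}"

lemma psd_mass: "subspace X \<Longrightarrow> X \<subseteq> L2_pairs \<Omega> \<Longrightarrow> psd_form X (mass \<Omega>)"
  by unfold_locales (auto simp: mass_def L2.sym L2.add_left L2.scale_left L2.nonneg subset_iff mem_Times_iff)

lemma psd_energy: "subspace X \<Longrightarrow> X \<subseteq> L2_pairs \<Omega> \<Longrightarrow> psd_form X (energy \<Omega>)"
  by unfold_locales (auto simp: energy_def L2.sym L2.add_left L2.scale_left L2.nonneg subset_iff mem_Times_iff)

lemma subspace_L2_pairs: "subspace (L2_pairs \<Omega>)"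
  using subspace_Times[OF subspace_L2 subspace_L2] .

interpretation sobolev: psd_form "L2_pairs \<Omega>" "sobolev_form \<Omega>" for \<Omega> :: "'a::euclidean_space set"
proof -
  interpret m: psd_form "L2_pairs \<Omega>" "mass \<Omega>" by (rule psd_mass[OF subspace_L2_pairs]) simp
  interpret e: psd_form "L2_pairs \<Omega>" "energy \<Omega>" by (rule psd_energy[OF subspace_L2_pairs]) simp
  show "psd_form (L2_pairs \<Omega>) (sobolev_form \<Omega>)"
  proof
    show "subspace (L2_pairs \<Omega>)" by (rule subspace_L2_pairs)
    fix u v w c assume u: "u \<in> L2_pairs \<Omega>"
    show "0 \<le> sobolev_form \<Omega> u u" unfolding sobolev_form_def using m.nonneg[OF u] e.nonneg[OF u] by simp
    assume v: "v \<in> L2_pairs \<Omega>"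
    show "sobolev_form \<Omega> u v = sobolev_form \<Omega> v u" unfolding sobolev_form_def using m.sym[OF u v] e.sym[OF u v] by simp
    show "sobolev_form \<Omega> (c *\<^sub>R u) v = c * sobolev_form \<Omega> u v"
      unfolding sobolev_form_def m.scale_left[OF u v] e.scale_left[OF u v] by (simp add: algebra_simps)
    assume w: "w \<in> L2_pairs \<Omega>"
    show "sobolev_form \<Omega> (u + v) w = sobolev_form \<Omega> u w + sobolev_form \<Omega> v w"
      unfolding sobolev_form_def m.add_left[OF u v w] e.add_left[OF u v w] by simp
  qed
qed

lemma subspace_W1: "\<Omega> \<in> sets lebesgue \<Longrightarrow> subspace (W1 \<Omega>)"
  unfolding W1_def by (rule subspace_weak_gradient)

lemma W1_subset: "W1 \<Omega> \<subseteq> L2_pairs \<Omega>"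
  unfolding W1_def using weak_gradient_L2 by auto

lemma test_pairs_subset_W1: "open \<Omega> \<Longrightarrow> test_pairs \<Omega> \<subseteq> W1 \<Omega>"
  unfolding W1_def test_pairs_def using weak_gradient_test_function by auto

lemma subspace_test_pairs: "subspace (test_pairs \<Omega>)"
  unfolding subspace_def test_pairs_def
proof (intro conjI ballI allI)
  show "0 \<in> {(\<phi>, \<psi>). test_function \<Omega> \<phi> \<and> (\<forall>x. GDERIV \<phi> x :> \<psi> x)}"
    using test_function_zero GDERIV_const[of 0] by (auto simp: zero_prod_def zero_fun_def)
  fix p q c assume "p \<in> {(\<phi>, \<psi>). test_function \<Omega> \<phi> \<and> (\<forall>x. GDERIV \<phi> x :> \<psi> x)}"
  then obtain \<phi> \<psi> where p: "p = (\<phi>, \<psi>)" "test_function \<Omega> \<phi>" "\<And>x. GDERIV \<phi> x :> \<psi> x" by auto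
  show "c *\<^sub>R p \<in> {(\<phi>, \<psi>). test_function \<Omega> \<phi> \<and> (\<forall>x. GDERIV \<phi> x :> \<psi> x)}"
    using test_function_cmult[OF p(2), of c] GDERIV_mult[OF GDERIV_const[of c] p(3)]
    by (simp add: p(1) scaleR_fun_def)
  assume "q \<in> {(\<phi>, \<psi>). test_function \<Omega> \<phi> \<and> (\<forall>x. GDERIV \<phi> x :> \<psi> x)}"
  then obtain \<phi>' \<psi>' where q: "q = (\<phi>', \<psi>')" "test_function \<Omega> \<phi>'" "\<And>x. GDERIV \<phi>' x :> \<psi>' x" by auto
  show "p + q \<in> {(\<phi>, \<psi>). test_function \<Omega> \<phi> \<and> (\<forall>x. GDERIV \<phi> x :> \<psi> x)}"
    using test_function_add[OF p(2) q(2)] GDERIV_add[OF p(3) q(3)]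
    by (simp add: p(1) q(1) plus_fun_def)
qed

text \<open>\<open>H1_0\<close> lifted to pairs; the identification, including the freedom in the
  gradient, is \<open>W1_0_iff\<close>.\<close>

definition W1_0 :: "'a::euclidean_space set \<Rightarrow> 'a gradient_pair set" where
  "W1_0 \<Omega> = sobolev.adherence \<Omega> (test_pairs \<Omega>)"

lemma sobolev_tendsto_iff:
  assumes s: "\<And>k::nat. s k \<in> L2_pairs \<Omega>" and p: "p \<in> L2_pairs \<Omega>"
  shows "(\<lambda>k. sobolev_form \<Omega> (s k - p) (s k - p)) \<longlonglongrightarrow> 0 \<longleftrightarrow>
    (\<lambda>k. ip (lebesgue_on \<Omega>) (fst (s k) - fst p) (fst (s k) - fst p)) \<longlonglongrightarrow> 0 \<and>
    (\<lambda>k. ip (lebesgue_on \<Omega>) (snd (s k) - snd p) (snd (s k) - snd p)) \<longlonglongrightarrow> 0"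
    (is "?L \<longleftrightarrow> ?m \<longlonglongrightarrow> 0 \<and> ?e \<longlonglongrightarrow> 0")
proof -
  have d: "fst (s k) - fst p \<in> L2 (lebesgue_on \<Omega>)" "snd (s k) - snd p \<in> L2 (lebesgue_on \<Omega>)" for k
    using s[of k] p by (auto simp: mem_Times_iff intro: subspace_diff[OF subspace_L2])
  have eq: "sobolev_form \<Omega> (s k - p) (s k - p) = ?m k + ?e k" for k
    by (simp add: sobolev_form_def mass_def energy_def)
  have nn: "?m k \<ge> 0" "?e k \<ge> 0" for k using L2.nonneg d by auto
  show ?thesis
    unfolding eq
  proof
    assume L: "(\<lambda>k. ?m k + ?e k) \<longlonglongrightarrow> 0"
    have "?m \<longlonglongrightarrow> 0" by (rule tendsto_sandwich[OF _ _ tendsto_const L]) (use nn in \<open>auto intro!: always_eventually\<close>)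
    moreover have "?e \<longlonglongrightarrow> 0" by (rule tendsto_sandwich[OF _ _ tendsto_const L]) (use nn in \<open>auto intro!: always_eventually\<close>)
    ultimately show "?m \<longlonglongrightarrow> 0 \<and> ?e \<longlonglongrightarrow> 0" by blast
  next
    assume "?m \<longlonglongrightarrow> 0 \<and> ?e \<longlonglongrightarrow> 0"
    then show "(\<lambda>k. ?m k + ?e k) \<longlonglongrightarrow> 0" using tendsto_add_zero by blast
  qed
qed

lemma W1_closed:
  assumes \<Omega>: "\<Omega> \<in> sets lebesgue" and s: "\<And>k::nat. s k \<in> W1 \<Omega>" and p: "p \<in> L2_pairs \<Omega>"
    and lim: "(\<lambda>k. sobolev_form \<Omega> (s k - p) (s k - p)) \<longlonglongrightarrow> 0"
  shows "p \<in> W1 \<Omega>"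
proof -
  have sL: "s k \<in> L2_pairs \<Omega>" for k using s W1_subset by blast
  have wg: "weak_gradient \<Omega> (fst (s k)) (snd (s k))" for k using s[of k] by (auto simp: W1_def)
  note l = lim[unfolded sobolev_tendsto_iff[OF sL p]]
  have "weak_gradient \<Omega> (fst p) (snd p)"
    by (rule weak_gradient_closed[OF \<Omega> wg _ conjunct1[OF l] _ conjunct2[OF l]])
      (use p in \<open>simp_all add: mem_Times_iff\<close>)
  then show ?thesis by (auto simp: W1_def case_prod_beta)
qed

lemma sobolev_complete:
  assumes s: "\<And>k::nat. s k \<in> L2_pairs \<Omega>"
    and cauchy: "\<And>\<epsilon>. \<epsilon> > 0 \<Longrightarrow> \<exists>M. \<forall>k\<ge>M. \<forall>l\<ge>M. sobolev_form \<Omega> (s k - s l) (s k - s l) < \<epsilon>"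
  shows "\<exists>p\<in>L2_pairs \<Omega>. (\<lambda>k. sobolev_form \<Omega> (s k - p) (s k - p)) \<longlonglongrightarrow> 0"
proof -
  let ?M = "lebesgue_on \<Omega>"
  have L: "fst (s k) \<in> L2 ?M" "snd (s k) \<in> L2 ?M" for k using s[of k] by (auto simp: mem_Times_iff)
  have d: "fst (s k) - fst (s l) \<in> L2 ?M" "snd (s k) - snd (s l) \<in> L2 ?M" for k l
    using subspace_diff[OF subspace_L2 L(1) L(1)] subspace_diff[OF subspace_L2 L(2) L(2)] by auto
  have le: "ip ?M (fst (s k) - fst (s l)) (fst (s k) - fst (s l)) \<le> sobolev_form \<Omega> (s k - s l) (s k - s l)"
    "ip ?M (snd (s k) - snd (s l)) (snd (s k) - snd (s l)) \<le> sobolev_form \<Omega> (s k - s l) (s k - s l)" for k l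
    using L2.nonneg[OF d(1)] L2.nonneg[OF d(2)] by (simp_all add: sobolev_form_def mass_def energy_def)
  have cauchy_le: "\<exists>N. \<forall>k\<ge>N. \<forall>l\<ge>N. f k l < \<epsilon>"
    if f: "\<And>k l. f k l \<le> sobolev_form \<Omega> (s k - s l) (s k - s l)" and \<epsilon>: "\<epsilon> > 0" for f and \<epsilon> :: real
  proof -
    obtain N where "\<forall>k\<ge>N. \<forall>l\<ge>N. sobolev_form \<Omega> (s k - s l) (s k - s l) < \<epsilon>"
      using cauchy[OF \<epsilon>] ..
    then show ?thesis
      by (intro exI[of _ N] allI impI) (rule le_less_trans[OF f], simp)
  qed
  have "\<exists>u\<in>L2 ?M. (\<lambda>k. ip ?M (fst (s k) - u) (fst (s k) - u)) \<longlonglongrightarrow> 0"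
    by (rule L2_complete[OF L(1)]) (rule cauchy_le[OF le(1)])
  then obtain u where u: "u \<in> L2 ?M" "(\<lambda>k. ip ?M (fst (s k) - u) (fst (s k) - u)) \<longlonglongrightarrow> 0" by blast
  have "\<exists>G\<in>L2 ?M. (\<lambda>k. ip ?M (snd (s k) - G) (snd (s k) - G)) \<longlonglongrightarrow> 0"
    by (rule L2_complete[OF L(2)]) (rule cauchy_le[OF le(2)])
  then obtain G where G: "G \<in> L2 ?M" "(\<lambda>k. ip ?M (snd (s k) - G) (snd (s k) - G)) \<longlonglongrightarrow> 0" by blast
  have p: "(u, G) \<in> L2_pairs \<Omega>" using u G by simp
  show ?thesis
    by (rule bexI[OF _ p]) (use u G in \<open>simp add: sobolev_tendsto_iff[OF s p]\<close>)
qed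

lemma W1_0_subset_W1:
  assumes \<Omega>: "open \<Omega>"
  shows "W1_0 \<Omega> \<subseteq> W1 \<Omega>"
proof
  fix p assume p: "p \<in> W1_0 \<Omega>"
  have \<Omega>m: "\<Omega> \<in> sets lebesgue" using \<Omega> by (simp add: sets_completionI_sets)
  have pL: "p \<in> L2_pairs \<Omega>" using p by (simp add: W1_0_def sobolev.adherence_def)
  have "\<exists>t. t \<in> test_pairs \<Omega> \<and> sobolev_form \<Omega> (p - t) (p - t) < 1 / real (Suc k)" for k
  proof -
    have "\<exists>t\<in>test_pairs \<Omega>. sobolev_form \<Omega> (p - t) (p - t) < 1 / real (Suc k)"
      using p unfolding W1_0_def sobolev.adherence_def by simp
    then show ?thesis by blast
  qed
  then obtain t where t: "\<And>k. t k \<in> test_pairs \<Omega>" "\<And>k. sobolev_form \<Omega> (p - t k) (p - t k) < 1 / real (Suc k)" by metis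
  have tL: "t k \<in> L2_pairs \<Omega>" for k using t(1) test_pairs_subset_W1[OF \<Omega>] W1_subset by blast
  have "(\<lambda>k. sobolev_form \<Omega> (t k - p) (t k - p)) \<longlonglongrightarrow> 0"
  proof (rule tendsto_sandwich[OF _ _ tendsto_const LIMSEQ_Suc[OF lim_1_over_n]])
    have mem: "t k - p \<in> L2_pairs \<Omega>" for k using subspace_diff[OF subspace_L2_pairs tL pL] .
    have "sobolev_form \<Omega> (t k - p) (t k - p) = sobolev_form \<Omega> (p - t k) (p - t k)" for k
      using sobolev.scale_quadratic[OF mem, of "-1" k] by simp
    then show "\<forall>\<^sub>F n in sequentially. sobolev_form \<Omega> (t n - p) (t n - p) \<le> 1 / real (Suc n)"
      using t(2) by (auto intro!: always_eventually less_imp_le)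
    show "\<forall>\<^sub>F n in sequentially. 0 \<le> sobolev_form \<Omega> (t n - p) (t n - p)"
      using sobolev.nonneg[OF mem] by (auto intro!: always_eventually)
  qed
  then show "p \<in> W1 \<Omega>"
    using t(1) test_pairs_subset_W1[OF \<Omega>] by (intro W1_closed[OF \<Omega>m _ pL]) auto
qed

text \<open>Membership in \<open>H1_0\<close> supplies an approximating sequence for some weak
  gradient of \<open>u\<close>, not necessarily \<open>G\<close>. Since weak gradients agree almost
  everywhere, the same sequence works for \<open>G\<close>.\<close>

lemma W1_0_iff:
  assumes \<Omega>: "open \<Omega>"
  shows "(u, G) \<in> W1_0 \<Omega> \<longleftrightarrow> u \<in> H1_0 \<Omega> \<and> weak_gradient \<Omega> u G"
proof -
  let ?M = "lebesgue_on \<Omega>"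
  have \<Omega>m: "\<Omega> \<in> sets lebesgue" using \<Omega> by (simp add: sets_completionI_sets)
  have form: "(LINT x|?M. (u x - \<phi> x)\<^sup>2 + (norm (G x - \<psi> x))\<^sup>2) = sobolev_form \<Omega> ((u, G) - (\<phi>, \<psi>)) ((u, G) - (\<phi>, \<psi>))"
    if wg: "weak_gradient \<Omega> u G" and t: "(\<phi>, \<psi>) \<in> test_pairs \<Omega>" for u G \<phi> \<psi>
  proof -
    have "(\<phi>, \<psi>) \<in> L2_pairs \<Omega>" using t test_pairs_subset_W1[OF \<Omega>] W1_subset by blast
    then have d: "u - \<phi> \<in> L2 ?M" "G - \<psi> \<in> L2 ?M"
      using weak_gradient_L2[OF wg] by (auto intro: subspace_diff[OF subspace_L2])
    show ?thesis
      using L2_integrable_square[OF d(1)] L2_integrable_square[OF d(2)]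
      by (simp add: sobolev_form_def mass_def energy_def ip_diff_eq)
  qed
  show ?thesis
  proof
    assume A: "(u, G) \<in> W1_0 \<Omega>"
    then have wg: "weak_gradient \<Omega> u G" using W1_0_subset_W1[OF \<Omega>] by (auto simp: W1_def)
    have "\<exists>\<phi> \<psi>. (\<phi>, \<psi>) \<in> test_pairs \<Omega> \<and> sobolev_form \<Omega> ((u, G) - (\<phi>, \<psi>)) ((u, G) - (\<phi>, \<psi>)) < 1 / real (Suc k)" for k
    proof -
      have "\<exists>t\<in>test_pairs \<Omega>. sobolev_form \<Omega> ((u, G) - t) ((u, G) - t) < 1 / real (Suc k)"
        using A unfolding W1_0_def sobolev.adherence_def by simp
      then show ?thesis by (metis surj_pair)
    qed
    then obtain \<phi> \<psi> where t: "\<And>k. (\<phi> k, \<psi> k) \<in> test_pairs \<Omega>"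
      and lt: "\<And>k. sobolev_form \<Omega> ((u, G) - (\<phi> k, \<psi> k)) ((u, G) - (\<phi> k, \<psi> k)) < 1 / real (Suc k)" by metis
    have "(\<lambda>n. LINT x|?M. (u x - \<phi> n x)\<^sup>2 + (norm (G x - \<psi> n x))\<^sup>2) \<longlonglongrightarrow> 0"
    proof (rule tendsto_sandwich[OF _ _ tendsto_const LIMSEQ_Suc[OF lim_1_over_n]])
      show "\<forall>\<^sub>F n in sequentially. (LINT x|?M. (u x - \<phi> n x)\<^sup>2 + (norm (G x - \<psi> n x))\<^sup>2) \<le> 1 / real (Suc n)"
        using lt form[OF wg t] by (auto intro!: always_eventually less_imp_le)
      show "\<forall>\<^sub>F n in sequentially. 0 \<le> (LINT x|?M. (u x - \<phi> n x)\<^sup>2 + (norm (G x - \<psi> n x))\<^sup>2)"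
        by (auto intro!: always_eventually integral_nonneg_AE)
    qed
    then show "u \<in> H1_0 \<Omega> \<and> weak_gradient \<Omega> u G"
      unfolding H1_0_def using t wg by (auto simp: test_pairs_def)
  next
    assume A: "u \<in> H1_0 \<Omega> \<and> weak_gradient \<Omega> u G"
    then obtain G' \<phi> \<psi> where wg': "weak_gradient \<Omega> u G'" and t: "\<And>n::nat. (\<phi> n, \<psi> n) \<in> test_pairs \<Omega>"
      and lim: "(\<lambda>n. LINT x|?M. (u x - \<phi> n x)\<^sup>2 + (norm (G' x - \<psi> n x))\<^sup>2) \<longlonglongrightarrow> 0"
      unfolding H1_0_def test_pairs_def by auto
    have wg: "weak_gradient \<Omega> u G" using A by blast
    have tL: "(\<phi> n, \<psi> n) \<in> L2_pairs \<Omega>" for n using t test_pairs_subset_W1[OF \<Omega>] W1_subset by blast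
    note L = weak_gradient_L2[OF wg] weak_gradient_L2[OF wg']
    have eq: "sobolev_form \<Omega> ((u, G) - (\<phi> n, \<psi> n)) ((u, G) - (\<phi> n, \<psi> n)) = sobolev_form \<Omega> ((u, G') - (\<phi> n, \<psi> n)) ((u, G') - (\<phi> n, \<psi> n))" for n
    proof -
      have d: "G - \<psi> n \<in> L2 ?M" "G' - \<psi> n \<in> L2 ?M" using L tL[of n] by (auto intro: subspace_diff[OF subspace_L2])
      have ae: "AE x in ?M. (G - \<psi> n) x = (G' - \<psi> n) x"
        using weak_gradient_unique[OF \<Omega> wg wg'] by eventually_elim simp
      have "ip ?M (G - \<psi> n) (G - \<psi> n) = ip ?M (G' - \<psi> n) (G' - \<psi> n)"
        by (rule ip_cong_AE[OF L2_measurable[OF d(1)] L2_measurable[OF d(2)] L2_measurable[OF d(1)] L2_measurable[OF d(2)] ae ae])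
      then show ?thesis by (simp add: sobolev_form_def mass_def energy_def)
    qed
    show "(u, G) \<in> W1_0 \<Omega>"
      unfolding W1_0_def sobolev.adherence_def
    proof (intro CollectI conjI allI impI)
      show "(u, G) \<in> L2_pairs \<Omega>" using L by simp
      fix \<epsilon> :: real assume "\<epsilon> > 0"
      then obtain n where "(LINT x|?M. (u x - \<phi> n x)\<^sup>2 + (norm (G' x - \<psi> n x))\<^sup>2) < \<epsilon>"
        using order_tendstoD(2)[OF lim] by (auto simp: eventually_sequentially)
      then show "\<exists>t\<in>test_pairs \<Omega>. sobolev_form \<Omega> ((u, G) - t) ((u, G) - t) < \<epsilon>"
        using t[of n] form[OF wg' t, of n] eq[of n] by metis
    qed
  qed
qed

lemma W1_0_closed:
  assumes \<Omega>: "open \<Omega>" and s: "\<And>k::nat. s k \<in> W1_0 \<Omega>" and p: "p \<in> L2_pairs \<Omega>"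
    and lim: "(\<lambda>k. sobolev_form \<Omega> (s k - p) (s k - p)) \<longlonglongrightarrow> 0"
  shows "p \<in> W1_0 \<Omega>"
  unfolding W1_0_def
  by (rule sobolev.adherence_closed[OF _ _ p lim])
    (use s test_pairs_subset_W1[OF \<Omega>] W1_subset in \<open>auto simp: W1_0_def\<close>)

lemma subspace_W1_0: "open \<Omega> \<Longrightarrow> subspace (W1_0 \<Omega>)"
  unfolding W1_0_def using test_pairs_subset_W1 W1_subset
  by (intro sobolev.subspace_adherence subspace_test_pairs) blast

lemma test_pairs_subset_W1_0: "open \<Omega> \<Longrightarrow> test_pairs \<Omega> \<subseteq> W1_0 \<Omega>"
  unfolding W1_0_def using test_pairs_subset_W1 W1_subset by (intro sobolev.subset_adherence) blast

text \<open>Bumps with disjoint supports around \<open>n\<close> distinct points of the open set,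
  for the axiom \<open>infinite_dim\<close>.\<close>

lemma orthogonal_test_pairs:
  fixes \<Omega> :: "'a::euclidean_space set"
  assumes \<Omega>: "open \<Omega>" "\<Omega> \<noteq> {}"
  shows "\<exists>w. (\<forall>i<n::nat. w i \<in> test_pairs \<Omega> \<and> mass \<Omega> (w i) (w i) > 0) \<and>
    (\<forall>i<n. \<forall>j<n. i \<noteq> j \<longrightarrow> mass \<Omega> (w i) (w j) = 0)"
proof -
  let ?M = "lebesgue_on \<Omega>"
  have \<Omega>m: "\<Omega> \<in> sets lebesgue" using \<Omega> by (simp add: sets_completionI_sets)
  have "infinite \<Omega>"
  proof
    assume "finite \<Omega>"
    then have "negligible \<Omega>" by (rule negligible_finite)
    then show False using open_not_negligible \<Omega> by blast
  qed
  then obtain F where F: "F \<subseteq> \<Omega>" "finite F" "card F = n" using infinite_arbitrarily_large by metis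
  obtain q where q: "bij_betw q {..<n} F"
    using ex_bij_betw_nat_finite[OF F(2)] F(3) by (auto simp: atLeast0LessThan)
  \<comment> \<open>At most half of every distance between two of the points, so balls of this
    radius are disjoint; the 1 keeps the minimum defined when there are no pairs.\<close>
  define \<eta> where "\<eta> = Min (insert 1 ((\<lambda>(i, j). dist (q i) (q j) / 2) ` {(i, j). i < n \<and> j < n \<and> i \<noteq> j}))"
  have finp: "finite {(i, j). i < n \<and> j < n \<and> i \<noteq> j}"
    by (rule finite_subset[of _ "{..<n} \<times> {..<n}"]) auto
  have \<eta>: "\<eta> > 0" unfolding \<eta>_def
    using finp q by (subst Min_gr_iff) (auto simp: bij_betw_def inj_on_def)
  have sep: "\<eta> \<le> dist (q i) (q j) / 2" if "i < n" "j < n" "i \<noteq> j" for i j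
    unfolding \<eta>_def using finp that by (intro Min_le) auto
  have "\<exists>l r. cbox l r \<subseteq> \<Omega> \<inter> ball (q i) \<eta> \<and> q i \<in> box l r" if "i < n" for i
  proof -
    have "q i \<in> \<Omega> \<inter> ball (q i) \<eta>" using that q F(1) \<eta> by (auto simp: bij_betw_def)
    then show ?thesis using open_contains_cbox[of "\<Omega> \<inter> ball (q i) \<eta>" "q i"] \<Omega>(1) by (metis open_Int open_ball)
  qed
  then obtain l r where lr: "\<And>i. i < n \<Longrightarrow> cbox (l i) (r i) \<subseteq> \<Omega> \<inter> ball (q i) \<eta>" "\<And>i. i < n \<Longrightarrow> q i \<in> box (l i) (r i)"
    by metis
  define \<phi> where "\<phi> i = box_bump 1 (l i) (r i)" for i
  have t: "test_function \<Omega> (\<phi> i)" if "i < n" for i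
    unfolding \<phi>_def by (rule test_function_box_bump) (use lr(1)[OF that] in auto)
  have "\<exists>\<psi>. \<forall>x. GDERIV (\<phi> i) x :> \<psi> x" if "i < n" for i using test_function_gradient[OF t[OF that]] by blast
  then obtain \<psi> where \<psi>: "\<And>i x. i < n \<Longrightarrow> GDERIV (\<phi> i) x :> \<psi> i x" by metis
  show ?thesis
  proof (intro exI[of _ "\<lambda>i. (\<phi> i, \<psi> i)"] conjI allI impI)
    fix i assume i: "i < n"
    show "(\<phi> i, \<psi> i) \<in> test_pairs \<Omega>" using t \<psi> i by (simp add: test_pairs_def)
    have L: "\<phi> i \<in> L2 ?M" using test_function_L2[OF t[OF i] \<Omega>m] .
    have "ip ?M (\<phi> i) (\<phi> i) \<noteq> 0"
    proof
      assume "ip ?M (\<phi> i) (\<phi> i) = 0"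
      then have "AE x in lebesgue. x \<in> \<Omega> \<longrightarrow> \<phi> i x = 0"
        using L2_null_iff[OF L] \<Omega>m by (simp add: AE_restrict_space_iff)
      then have "AE x in lebesgue. x \<notin> box (l i) (r i)"
      proof eventually_elim
        case (elim x)
        have "x \<in> \<Omega>" if "x \<in> box (l i) (r i)" using lr(1)[OF i] box_subset_cbox that by blast
        moreover have "\<phi> i x \<noteq> 0" if "x \<in> box (l i) (r i)" using that by (simp add: \<phi>_def box_bump_nonzero_iff)
        ultimately show ?case using elim by blast
      qed
      then have "negligible (box (l i) (r i))"
        unfolding negligible_iff_null_sets by (subst AE_iff_null_sets) auto
      then show False using open_not_negligible[OF open_box, of "l i" "r i"] lr(2)[OF i] by blast
    qed
    then show "mass \<Omega> (\<phi> i, \<psi> i) (\<phi> i, \<psi> i) > 0"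
      using L2.nonneg[OF L] by (simp add: mass_def)
    fix j assume j: "j < n" "i \<noteq> j"
    have prod0: "\<phi> i x * \<phi> j x = 0" for x
    proof (rule ccontr)
      assume "\<phi> i x * \<phi> j x \<noteq> 0"
      then have "x \<in> box (l i) (r i)" "x \<in> box (l j) (r j)" by (auto simp: \<phi>_def box_bump_nonzero_iff)
      then have "x \<in> ball (q i) \<eta>" "x \<in> ball (q j) \<eta>" using lr(1)[OF i] lr(1)[OF j(1)] box_subset_cbox by blast+
      then have "dist (q i) (q j) < 2 * \<eta>" using dist_triangle2[of "q i" "q j" x] by simp
      then show False using sep[OF i j] by simp
    qed
    show "mass \<Omega> (\<phi> i, \<psi> i) (\<phi> j, \<psi> j) = 0"
      unfolding mass_def ip_def fst_conv inner_real_def prod0 by simp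
  qed
qed

text \<open>The part common to both boundary conditions: the form domain has only to be a closed
  subspace that contains the test pairs and satisfies the compactness estimate. The functionals are
  inner products with the \<open>\<zeta> i\<close>, bounded by Cauchy-Schwarz.\<close>

lemma energy_space_W1_subspace:
  assumes \<Omega>: "open \<Omega>" "\<Omega> \<noteq> {}" and X: "subspace X" "X \<subseteq> L2_pairs \<Omega>" "test_pairs \<Omega> \<subseteq> X"
    and closed: "\<And>s p. \<lbrakk>\<And>k::nat. s k \<in> X; p \<in> L2_pairs \<Omega>;
      (\<lambda>k. sobolev_form \<Omega> (s k - p) (s k - p)) \<longlonglongrightarrow> 0\<rbrakk> \<Longrightarrow> p \<in> X"
    and compact: "\<And>\<epsilon>. \<epsilon> > 0 \<Longrightarrow> \<exists>(N::nat) \<zeta>. (\<forall>i<N. \<zeta> i \<in> L2 (lebesgue_on \<Omega>)) \<and>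
      (\<forall>(u, G)\<in>X. ip (lebesgue_on \<Omega>) u u \<le> \<epsilon> * ip (lebesgue_on \<Omega>) G G +
         (\<Sum>i<N. (ip (lebesgue_on \<Omega>) u (\<zeta> i))\<^sup>2))"
  shows "energy_space X (mass \<Omega>) (energy \<Omega>)"
proof (intro energy_space.intro energy_space_axioms.intro psd_mass[OF X(1,2)] psd_energy[OF X(1,2)])
  fix s assume s: "\<And>k::nat. s k \<in> X"
    and c: "\<And>\<epsilon>. \<epsilon> > 0 \<Longrightarrow> \<exists>M. \<forall>k\<ge>M. \<forall>l\<ge>M. mass \<Omega> (s k - s l) (s k - s l) + energy \<Omega> (s k - s l) (s k - s l) < \<epsilon>"
  have "\<exists>p\<in>L2_pairs \<Omega>. (\<lambda>k. sobolev_form \<Omega> (s k - p) (s k - p)) \<longlonglongrightarrow> 0"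
    by (rule sobolev_complete) (use s X(2) c in \<open>auto simp: sobolev_form_def\<close>)
  then obtain p where p: "p \<in> L2_pairs \<Omega>" "(\<lambda>k. sobolev_form \<Omega> (s k - p) (s k - p)) \<longlonglongrightarrow> 0" ..
  have "p \<in> X" by (rule closed[OF s p])
  then show "\<exists>u\<in>X. (\<lambda>k. mass \<Omega> (s k - u) (s k - u) + energy \<Omega> (s k - u) (s k - u)) \<longlonglongrightarrow> 0"
    using p(2) unfolding sobolev_form_def by (rule rev_bexI)
next
  fix \<epsilon> :: real assume \<epsilon>: "\<epsilon> > 0"
  let ?M = "lebesgue_on \<Omega>"
  obtain N :: nat and \<zeta> where \<zeta>: "\<And>i. i < N \<Longrightarrow> \<zeta> i \<in> L2 ?M"
    and ineq: "\<And>u G. (u, G) \<in> X \<Longrightarrow> ip ?M u u \<le> \<epsilon> * ip ?M G G + (\<Sum>i<N. (ip ?M u (\<zeta> i))\<^sup>2)"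
    using compact[OF \<epsilon>] by blast
  define B where "B = (\<Sum>i<N. ip ?M (\<zeta> i) (\<zeta> i))"
  have B: "ip ?M (\<zeta> i) (\<zeta> i) \<le> B" if "i < N" for i
    unfolding B_def using L2.nonneg \<zeta> that by (intro member_le_sum) auto
  have XL: "fst p \<in> L2 ?M" "snd p \<in> L2 ?M" if "p \<in> X" for p using X(2) that by (auto simp: mem_Times_iff)
  show "\<exists>(N::nat) l B. (\<forall>i<N. \<forall>u\<in>X. \<forall>v\<in>X. \<forall>c. l i (u + v) = l i u + l i v \<and>
        l i (c *\<^sub>R u) = c * l i u \<and> (l i u)\<^sup>2 \<le> B * mass \<Omega> u u) \<and>
        (\<forall>u\<in>X. mass \<Omega> u u \<le> \<epsilon> * (mass \<Omega> u u + energy \<Omega> u u) + (\<Sum>i<N. (l i u)\<^sup>2))"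
  proof (intro exI[of _ N] exI[of _ "\<lambda>i p. ip ?M (fst p) (\<zeta> i)"] exI[of _ B] conjI allI impI ballI)
    fix i u v c assume i: "i < N" and u: "u \<in> X" and v: "v \<in> X"
    show "ip ?M (fst (u + v)) (\<zeta> i) = ip ?M (fst u) (\<zeta> i) + ip ?M (fst v) (\<zeta> i)"
      using L2.add_left[OF XL(1)[OF u] XL(1)[OF v] \<zeta>[OF i]] by simp
    show "ip ?M (fst (c *\<^sub>R u)) (\<zeta> i) = c * ip ?M (fst u) (\<zeta> i)"
      using L2.scale_left[OF XL(1)[OF u] \<zeta>[OF i]] by simp
    have "(ip ?M (fst u) (\<zeta> i))\<^sup>2 \<le> ip ?M (fst u) (fst u) * ip ?M (\<zeta> i) (\<zeta> i)"
      by (rule L2.cauchy_schwarz[OF XL(1)[OF u] \<zeta>[OF i]])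
    also have "\<dots> \<le> ip ?M (fst u) (fst u) * B" using B[OF i] L2.nonneg[OF XL(1)[OF u]] by (rule mult_left_mono)
    finally show "(ip ?M (fst u) (\<zeta> i))\<^sup>2 \<le> B * mass \<Omega> u u" by (simp add: mass_def mult.commute)
  next
    fix u assume u: "u \<in> X"
    have "mass \<Omega> u u \<le> \<epsilon> * energy \<Omega> u u + (\<Sum>i<N. (ip ?M (fst u) (\<zeta> i))\<^sup>2)"
      using ineq[of "fst u" "snd u"] u by (simp add: mass_def energy_def)
    also have "\<epsilon> * energy \<Omega> u u \<le> \<epsilon> * (mass \<Omega> u u + energy \<Omega> u u)"
      using \<epsilon> L2.nonneg[OF XL(1)[OF u]] by (simp add: mass_def)
    finally show "mass \<Omega> u u \<le> \<epsilon> * (mass \<Omega> u u + energy \<Omega> u u) + (\<Sum>i<N. (ip ?M (fst u) (\<zeta> i))\<^sup>2)"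
      by simp
  qed
next
  fix n :: nat
  show "\<exists>w. (\<forall>i<n. w i \<in> X \<and> mass \<Omega> (w i) (w i) > 0) \<and> (\<forall>i<n. \<forall>j<n. i \<noteq> j \<longrightarrow> mass \<Omega> (w i) (w j) = 0)"
    using orthogonal_test_pairs[OF \<Omega>, of n] X(3) by blast
qed

lemma energy_space_W1:
  assumes \<Omega>: "open \<Omega>" "\<Omega> \<noteq> {}" "bounded \<Omega>" and lip: "lipschitz_boundary \<Omega>"
  shows "energy_space (W1 \<Omega>) (mass \<Omega>) (energy \<Omega>)"
proof (rule energy_space_W1_subspace[OF \<Omega>(1,2) _ W1_subset test_pairs_subset_W1[OF \<Omega>(1)]])
  have \<Omega>m: "\<Omega> \<in> sets lebesgue" using \<Omega> by (simp add: sets_completionI_sets)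
  show "subspace (W1 \<Omega>)" by (rule subspace_W1[OF \<Omega>m])
  show "p \<in> W1 \<Omega>" if "\<And>k::nat. s k \<in> W1 \<Omega>" "p \<in> L2_pairs \<Omega>" "(\<lambda>k. sobolev_form \<Omega> (s k - p) (s k - p)) \<longlonglongrightarrow> 0" for s p
    by (rule W1_closed[OF \<Omega>m that])
  show "\<exists>(N::nat) \<zeta>. (\<forall>i<N. \<zeta> i \<in> L2 (lebesgue_on \<Omega>)) \<and>
      (\<forall>(u, G)\<in>W1 \<Omega>. ip (lebesgue_on \<Omega>) u u \<le> \<epsilon> * ip (lebesgue_on \<Omega>) G G +
         (\<Sum>i<N. (ip (lebesgue_on \<Omega>) u (\<zeta> i))\<^sup>2))" if "\<epsilon> > 0" for \<epsilon>
    using neumann_compactness[OF \<Omega>(1,3) lip that] unfolding W1_def by auto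
qed

section \<open>Extension by zero and compactness for the Dirichlet form domain\<close>

definition extension :: "'a set \<Rightarrow> 'a::euclidean_space gradient_pair \<Rightarrow> 'a gradient_pair" where
  "extension T p = ((\<lambda>x. if x \<in> T then fst p x else 0), (\<lambda>x. if x \<in> T then snd p x else 0))"

text \<open>The primed functions are allowed to differ from the unprimed ones off \<open>T\<close>,
  so that zero extensions and restrictions against test functions supported in \<open>T\<close> are
  both covered.\<close>

lemma ip_extension:
  fixes f :: "'a::euclidean_space \<Rightarrow> 'b::euclidean_space"
  assumes "T \<subseteq> \<Omega>" "T \<in> sets lebesgue" "\<Omega> \<in> sets lebesgue" "\<And>x. x \<in> T \<Longrightarrow> f x \<bullet> g x = f' x \<bullet> g' x"
    "\<And>x. x \<in> \<Omega> \<Longrightarrow> x \<notin> T \<Longrightarrow> f x \<bullet> g x = 0"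
  shows "ip (lebesgue_on \<Omega>) f g = ip (lebesgue_on T) f' g'"
proof -
  have "ip (lebesgue_on \<Omega>) f g = (LINT x|lebesgue. indicator \<Omega> x *\<^sub>R (f x \<bullet> g x))"
    unfolding ip_def using assms by (intro integral_restrict_space) auto
  also have "\<dots> = (LINT x|lebesgue. indicator T x *\<^sub>R (f' x \<bullet> g' x))"
    using assms by (intro Bochner_Integration.integral_cong) (auto simp: indicator_def)
  also have "\<dots> = ip (lebesgue_on T) f' g'"
    unfolding ip_def using assms by (intro integral_restrict_space[symmetric]) auto
  finally show ?thesis .
qed

lemma L2_extension:
  fixes f :: "'a::euclidean_space \<Rightarrow> 'b::euclidean_space"
  assumes "f \<in> L2 (lebesgue_on T)" "T \<subseteq> \<Omega>" "T \<in> sets lebesgue" "\<Omega> \<in> sets lebesgue"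
  shows "(\<lambda>x. if x \<in> T then f x else 0) \<in> L2 (lebesgue_on \<Omega>)"
proof -
  have eq: "(\<lambda>x. if x \<in> T then f x else 0) = (\<lambda>x. indicator T x *\<^sub>R f x)" by (auto simp: fun_eq_iff)
  have "(\<lambda>x. indicator T x *\<^sub>R f x) \<in> borel_measurable lebesgue"
    using L2_measurable[OF assms(1)] assms(3) by (simp add: borel_measurable_restrict_space_iff)
  moreover have "integrable lebesgue (\<lambda>x. indicator T x *\<^sub>R (norm (f x))\<^sup>2)"
    using L2_integrable_square[OF assms(1)] assms(3) by (simp add: integrable_restrict_space)
  moreover have "(\<lambda>x. indicator T x *\<^sub>R (norm (f x))\<^sup>2) = (\<lambda>x. (norm (indicator T x *\<^sub>R f x))\<^sup>2)"
    by (auto simp: fun_eq_iff indicator_def)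
  ultimately have "(\<lambda>x. if x \<in> T then f x else 0) \<in> L2 lebesgue" unfolding eq by (simp add: L2_def)
  then have "(\<lambda>x. if x \<in> T then f x else 0) \<in> L2 (lebesgue_on UNIV)" by (simp add: lebesgue_on_UNIV_eq)
  then show ?thesis by (rule L2_subset) (use assms in auto)
qed

text \<open>Test pairs on \<open>T\<close> already vanish outside \<open>T\<close>, so extending by
  zero leaves their Sobolev distance to \<open>p\<close> unchanged. The shape of the boundary of
  \<open>T\<close> does not enter.\<close>

lemma extension_W1_0:
  assumes T: "open T" "T \<subseteq> \<Omega>" and \<Omega>: "open \<Omega>" and p: "p \<in> W1_0 T"
  shows "extension T p \<in> W1_0 \<Omega>"
proof -
  have m: "T \<in> sets lebesgue" "\<Omega> \<in> sets lebesgue" using T \<Omega> by (auto simp: sets_completionI_sets)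
  have pL: "fst p \<in> L2 (lebesgue_on T)" "snd p \<in> L2 (lebesgue_on T)"
    using p by (auto simp: W1_0_def sobolev.adherence_def mem_Times_iff)
  show ?thesis
    unfolding W1_0_def sobolev.adherence_def
  proof (intro CollectI conjI allI impI)
    show "extension T p \<in> L2_pairs \<Omega>" unfolding extension_def using L2_extension[OF pL(1) T(2) m] L2_extension[OF pL(2) T(2) m] by simp
    fix \<epsilon> :: real assume "\<epsilon> > 0"
    then obtain t where t: "t \<in> test_pairs T" "sobolev_form T (p - t) (p - t) < \<epsilon>"
      using p by (auto simp: W1_0_def sobolev.adherence_def)
    obtain \<phi> \<psi> where t': "t = (\<phi>, \<psi>)" "test_function T \<phi>" "\<And>x. GDERIV \<phi> x :> \<psi> x"
      using t(1) by (auto simp: test_pairs_def)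
    have z: "\<phi> x = 0" "\<psi> x = 0" if "x \<notin> T" for x
      using test_function_support[OF t'(2)] t'(3) that by (metis subset_iff)+
    have "sobolev_form \<Omega> (extension T p - t) (extension T p - t) = sobolev_form T (p - t) (p - t)"
      unfolding sobolev_form_def mass_def energy_def
      by (intro arg_cong2[where f="(+)"] ip_extension[OF T(2) m]) (auto simp: extension_def t'(1) z)
    then show "\<exists>t\<in>test_pairs \<Omega>. sobolev_form \<Omega> (extension T p - t) (extension T p - t) < \<epsilon>"
      using t test_function_mono[OF t'(2) T(2)] t'(3) by (intro bexI[of _ t]) (auto simp: t'(1) test_pairs_def)
  qed
qed

text \<open>After extension by zero to the whole space, the closure of \<open>\<Omega>\<close> is a
  compact subset of an open set, and the interior estimate covers the whole mass.\<close>

lemma dirichlet_compactness: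
  fixes \<Omega> :: "'a::euclidean_space set"
  assumes \<Omega>: "open \<Omega>" "bounded \<Omega>" and \<epsilon>: "\<epsilon> > 0"
  shows "\<exists>(N::nat) \<zeta>. (\<forall>i<N. \<zeta> i \<in> L2 (lebesgue_on \<Omega>)) \<and>
      (\<forall>(u, G)\<in>W1_0 \<Omega>. ip (lebesgue_on \<Omega>) u u \<le> \<epsilon> * ip (lebesgue_on \<Omega>) G G +
         (\<Sum>i<N. (ip (lebesgue_on \<Omega>) u (\<zeta> i))\<^sup>2))"
proof -
  let ?U = "lebesgue_on (UNIV :: 'a set)" and ?M = "lebesgue_on \<Omega>"
  have m: "\<Omega> \<in> sets lebesgue" "(UNIV::'a set) \<in> sets lebesgue" "closure \<Omega> \<in> sets lebesgue"
    using \<Omega> by (auto simp: sets_completionI_sets)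
  have "compact (closure \<Omega>)" using \<Omega> by (simp add: compact_closure)
  from interior_compactness[OF open_UNIV this _ \<epsilon>]
  obtain N :: nat and \<zeta> where \<zeta>: "\<And>i. i < N \<Longrightarrow> \<zeta> i \<in> L2 ?U"
    and ineq: "\<And>u G. weak_gradient UNIV u G \<Longrightarrow>
       ip (lebesgue_on (closure \<Omega>)) u u \<le> \<epsilon> * ip ?U G G + (\<Sum>i<N. (ip ?U u (\<zeta> i))\<^sup>2)" by auto
  have "ip ?M u u \<le> \<epsilon> * ip ?M G G + (\<Sum>i<N. (ip ?M u (\<zeta> i))\<^sup>2)" if p: "(u, G) \<in> W1_0 \<Omega>" for u G
  proof -
    let ?u = "\<lambda>x. if x \<in> \<Omega> then u x else 0" and ?G = "\<lambda>x. if x \<in> \<Omega> then G x else 0"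
    have "extension \<Omega> (u, G) \<in> W1 UNIV"
      using extension_W1_0[OF \<Omega>(1) _ open_UNIV p] W1_0_subset_W1[OF open_UNIV] by auto
    then have "weak_gradient UNIV ?u ?G" unfolding extension_def W1_def fst_conv snd_conv by simp
    from ineq[OF this] have "ip (lebesgue_on (closure \<Omega>)) ?u ?u \<le> \<epsilon> * ip ?U ?G ?G + (\<Sum>i<N. (ip ?U ?u (\<zeta> i))\<^sup>2)" .
    also have "ip (lebesgue_on (closure \<Omega>)) ?u ?u = ip ?M u u"
      by (rule ip_extension[OF closure_subset m(1,3)]) auto
    also have "ip ?U ?G ?G = ip ?M G G" by (rule ip_extension[OF _ m(1,2)]) auto
    also have "(\<Sum>i<N. (ip ?U ?u (\<zeta> i))\<^sup>2) = (\<Sum>i<N. (ip ?M u (\<zeta> i))\<^sup>2)"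
      by (intro sum.cong refl arg_cong[where f="\<lambda>x. x\<^sup>2"] ip_extension[OF _ m(1,2)]) auto
    finally show ?thesis .
  qed
  moreover have "\<zeta> i \<in> L2 ?M" if "i < N" for i by (rule L2_subset[OF \<zeta>[OF that] _ m(1,2)]) simp
  ultimately show ?thesis by blast
qed

lemma energy_space_W1_0:
  assumes \<Omega>: "open \<Omega>" "\<Omega> \<noteq> {}" "bounded \<Omega>"
  shows "energy_space (W1_0 \<Omega>) (mass \<Omega>) (energy \<Omega>)"
proof (rule energy_space_W1_subspace[OF \<Omega>(1,2) subspace_W1_0[OF \<Omega>(1)] _ test_pairs_subset_W1_0[OF \<Omega>(1)]])
  show "W1_0 \<Omega> \<subseteq> L2_pairs \<Omega>" using W1_0_subset_W1[OF \<Omega>(1)] W1_subset by blast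
  show "p \<in> W1_0 \<Omega>" if "\<And>k::nat. s k \<in> W1_0 \<Omega>" "p \<in> L2_pairs \<Omega>" "(\<lambda>k. sobolev_form \<Omega> (s k - p) (s k - p)) \<longlonglongrightarrow> 0" for s p
    by (rule W1_0_closed[OF \<Omega>(1) that])
qed (rule dirichlet_compactness[OF \<Omega>(1,3)])

section \<open>Isometries and eigenvalue counts\<close>

lemma orthogonal_transformation_measurable:
  fixes A :: "'a::euclidean_space \<Rightarrow> 'a"
  assumes "orthogonal_transformation A"
  shows "A \<in> borel_measurable borel"
proof -
  have "bounded_linear A"
    using orthogonal_transformation_linear[OF assms] by (simp only: linear_conv_bounded_linear)
  then show ?thesis by (intro borel_measurable_continuous_onI linear_continuous_on)
qed

text \<open>Uniqueness of Haar measure: integrating \<open>1\<^sub>S(A x) 1\<^sub>U(A x - y)\<close> over \<open>x\<close> and \<open>y\<close>, with \<open>U\<close> the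
  unit ball, in the two orders gives \<open>|A\<^sup>-\<^sup>1 S| |U| = |U| |S|\<close>.\<close>

lemma lborel_distr_orthogonal:
  fixes A :: "'a::euclidean_space \<Rightarrow> 'a"
  assumes A: "orthogonal_transformation A"
  shows "distr lborel borel A = lborel"
proof (rule measure_eqI)
  show "sets (distr lborel borel A) = sets lborel" by simp
  fix S :: "'a set" assume "S \<in> sets (distr lborel borel A)"
  then have S[measurable]: "S \<in> sets borel" by simp
  have [measurable]: "A \<in> borel_measurable borel" by (rule orthogonal_transformation_measurable[OF A])
  define U where "U = ball (0::'a) 1"
  have [measurable]: "U \<in> sets borel" by (simp add: U_def)
  define B where "B = inv A"
  have AB: "A (B y) = y" for y
    using orthogonal_transformation_bij[OF A] by (simp add: B_def bij_is_surj surj_f_inv_f)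
  have lin: "A (x + y) = A x + A y" for x y using orthogonal_transformation_linear[OF A] by (rule linear_add)
  have AU: "A x \<in> U \<longleftrightarrow> x \<in> U" for x using orthogonal_transformation_norm[OF A, of x] by (simp add: U_def)
  have iU: "indicator U (A x) = (indicator U x :: ennreal)" for x using AU[of x] by (simp add: indicator_def)
  have U1: "(\<integral>\<^sup>+y. indicator U (z - y) \<partial>lborel) = emeasure lborel U" for z :: 'a
  proof -
    have "indicator U (z - y) = (indicator U (y + - z) :: ennreal)" for y
      by (simp add: indicator_def U_def norm_minus_commute)
    then have "(\<integral>\<^sup>+y. indicator U (z - y) \<partial>lborel) = (\<integral>\<^sup>+y. indicator U (y + - z) \<partial>lborel)" by simp
    also have "\<dots> = (\<integral>\<^sup>+y. indicator U y \<partial>lborel)" by (rule nn_integral_lborel_translate) measurable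
    finally show ?thesis by simp
  qed
  have S1: "(\<integral>\<^sup>+y. indicator S (z + y) \<partial>lborel) = emeasure lborel S" for z :: 'a
    using nn_integral_lborel_translate[of "indicator S" z] by (simp add: add.commute)
  have "emeasure (distr lborel borel A) S * emeasure lborel U
      = (\<integral>\<^sup>+x. indicator S (A x) * emeasure lborel U \<partial>lborel)"
  proof -
    have "(\<integral>\<^sup>+x. indicator S (A x) \<partial>lborel) = (\<integral>\<^sup>+x. indicator S x \<partial>distr lborel borel A)"
      by (rule nn_integral_distr[symmetric]) measurable
    then show ?thesis by (simp add: nn_integral_multc)
  qed
  also have "\<dots> = (\<integral>\<^sup>+x. (\<integral>\<^sup>+y. indicator S (A x) * indicator U (A x - y) \<partial>lborel) \<partial>lborel)"
    by (simp add: nn_integral_cmult U1)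
  also have "\<dots> = (\<integral>\<^sup>+y. (\<integral>\<^sup>+x. indicator S (A x) * indicator U (A x - y) \<partial>lborel) \<partial>lborel)"
    by (rule lborel_pair.Fubini') measurable
  also have "\<dots> = (\<integral>\<^sup>+y. (\<integral>\<^sup>+x. indicator S (A x + y) * indicator U (A x) \<partial>lborel) \<partial>lborel)"
  proof (rule nn_integral_cong)
    \<comment> \<open>Replacing \<open>x\<close> by \<open>x + B y\<close> turns
      \<open>A x - y\<close> into \<open>A x\<close>, and \<open>U\<close> is invariant under
      \<open>A\<close>.\<close>
    fix y
    have "(\<integral>\<^sup>+x. indicator S (A x) * indicator U (A x - y) \<partial>lborel)
       = (\<integral>\<^sup>+x. indicator S (A (x + B y)) * indicator U (A (x + B y) - y) \<partial>lborel)"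
      by (rule nn_integral_lborel_translate[symmetric]) measurable
    then show "(\<integral>\<^sup>+x. indicator S (A x) * indicator U (A x - y) \<partial>lborel)
       = (\<integral>\<^sup>+x. indicator S (A x + y) * indicator U (A x) \<partial>lborel)"
      by (simp add: lin AB)
  qed
  also have "\<dots> = (\<integral>\<^sup>+x. (\<integral>\<^sup>+y. indicator S (A x + y) * indicator U (A x) \<partial>lborel) \<partial>lborel)"
    by (rule lborel_pair.Fubini') measurable
  also have "\<dots> = (\<integral>\<^sup>+x. emeasure lborel S * indicator U x \<partial>lborel)"
    by (simp add: nn_integral_multc S1 iU)
  also have "\<dots> = emeasure lborel S * emeasure lborel U" by (simp add: nn_integral_cmult)
  finally have eq: "emeasure (distr lborel borel A) S * emeasure lborel U = emeasure lborel S * emeasure lborel U" .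
  have fin: "emeasure lborel U < \<infinity>" unfolding U_def by (rule emeasure_lborel_ball_finite)
  have "measure lborel U > 0" unfolding U_def using content_ball_pos[of 1 "0::'a"] by simp
  then have "emeasure lborel U \<noteq> 0" by (auto simp: measure_def)
  then have cancel: "x * emeasure lborel U / emeasure lborel U = x" for x
    using fin by (intro mult_divide_eq_ennreal) auto
  have "emeasure (distr lborel borel A) S
      = emeasure (distr lborel borel A) S * emeasure lborel U / emeasure lborel U" by (rule cancel[symmetric])
  also have "\<dots> = emeasure lborel S" unfolding eq by (rule cancel)
  finally show "emeasure (distr lborel borel A) S = emeasure lborel S" .
qed

definition isometry_of :: "'a::euclidean_space \<Rightarrow> ('a \<Rightarrow> 'a) \<Rightarrow> 'a \<Rightarrow> 'a" where
  "isometry_of c A x = c + A x"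

lemma lborel_distr_isometry:
  fixes A :: "'a::euclidean_space \<Rightarrow> 'a"
  assumes A: "orthogonal_transformation A"
  shows "distr lborel borel (isometry_of c A) = lborel"
proof -
  have [measurable]: "A \<in> borel_measurable borel" by (rule orthogonal_transformation_measurable[OF A])
  have "distr lborel borel (isometry_of c A) = distr (distr lborel borel A) borel ((+) c)"
    by (subst distr_distr) (auto simp: isometry_of_def[abs_def] comp_def)
  then show ?thesis by (simp add: lborel_distr_orthogonal[OF A] lborel_distr_plus)
qed

text \<open>Passing to the completion requires preimages of null sets to be null, which is a
  consequence of the invariance of \<open>lborel\<close>.\<close>

lemma lebesgue_isometry:
  fixes A :: "'a::euclidean_space \<Rightarrow> 'a"
  assumes A: "orthogonal_transformation A"
  shows isometry_measurable_lebesgue: "isometry_of c A \<in> lebesgue \<rightarrow>\<^sub>M lebesgue"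
    and lebesgue_distr_isometry: "distr lebesgue lebesgue (isometry_of c A) = lebesgue"
proof -
  have [measurable]: "A \<in> borel_measurable borel" by (rule orthogonal_transformation_measurable[OF A])
  have "isometry_of c A \<in> lborel \<rightarrow>\<^sub>M lborel" unfolding isometry_of_def[abs_def] by measurable
  then have m: "isometry_of c A \<in> lebesgue \<rightarrow>\<^sub>M lborel" by (rule measurable_completion)
  have d: "distr lebesgue lborel (isometry_of c A) = lborel"
  proof -
    have "distr lebesgue lborel (isometry_of c A) = distr lborel lborel (isometry_of c A)"
      by (rule distr_completion) fact
    also have "\<dots> = distr lborel borel (isometry_of c A)" by (rule distr_cong) auto
    finally show ?thesis by (simp add: lborel_distr_isometry[OF A])
  qed
  show "isometry_of c A \<in> lebesgue \<rightarrow>\<^sub>M lebesgue"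
    by (rule completion.measurable_completion2[OF m]) (simp add: d)
  show "distr lebesgue lebesgue (isometry_of c A) = lebesgue"
    using completion.completion_distr_eq[OF m] d by simp
qed

text \<open>The inverse \<open>B\<close> is a parameter beside \<open>A\<close>, so that the inverse
  isometry is again an instance of the locale, with offset \<open>- B c\<close> and the two maps
  exchanged.\<close>

locale isometric_domains =
  fixes c :: "'a::euclidean_space" and A B :: "'a \<Rightarrow> 'a" and \<Omega>\<^sub>1 \<Omega>\<^sub>2 :: "'a set"
  assumes A: "orthogonal_transformation A" and B: "orthogonal_transformation B"
    and AB: "A (B y) = y" and BA: "B (A y) = y"
    and open1: "open \<Omega>\<^sub>1" and open2: "open \<Omega>\<^sub>2"
    and mem_iff: "x \<in> \<Omega>\<^sub>1 \<longleftrightarrow> c + A x \<in> \<Omega>\<^sub>2"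
begin

lemma sets1: "\<Omega>\<^sub>1 \<in> sets lebesgue" and sets2: "\<Omega>\<^sub>2 \<in> sets lebesgue"
  using open1 open2 by (auto simp: sets_completionI_sets)

lemma A_inner: "A v \<bullet> A w = v \<bullet> w" and B_inner: "B v \<bullet> B w = v \<bullet> w"
  using A B by (auto simp: orthogonal_transformation_def)

lemma B_inner_left: "B v \<bullet> w = v \<bullet> A w"
  using A_inner[of "B v" w] by (simp add: AB)

lemma indicator_compose: "indicator \<Omega>\<^sub>1 x = indicator \<Omega>\<^sub>2 (isometry_of c A x)"
  using mem_iff[of x] by (simp add: indicator_def isometry_of_def)

lemma lebesgue_integral_compose:
  fixes h :: "'a \<Rightarrow> 'b::euclidean_space"
  assumes "h \<in> borel_measurable lebesgue"
  shows "(LINT x|lebesgue. h (isometry_of c A x)) = (LINT x|lebesgue. h x)"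
    and "integrable lebesgue h \<longleftrightarrow> integrable lebesgue (\<lambda>x. h (isometry_of c A x))"
  using integral_distr[OF isometry_measurable_lebesgue[OF A] assms]
    integrable_distr_eq[OF isometry_measurable_lebesgue[OF A] assms]
  by (simp_all add: lebesgue_distr_isometry[OF A])

lemma L2_compose:
  fixes f :: "'a \<Rightarrow> 'b::euclidean_space"
  assumes "f \<in> L2 (lebesgue_on \<Omega>\<^sub>2)"
  shows "(\<lambda>x. f (c + A x)) \<in> L2 (lebesgue_on \<Omega>\<^sub>1)"
proof -
  have m: "(\<lambda>y. indicator \<Omega>\<^sub>2 y *\<^sub>R f y) \<in> borel_measurable lebesgue"
    using L2_measurable[OF assms] sets2 by (simp add: borel_measurable_restrict_space_iff)
  have "(\<lambda>x. indicator \<Omega>\<^sub>2 (isometry_of c A x) *\<^sub>R f (isometry_of c A x)) \<in> borel_measurable lebesgue"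
    by (rule measurable_compose[OF isometry_measurable_lebesgue[OF A] m])
  then have "(\<lambda>x. f (c + A x)) \<in> borel_measurable (lebesgue_on \<Omega>\<^sub>1)"
    using sets1 by (simp add: borel_measurable_restrict_space_iff indicator_compose) (simp add: isometry_of_def)
  moreover have i: "integrable lebesgue (\<lambda>y. indicator \<Omega>\<^sub>2 y *\<^sub>R (norm (f y))\<^sup>2)"
    using L2_integrable_square[OF assms] sets2 by (simp add: integrable_restrict_space)
  have "integrable lebesgue (\<lambda>x. indicator \<Omega>\<^sub>2 (isometry_of c A x) *\<^sub>R (norm (f (isometry_of c A x)))\<^sup>2)"
    using lebesgue_integral_compose(2)[OF borel_measurable_integrable[OF i]] i by blast
  then have "integrable (lebesgue_on \<Omega>\<^sub>1) (\<lambda>x. (norm (f (c + A x)))\<^sup>2)"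
    using sets1 by (simp add: integrable_restrict_space indicator_compose) (simp add: isometry_of_def)
  ultimately show ?thesis by (simp add: L2_def)
qed

lemma integral_compose:
  fixes h :: "'a \<Rightarrow> 'b::euclidean_space"
  assumes "h \<in> borel_measurable (lebesgue_on \<Omega>\<^sub>2)"
  shows "(LINT x|lebesgue_on \<Omega>\<^sub>1. h (c + A x)) = (LINT x|lebesgue_on \<Omega>\<^sub>2. h x)"
proof -
  have m: "(\<lambda>y. indicator \<Omega>\<^sub>2 y *\<^sub>R h y) \<in> borel_measurable lebesgue"
    using assms sets2 by (simp add: borel_measurable_restrict_space_iff)
  have "(LINT x|lebesgue_on \<Omega>\<^sub>1. h (c + A x)) = (LINT x|lebesgue. indicator \<Omega>\<^sub>1 x *\<^sub>R h (c + A x))"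
    using sets1 by (intro integral_restrict_space) auto
  also have "\<dots> = (LINT x|lebesgue. indicator \<Omega>\<^sub>2 (isometry_of c A x) *\<^sub>R h (isometry_of c A x))"
    by (simp add: indicator_compose) (simp add: isometry_of_def)
  also have "\<dots> = (LINT x|lebesgue. indicator \<Omega>\<^sub>2 x *\<^sub>R h x)" by (rule lebesgue_integral_compose(1)[OF m])
  also have "\<dots> = (LINT x|lebesgue_on \<Omega>\<^sub>2. h x)"
    using sets2 by (intro integral_restrict_space[symmetric]) auto
  finally show ?thesis .
qed

lemma ip_compose:
  fixes f g :: "'a \<Rightarrow> 'b::euclidean_space"
  assumes "f \<in> L2 (lebesgue_on \<Omega>\<^sub>2)" "g \<in> L2 (lebesgue_on \<Omega>\<^sub>2)"
  shows "ip (lebesgue_on \<Omega>\<^sub>1) (\<lambda>x. f (c + A x)) (\<lambda>x. g (c + A x)) = ip (lebesgue_on \<Omega>\<^sub>2) f g"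
  unfolding ip_def
  by (rule integral_compose[of "\<lambda>x. f x \<bullet> g x"])
    (rule borel_measurable_integrable[OF L2_inner_integrable[OF assms]])

lemma measure_eq: "measure lebesgue \<Omega>\<^sub>1 = measure lebesgue \<Omega>\<^sub>2"
  using integral_compose[of "\<lambda>_. 1::real"] sets1 sets2 by (simp add: measure_restrict_space)

text \<open>The gradient of \<open>u (c + A x)\<close> is the transpose of \<open>A\<close> applied
  to the gradient at the image point, and this transpose is \<open>B\<close>.\<close>

definition pullback :: "'a gradient_pair \<Rightarrow> 'a gradient_pair" where
  "pullback p = ((\<lambda>x. fst p (c + A x)), (\<lambda>x. B (snd p (c + A x))))"

lemma pullback_L2:
  assumes "p \<in> L2_pairs \<Omega>\<^sub>2"
  shows "pullback p \<in> L2_pairs \<Omega>\<^sub>1"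
proof -
  have p: "fst p \<in> L2 (lebesgue_on \<Omega>\<^sub>2)" "snd p \<in> L2 (lebesgue_on \<Omega>\<^sub>2)" using assms by (auto simp: mem_Times_iff)
  have s: "(\<lambda>x. snd p (c + A x)) \<in> L2 (lebesgue_on \<Omega>\<^sub>1)" by (rule L2_compose[OF p(2)])
  have "(\<lambda>x. B (snd p (c + A x))) \<in> borel_measurable (lebesgue_on \<Omega>\<^sub>1)"
    by (rule measurable_compose[OF L2_measurable[OF s] orthogonal_transformation_measurable[OF B]])
  then have "(\<lambda>x. B (snd p (c + A x))) \<in> L2 (lebesgue_on \<Omega>\<^sub>1)"
    using L2_integrable_square[OF s] by (simp add: L2_def orthogonal_transformation_norm[OF B])
  then show ?thesis using L2_compose[OF p(1)] by (simp add: pullback_def)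
qed

lemma mass_pullback:
  assumes "p \<in> L2_pairs \<Omega>\<^sub>2" "q \<in> L2_pairs \<Omega>\<^sub>2"
  shows "mass \<Omega>\<^sub>1 (pullback p) (pullback q) = mass \<Omega>\<^sub>2 p q"
  using assms ip_compose by (auto simp: mass_def pullback_def mem_Times_iff)

lemma energy_pullback:
  assumes "p \<in> L2_pairs \<Omega>\<^sub>2" "q \<in> L2_pairs \<Omega>\<^sub>2"
  shows "energy \<Omega>\<^sub>1 (pullback p) (pullback q) = energy \<Omega>\<^sub>2 p q"
proof -
  have "energy \<Omega>\<^sub>1 (pullback p) (pullback q) = ip (lebesgue_on \<Omega>\<^sub>1) (\<lambda>x. snd p (c + A x)) (\<lambda>x. snd q (c + A x))"
    by (simp add: energy_def pullback_def ip_def B_inner)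
  then show ?thesis using assms ip_compose[of "snd p" "snd q"] by (auto simp: energy_def mem_Times_iff)
qed

lemma pullback_diff: "pullback (p - q) = pullback p - pullback q"
  using orthogonal_transformation_linear[OF B] by (auto simp: pullback_def fun_eq_iff linear_diff)

lemma pullback_sum: "pullback (\<Sum>i\<in>I. r i *\<^sub>R p i) = (\<Sum>i\<in>I. r i *\<^sub>R pullback (p i))"
  using orthogonal_transformation_linear[OF B]
  by (simp add: prod_eq_iff pullback_def fst_sum snd_sum fun_eq_iff sum_fun_apply linear_sum linear_scale)

lemma pushed_test_function:
  assumes "test_function \<Omega>\<^sub>1 \<phi>" "\<And>x. GDERIV \<phi> x :> \<psi> x"
  shows "test_function \<Omega>\<^sub>2 (\<lambda>y. \<phi> (- B c + B y))"
    and "GDERIV (\<lambda>y. \<phi> (- B c + B y)) y :> A (\<psi> (- B c + B y))"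
proof -
  have linA: "linear A" using A by (rule orthogonal_transformation_linear)
  have "c + A (- B c + B y) = y" for y by (simp add: linear_diff[OF linA] AB)
  then show "test_function \<Omega>\<^sub>2 (\<lambda>y. \<phi> (- B c + B y))"
    by (intro test_function_compose_orthogonal[OF B assms(1)]) (metis mem_iff)
  show "GDERIV (\<lambda>y. \<phi> (- B c + B y)) y :> A (\<psi> (- B c + B y))"
    by (rule GDERIV_compose_orthogonal[OF B BA assms(2)])
qed

text \<open>A test function on \<open>\<Omega>\<^sub>1\<close> is carried to
  \<open>\<Omega>\<^sub>2\<close> by the inverse isometry and tested there with the vector
  \<open>A v\<close>; orthogonality moves \<open>A\<close> to the other factor as
  \<open>B\<close>.\<close>

lemma pullback_W1:
  assumes p: "p \<in> W1 \<Omega>\<^sub>2"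
  shows "pullback p \<in> W1 \<Omega>\<^sub>1"
proof -
  obtain u G where pe: "p = (u, G)" and wg: "weak_gradient \<Omega>\<^sub>2 u G" using p by (auto simp: W1_def)
  note L = weak_gradient_L2[OF wg]
  have linA: "linear A" using A by (rule orthogonal_transformation_linear)
  have linB: "linear B" using B by (rule orthogonal_transformation_linear)
  have inv: "- B c + B (c + A x) = x" for x by (simp add: linear_add[OF linB] BA)
  have "pullback p \<in> L2_pairs \<Omega>\<^sub>1" using p W1_subset by (intro pullback_L2) blast
  moreover have "ip (lebesgue_on \<Omega>\<^sub>1) (\<lambda>x. u (c + A x)) (\<lambda>x. \<psi> x \<bullet> v) = - ip (lebesgue_on \<Omega>\<^sub>1) (\<lambda>x. B (G (c + A x))) (\<lambda>x. \<phi> x *\<^sub>R v)"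
    if \<phi>: "test_function \<Omega>\<^sub>1 \<phi>" "\<forall>x. GDERIV \<phi> x :> \<psi> x" for \<phi> \<psi> v
  proof -
    let ?\<phi> = "\<lambda>y. \<phi> (- B c + B y)" and ?\<psi> = "\<lambda>y. A (\<psi> (- B c + B y))"
    have t: "test_function \<Omega>\<^sub>2 ?\<phi>" "\<And>y. GDERIV ?\<phi> y :> ?\<psi> y"
      using pushed_test_function[OF \<phi>(1), of \<psi>] \<phi>(2) by auto
    note tL = L2_test_components[OF t sets2, of "A v"]
    have "ip (lebesgue_on \<Omega>\<^sub>1) (\<lambda>x. u (c + A x)) (\<lambda>x. \<psi> x \<bullet> v)
       = ip (lebesgue_on \<Omega>\<^sub>1) (\<lambda>x. u (c + A x)) (\<lambda>x. (\<lambda>y. ?\<psi> y \<bullet> A v) (c + A x))"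
      by (simp only: inv A_inner)
    also have "\<dots> = ip (lebesgue_on \<Omega>\<^sub>2) u (\<lambda>y. ?\<psi> y \<bullet> A v)" by (rule ip_compose[OF L(1) tL(1)])
    also have "\<dots> = - ip (lebesgue_on \<Omega>\<^sub>2) G (\<lambda>y. ?\<phi> y *\<^sub>R A v)" by (rule weak_gradientD[OF wg sets2 t])
    also have "ip (lebesgue_on \<Omega>\<^sub>2) G (\<lambda>y. ?\<phi> y *\<^sub>R A v)
       = ip (lebesgue_on \<Omega>\<^sub>1) (\<lambda>x. G (c + A x)) (\<lambda>x. (\<lambda>y. ?\<phi> y *\<^sub>R A v) (c + A x))"
      by (rule ip_compose[OF L(2) tL(2), symmetric])
    also have "\<dots> = ip (lebesgue_on \<Omega>\<^sub>1) (\<lambda>x. B (G (c + A x))) (\<lambda>x. \<phi> x *\<^sub>R v)"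
      unfolding ip_def B_inner_left inv linear_scale[OF linA] ..
    finally show ?thesis .
  qed
  ultimately show ?thesis
    by (auto simp: W1_def pullback_def pe weak_gradient_iff[OF sets1])
qed

end

lemma isometric_domains_inverse:
  assumes "isometric_domains c A B \<Omega>\<^sub>1 \<Omega>\<^sub>2"
  shows "isometric_domains (- B c) B A \<Omega>\<^sub>2 \<Omega>\<^sub>1"
proof -
  interpret isometric_domains c A B \<Omega>\<^sub>1 \<Omega>\<^sub>2 by fact
  have linA: "linear A" using A by (rule orthogonal_transformation_linear)
  have "c + A (- B c + B y) = y" for y by (simp add: linear_diff[OF linA] AB)
  then show ?thesis using A B AB BA open1 open2 mem_iff by unfold_locales auto
qed

text \<open>Pullback maps test pairs to test pairs and preserves the Sobolev form, so approximation
  in that form is preserved.\<close>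

lemma (in isometric_domains) pullback_W1_0:
  assumes p: "p \<in> W1_0 \<Omega>\<^sub>2"
  shows "pullback p \<in> W1_0 \<Omega>\<^sub>1"
proof -
  interpret i: isometric_domains "- B c" B A \<Omega>\<^sub>2 \<Omega>\<^sub>1
    by (rule isometric_domains_inverse) unfold_locales
  have linB: "linear B" using B by (rule orthogonal_transformation_linear)
  have pL: "p \<in> L2_pairs \<Omega>\<^sub>2" using p by (simp add: W1_0_def sobolev.adherence_def)
  show ?thesis
    unfolding W1_0_def sobolev.adherence_def
  proof (intro CollectI conjI allI impI pullback_L2[OF pL])
    fix \<epsilon> :: real assume "\<epsilon> > 0"
    then obtain t where t: "t \<in> test_pairs \<Omega>\<^sub>2" "sobolev_form \<Omega>\<^sub>2 (p - t) (p - t) < \<epsilon>"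
      using p by (auto simp: W1_0_def sobolev.adherence_def)
    obtain \<phi> \<psi> where t': "t = (\<phi>, \<psi>)" "test_function \<Omega>\<^sub>2 \<phi>" "\<And>x. GDERIV \<phi> x :> \<psi> x"
      using t(1) by (auto simp: test_pairs_def)
    \<comment> \<open>The inverse of the inverse isometry has offset \<open>- A (- B c)\<close>;
      this identifies the functions pushed by \<open>i\<close> with the pullback.\<close>
    have c: "- A (- B c) = c"
      using AB linear_neg[OF orthogonal_transformation_linear[OF A]] by simp
    have "t \<in> L2_pairs \<Omega>\<^sub>2" using t(1) test_pairs_subset_W1[OF open2] W1_subset by blast
    then have ptL: "p - t \<in> L2_pairs \<Omega>\<^sub>2" by (rule subspace_diff[OF subspace_L2_pairs pL])
    have "pullback t \<in> test_pairs \<Omega>\<^sub>1"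
      using i.pushed_test_function[OF t'(2,3)] by (simp add: pullback_def t'(1) test_pairs_def c)
    moreover have "sobolev_form \<Omega>\<^sub>1 (pullback p - pullback t) (pullback p - pullback t) < \<epsilon>"
      using t(2) mass_pullback[OF ptL ptL] energy_pullback[OF ptL ptL]
      by (simp add: sobolev_form_def flip: pullback_diff)
    ultimately show "\<exists>t\<in>test_pairs \<Omega>\<^sub>1. sobolev_form \<Omega>\<^sub>1 (pullback p - t) (pullback p - t) < \<epsilon>" by blast
  qed
qed

lemma congruent_to_isometric_domains:
  assumes "congruent_to S T" "open S"
  shows "\<exists>c A B. isometric_domains c A B S T"
proof -
  obtain c A where A: "orthogonal_transformation A" and T: "T = (\<lambda>x. c + A x) ` S"
    using assms by (auto simp: congruent_to_def)
  define B where "B = inv A"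
  have B: "orthogonal_transformation B" unfolding B_def by (rule orthogonal_transformation_inv[OF A])
  have bij: "bij A" by (rule orthogonal_transformation_bij[OF A])
  have AB: "A (B y) = y" "B (A y) = y" for y
    using bij by (auto simp: B_def bij_is_surj surj_f_inv_f bij_is_inj)
  have mem: "x \<in> S \<longleftrightarrow> c + A x \<in> T" for x
  proof
    assume "c + A x \<in> T"
    then obtain y where y: "y \<in> S" "A x = A y" unfolding T by auto
    have "x = y" by (rule injD[OF bij_is_inj[OF bij] y(2)])
    then show "x \<in> S" using y by simp
  qed (simp add: T)
  have "T = (\<lambda>y. B (y - c)) -` S"
  proof (intro set_eqI)
    fix y show "y \<in> T \<longleftrightarrow> y \<in> (\<lambda>y. B (y - c)) -` S" using mem[of "B (y - c)"] by (simp add: AB)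
  qed
  moreover have "open ((\<lambda>y. B (y - c)) -` S)"
  proof (rule open_vimage[OF assms(2)])
    have "bounded_linear B"
      using orthogonal_transformation_linear[OF B] by (simp only: linear_conv_bounded_linear)
    then have "continuous_on UNIV B" by (rule linear_continuous_on)
    then show "continuous_on UNIV (\<lambda>y. B (y - c))"
      by (rule continuous_on_compose2) (auto intro!: continuous_intros)
  qed
  ultimately have "isometric_domains c A B S T"
    using A B AB assms(2) mem by unfold_locales auto
  then show ?thesis by blast
qed

text \<open>A test function on the smaller set is one on the larger set and vanishes, with its
  gradient, outside the smaller one.\<close>

lemma weak_gradient_restrict:
  assumes wg: "weak_gradient \<Omega> u G" and T: "T \<subseteq> \<Omega>" and m: "T \<in> sets lebesgue" "\<Omega> \<in> sets lebesgue"
  shows "weak_gradient T u G"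
  unfolding weak_gradient_iff[OF m(1)]
proof (intro conjI allI impI)
  show "u \<in> L2 (lebesgue_on T)" "G \<in> L2 (lebesgue_on T)"
    using L2_subset[OF _ T m] weak_gradient_L2[OF wg] by blast+
  fix \<phi> \<psi> v assume \<phi>: "test_function T \<phi>" and \<psi>: "\<forall>x. GDERIV \<phi> x :> \<psi> x"
  obtain K where K: "K \<subseteq> T" "\<And>x. x \<notin> K \<Longrightarrow> \<phi> x = 0" "\<And>x. x \<notin> K \<Longrightarrow> \<psi> x = 0"
    using test_function_support[OF \<phi>] \<psi> by metis
  then have z: "\<phi> x = 0" "\<psi> x = 0" if "x \<notin> T" for x using that by auto
  have "ip (lebesgue_on T) u (\<lambda>x. \<psi> x \<bullet> v) = ip (lebesgue_on \<Omega>) u (\<lambda>x. \<psi> x \<bullet> v)"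
    by (rule ip_extension[OF T m, symmetric]) (auto simp: z)
  also have "\<dots> = - ip (lebesgue_on \<Omega>) G (\<lambda>x. \<phi> x *\<^sub>R v)"
    using weak_gradientD[OF wg m(2) test_function_mono[OF \<phi> T]] \<psi> by blast
  also have "ip (lebesgue_on \<Omega>) G (\<lambda>x. \<phi> x *\<^sub>R v) = ip (lebesgue_on T) G (\<lambda>x. \<phi> x *\<^sub>R v)"
    by (rule ip_extension[OF T m]) (auto simp: z)
  finally show "ip (lebesgue_on T) u (\<lambda>x. \<psi> x \<bullet> v) = - ip (lebesgue_on T) G (\<lambda>x. \<phi> x *\<^sub>R v)" .
qed

section \<open>From eigenbases to the eigenvalue counts\<close>

lemma form_laplacian_eigen_iff:
  assumes X: "X = {(u, G). u \<in> V \<and> weak_gradient \<Omega> u G}"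
  shows "form_laplacian V \<Omega> u (\<lambda>x. t * u x) \<longleftrightarrow>
    (\<exists>G. (u, G) \<in> X \<and> (\<forall>p\<in>X. energy \<Omega> (u, G) p = t * mass \<Omega> (u, G) p))"
proof -
  have "(LINT x|lebesgue_on \<Omega>. (t * u x) * v x) = t * (LINT x|lebesgue_on \<Omega>. u x * v x)" for v
    by (simp add: mult.assoc)
  moreover have "square_integrable \<Omega> (\<lambda>x. t * u x)" if "weak_gradient \<Omega> u G" for G
    using L2_scale[OF weak_gradient_L2(1)[OF that], of t] by (simp add: square_integrable_iff_L2)
  ultimately show ?thesis
    unfolding form_laplacian_def X by (auto simp: energy_def mass_def ip_def)
qed

text \<open>Independence almost everywhere means that only the trivial combination has mass 0. An
  independent family in the eigenspace is therefore bounded by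
  \<open>eigenvector_family_card_le\<close>, and the basis vectors belonging to \<open>t\<close>
  attain the bound.\<close>

lemma eigenvalue_multiplicity:
  assumes X: "X = {(u, G). u \<in> V \<and> weak_gradient \<Omega> u G}"
    and es: "energy_space X (mass \<Omega>) (energy \<Omega>)"
    and eb: "energy_space.eigenbasis X (mass \<Omega>) (energy \<Omega>) w \<Lambda>"
  shows "multiplicity_on \<Omega> (form_laplacian V \<Omega>) t = enat (card {n. \<Lambda> n = t})"
proof -
  interpret energy_space X "mass \<Omega>" "energy \<Omega>" by (rule es)
  have XL: "fst p \<in> L2 (lebesgue_on \<Omega>)" if "p \<in> X" for p using that X weak_gradient_L2 by auto
  have null: "mass \<Omega> (\<Sum>i<n. c i *\<^sub>R v i) (\<Sum>i<n. c i *\<^sub>R v i) = 0 \<longleftrightarrow>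
      (AE x in lebesgue_on \<Omega>. (\<Sum>i<n. c i * fst (v i) x) = 0)" if "\<And>i. i < n \<Longrightarrow> v i \<in> X" for n c and v :: "nat \<Rightarrow> 'a gradient_pair"
  proof -
    have "(\<Sum>i<n. c i *\<^sub>R v i) \<in> X" using m.X that by (intro subspace_sum subspace_scale) auto
    from L2_null_iff[OF XL[OF this]] show ?thesis by (simp add: mass_def fst_sum sum_fun_apply)
  qed
  let ?S = "{enat n | n. \<exists>u :: nat \<Rightarrow> 'a \<Rightarrow> real.
     (\<forall>i<n. form_laplacian V \<Omega> (u i) (\<lambda>x. t * u i x)) \<and>
     (\<forall>c :: nat \<Rightarrow> real. (AE x in lebesgue_on \<Omega>. (\<Sum>i<n. c i * u i x) = 0) \<longrightarrow> (\<forall>i<n. c i = 0))}"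
  have "Sup ?S \<le> enat (card {n. \<Lambda> n = t})"
  proof (rule Sup_least)
    fix z assume "z \<in> ?S"
    then obtain n and u :: "nat \<Rightarrow> 'a \<Rightarrow> real" where z: "z = enat n"
      and lap: "\<And>i. i < n \<Longrightarrow> form_laplacian V \<Omega> (u i) (\<lambda>x. t * u i x)"
      and ind: "\<And>c :: nat \<Rightarrow> real. (AE x in lebesgue_on \<Omega>. (\<Sum>i<n. c i * u i x) = 0) \<Longrightarrow> (\<forall>i<n. c i = 0)" by auto
    have "\<forall>i. \<exists>G. i < n \<longrightarrow> (u i, G) \<in> X \<and> (\<forall>p\<in>X. energy \<Omega> (u i, G) p = t * mass \<Omega> (u i, G) p)"
      using lap form_laplacian_eigen_iff[OF X] by blast
    then obtain G where G: "\<And>i. i < n \<Longrightarrow> (u i, G i) \<in> X"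
      "\<And>i p. i < n \<Longrightarrow> p \<in> X \<Longrightarrow> energy \<Omega> (u i, G i) p = t * mass \<Omega> (u i, G i) p" by metis
    have "n \<le> card {k. \<Lambda> k = t}"
    proof (rule eigenvector_family_card_le[OF eb, of n "\<lambda>i. (u i, G i)"])
      fix c assume "mass \<Omega> (\<Sum>i<n. c i *\<^sub>R (u i, G i)) (\<Sum>i<n. c i *\<^sub>R (u i, G i)) = 0"
      then have "AE x in lebesgue_on \<Omega>. (\<Sum>i<n. c i * fst (u i, G i) x) = 0"
        using null[of n "\<lambda>i. (u i, G i)" c] G(1) by blast
      then show "\<forall>i<n. c i = 0" using ind by simp
    qed (use G in auto)
    then show "z \<le> enat (card {n. \<Lambda> n = t})" by (simp add: z)
  qed
  moreover have "enat (card {n. \<Lambda> n = t}) \<le> Sup ?S"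
  proof (rule Sup_upper)
    let ?n = "card {n. \<Lambda> n = t}"
    have fin: "finite {n. \<Lambda> n = t}" by (rule finite_subset[OF _ eigenbasis_finite[OF eb, of t]]) auto
    obtain k where k: "bij_betw k {..<?n} {n. \<Lambda> n = t}"
      using ex_bij_betw_nat_finite[OF fin] by (auto simp: atLeast0LessThan)
    have kt: "\<Lambda> (k i) = t" if "i < ?n" for i using k that by (auto simp: bij_betw_def)
    have kinj: "k i \<noteq> k j" if "i < ?n" "j < ?n" "i \<noteq> j" for i j
      using k that by (auto simp: bij_betw_def inj_on_def)
    have "form_laplacian V \<Omega> (fst (w (k i))) (\<lambda>x. t * fst (w (k i)) x)" if "i < ?n" for i
      unfolding form_laplacian_eigen_iff[OF X]
      by (rule exI[of _ "snd (w (k i))"])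
        (use eigenbasis_mem[OF eb, of "k i"] eigenbasis_eigen[OF eb, of _ "k i"] kt[OF that] in auto)
    moreover have "\<forall>i<?n. c i = 0" if ae: "AE x in lebesgue_on \<Omega>. (\<Sum>i<?n. c i * fst (w (k i)) x) = 0" for c :: "nat \<Rightarrow> real"
    proof -
      have "mass \<Omega> (\<Sum>i<?n. c i *\<^sub>R w (k i)) (\<Sum>i<?n. c i *\<^sub>R w (k i)) = 0"
        using null[of ?n "\<lambda>i. w (k i)" c] ae eigenbasis_mem[OF eb] by blast
      moreover have "mass \<Omega> (\<Sum>i<?n. c i *\<^sub>R w (k i)) (\<Sum>i<?n. c i *\<^sub>R w (k i)) = (\<Sum>i<?n. (c i)\<^sup>2 * mass \<Omega> (w (k i)) (w (k i)))"
        using eigenbasis_mem[OF eb] eigenbasis_orth[OF eb] kinj by (intro m.orthogonal_sum) auto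
      ultimately have "(\<Sum>i<?n. (c i)\<^sup>2) = 0" by (simp add: eigenbasis_norm[OF eb])
      then show ?thesis by (subst (asm) sum_nonneg_eq_0_iff) auto
    qed
    ultimately show "enat ?n \<in> ?S" by (intro CollectI exI[of _ ?n] conjI exI[of _ "\<lambda>i. fst (w (k i))"]) auto
  qed
  ultimately show ?thesis unfolding multiplicity_on_def by (rule antisym)
qed

text \<open>The sequence chosen by \<open>SOME\<close> shares its fibre cardinalities with
  \<open>\<Lambda>\<close>, and these alone determine how many terms lie below \<open>s\<close>; no
  comparison term by term is made.\<close>

lemma eigenvalue_sequence_count:
  fixes \<Lambda> :: "nat \<Rightarrow> real"
  assumes mult: "\<And>t. multiplicity_on \<Omega> A t = enat (card {n. \<Lambda> n = t})"
    and mono: "mono \<Lambda>" and fin: "\<And>t. finite {n. \<Lambda> n \<le> t}"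
  shows "card {n. 1 \<le> n \<and> eigenvalue_sequence \<Omega> A n \<le> s} = card {n. \<Lambda> n \<le> s}"
proof -
  define P where "P ev \<longleftrightarrow> mono_on {1..} ev \<and> (\<forall>t. finite {n. 1 \<le> n \<and> ev n = t} \<and>
          multiplicity_on \<Omega> A t = enat (card {n. 1 \<le> n \<and> ev n = t}))" for ev :: "nat \<Rightarrow> real"
  have fin_eq: "finite {n. \<Lambda> n = t}" for t by (rule finite_subset[OF _ fin[of t]]) auto
  \<comment> \<open>The chosen sequence is numbered from 1 and \<open>\<Lambda>\<close> from 0,
    hence the shift; the value at index 0 falls outside the range \<open>1 \<le> n\<close>. This
    witness makes the \<open>SOME\<close> meaningful.\<close>
  have "P (\<lambda>n. \<Lambda> (n - 1))"
  proof -
    have "{n. 1 \<le> n \<and> \<Lambda> (n - 1) = t} = Suc ` {n. \<Lambda> n = t}" for t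
    proof (intro set_eqI iffI)
      fix n assume "n \<in> {n. 1 \<le> n \<and> \<Lambda> (n - 1) = t}"
      then show "n \<in> Suc ` {n. \<Lambda> n = t}" by (intro image_eqI[of _ _ "n - 1"]) auto
    qed auto
    then show ?thesis unfolding P_def using fin_eq mult mono
      by (auto simp: card_image mono_on_def intro!: monoD[OF mono])
  qed
  then have P: "P (eigenvalue_sequence \<Omega> A)"
    unfolding eigenvalue_sequence_def P_def[symmetric] by (rule someI[of P])
  define ev where "ev = eigenvalue_sequence \<Omega> A"
  have ev: "finite {n. 1 \<le> n \<and> ev n = t}" "card {n. 1 \<le> n \<and> ev n = t} = card {n. \<Lambda> n = t}" for t
    using P mult[of t] by (auto simp: P_def ev_def)
  \<comment> \<open>Both sets are split into fibres over the values in \<open>?R\<close>. Every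
    value of \<open>ev\<close> up to \<open>s\<close> occurs there, because its fibre is nonempty
    and the corresponding fibre of \<open>\<Lambda>\<close> has the same size.\<close>
  let ?R = "\<Lambda> ` {n. \<Lambda> n \<le> s}"
  have R: "finite ?R" using fin by simp
  have "{n. 1 \<le> n \<and> ev n \<le> s} = (\<Union>t\<in>?R. {n. 1 \<le> n \<and> ev n = t})"
  proof (intro set_eqI iffI)
    fix n assume n: "n \<in> {n. 1 \<le> n \<and> ev n \<le> s}"
    then have "card {k. 1 \<le> k \<and> ev k = ev n} > 0" using ev(1)[of "ev n"] by (auto simp: card_gt_0_iff)
    then have "card {k. \<Lambda> k = ev n} > 0" using ev(2) by simp
    then obtain k where k: "\<Lambda> k = ev n" by (auto simp: card_gt_0_iff)
    have "\<Lambda> k \<in> ?R" using n k by (intro imageI) simp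
    then show "n \<in> (\<Union>t\<in>?R. {n. 1 \<le> n \<and> ev n = t})" using n k by (intro UN_I[of "\<Lambda> k"]) auto
  qed auto
  then have "card {n. 1 \<le> n \<and> ev n \<le> s} = (\<Sum>t\<in>?R. card {n. 1 \<le> n \<and> ev n = t})"
    using R ev(1) by (simp only:) (intro card_UN_disjoint, auto)
  also have "\<dots> = (\<Sum>t\<in>?R. card {n. \<Lambda> n = t})" using ev(2) by simp
  also have "\<dots> = card (\<Union>t\<in>?R. {n. \<Lambda> n = t})"
    using R fin_eq by (intro card_UN_disjoint[symmetric]) auto
  also have "(\<Union>t\<in>?R. {n. \<Lambda> n = t}) = {n. \<Lambda> n \<le> s}" by auto
  finally show ?thesis by (simp add: ev_def)
qed

lemma W1_eq_H1: "W1 \<Omega> = {(u, G). u \<in> H1 \<Omega> \<and> weak_gradient \<Omega> u G}"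
  by (auto simp: W1_def H1_def)

lemma W1_0_eq_H1_0: "open \<Omega> \<Longrightarrow> W1_0 \<Omega> = {(u, G). u \<in> H1_0 \<Omega> \<and> weak_gradient \<Omega> u G}"
  using W1_0_iff by auto

lemma neumann_count_eq:
  assumes es: "energy_space (W1 \<Omega>) (mass \<Omega>) (energy \<Omega>)"
    and eb: "energy_space.eigenbasis (W1 \<Omega>) (mass \<Omega>) (energy \<Omega>) w \<Lambda>"
  shows "neumann_count \<Omega> r = card {n. \<Lambda> n \<le> r\<^sup>2}"
  unfolding neumann_count_def neumann_eigenvalue_def neumann_laplacian_def
  using eigenvalue_multiplicity[OF W1_eq_H1 es eb]
    energy_space.eigenbasis_mono[OF es eb] energy_space.eigenbasis_finite[OF es eb]
  by (rule eigenvalue_sequence_count)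

lemma dirichlet_count_eq:
  assumes \<Omega>: "open \<Omega>" and es: "energy_space (W1_0 \<Omega>) (mass \<Omega>) (energy \<Omega>)"
    and eb: "energy_space.eigenbasis (W1_0 \<Omega>) (mass \<Omega>) (energy \<Omega>) w \<Lambda>"
  shows "dirichlet_count \<Omega> r = card {n. \<Lambda> n \<le> r\<^sup>2}"
  unfolding dirichlet_count_def dirichlet_eigenvalue_def dirichlet_laplacian_def
  using eigenvalue_multiplicity[OF W1_0_eq_H1_0[OF \<Omega>] es eb]
    energy_space.eigenbasis_mono[OF es eb] energy_space.eigenbasis_finite[OF es eb]
  by (rule eigenvalue_sequence_count)

lemma integral_over_tiles:
  fixes F :: "'a::euclidean_space \<Rightarrow> real"
  assumes fin: "finite \<T>" and disj: "disjoint \<T>" and T: "\<And>T. T \<in> \<T> \<Longrightarrow> T \<subseteq> \<Omega> \<and> T \<in> sets lebesgue"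
    and neg: "negligible (\<Omega> - \<Union>\<T>)" and \<Omega>: "\<Omega> \<in> sets lebesgue" and F: "integrable (lebesgue_on \<Omega>) F"
  shows "(LINT x|lebesgue_on \<Omega>. F x) = (\<Sum>T\<in>\<T>. (LINT x|lebesgue_on T. F x))"
proof -
  have FT: "integrable lebesgue (\<lambda>x. indicator T x *\<^sub>R F x)" if "T \<in> \<T>" for T
    using lebesgue_on_integrable_subset[OF F] T[OF that] \<Omega> by (simp add: integrable_restrict_space)
  have "(LINT x|lebesgue_on \<Omega>. F x) = (LINT x|lebesgue. indicator \<Omega> x *\<^sub>R F x)"
    using \<Omega> by (intro integral_restrict_space) auto
  also have "\<dots> = (LINT x|lebesgue. (\<Sum>T\<in>\<T>. indicator T x *\<^sub>R F x))"
  proof (rule integral_cong_AE)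
    show "(\<lambda>x. indicator \<Omega> x *\<^sub>R F x) \<in> borel_measurable lebesgue"
      using F \<Omega> by (auto simp: integrable_restrict_space dest: borel_measurable_integrable)
    show "(\<lambda>x. \<Sum>T\<in>\<T>. indicator T x *\<^sub>R F x) \<in> borel_measurable lebesgue"
      using FT by (intro borel_measurable_sum borel_measurable_integrable)
    have "AE x in lebesgue. x \<notin> \<Omega> - \<Union>\<T>" using neg unfolding negligible_iff_null_sets by (rule AE_not_in)
    then show "AE x in lebesgue. indicator \<Omega> x *\<^sub>R F x = (\<Sum>T\<in>\<T>. indicator T x *\<^sub>R F x)"
    proof eventually_elim
      case (elim x)
      show ?case
      proof (cases "x \<in> \<Omega>")
        case True
        then obtain T where T': "T \<in> \<T>" "x \<in> T" using elim by blast
        have "(\<Sum>S\<in>\<T>. indicator S x *\<^sub>R F x) = (\<Sum>S\<in>\<T>. if S = T then F x else 0)"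
          using T' disj by (intro sum.cong) (auto simp: indicator_def disjoint_def)
        then show ?thesis using True T' fin by simp
      next
        case False
        then have "(\<Sum>S\<in>\<T>. indicator S x *\<^sub>R F x) = 0" using T by (intro sum.neutral) (auto simp: indicator_def)
        then show ?thesis using False by simp
      qed
    qed
  qed
  also have "\<dots> = (\<Sum>T\<in>\<T>. (LINT x|lebesgue. indicator T x *\<^sub>R F x))"
    using FT by (intro Bochner_Integration.integral_sum)
  also have "\<dots> = (\<Sum>T\<in>\<T>. (LINT x|lebesgue_on T. F x))"
    using T by (intro sum.cong refl integral_restrict_space[symmetric]) auto
  finally show ?thesis .
qed

section \<open>Tilings\<close>

locale tiling =
  fixes \<Omega> \<Omega>' :: "'a::euclidean_space set" and \<T> :: "'a set set"
  assumes domain: "bounded_domain \<Omega>" and domain': "bounded_domain \<Omega>'"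
    and fin: "finite \<T>" and disj: "disjoint \<T>"
    and congruent: "T \<in> \<T> \<Longrightarrow> congruent_to \<Omega>' T" and subset: "T \<in> \<T> \<Longrightarrow> T \<subseteq> \<Omega>"
    and negligible_rest: "negligible (\<Omega> - \<Union>\<T>)"
begin

lemma \<Omega>: "open \<Omega>" "\<Omega> \<noteq> {}" "bounded \<Omega>" and \<Omega>': "open \<Omega>'" "\<Omega>' \<noteq> {}" "bounded \<Omega>'"
  using domain domain' by (auto simp: bounded_domain_def)

lemma sets_\<Omega>: "\<Omega> \<in> sets lebesgue" and sets_\<Omega>': "\<Omega>' \<in> sets lebesgue"
  using \<Omega> \<Omega>' by (auto simp: sets_completionI_sets)

lemma isometries_exist:
  "\<exists>c A B. \<forall>T\<in>\<T>. isometric_domains (c T) (A T) (B T) \<Omega>' T"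
proof -
  have "\<forall>T\<in>\<T>. \<exists>c A B. isometric_domains c A B \<Omega>' T"
    using congruent_to_isometric_domains[OF congruent \<Omega>'(1)] by blast
  then show ?thesis by metis
qed

lemma tile_open: "T \<in> \<T> \<Longrightarrow> open T"
  using isometries_exist isometric_domains.open2 by blast

lemma tile_sets: "T \<in> \<T> \<Longrightarrow> T \<subseteq> \<Omega> \<and> T \<in> sets lebesgue"
  using tile_open subset by (auto simp: sets_completionI_sets)

text \<open>Without tiles the nonempty open set \<open>\<Omega>\<close> would be negligible.
  Positivity allows the number of tiles to be cancelled at the end.\<close>

lemma card_pos: "card \<T> > 0"
proof -
  have "\<T> \<noteq> {}" using negligible_rest open_not_negligible[OF \<Omega>(1,2)] by auto
  then show ?thesis using fin by (simp add: card_gt_0_iff)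
qed

lemma tile_measure: "T \<in> \<T> \<Longrightarrow> measure lebesgue T = measure lebesgue \<Omega>'"
  using isometries_exist isometric_domains.measure_eq[symmetric] by blast

lemma measure_eq: "measure lebesgue \<Omega> = card \<T> * measure lebesgue \<Omega>'"
proof -
  have lm: "\<Omega> \<in> lmeasurable" using \<Omega> by (simp add: lmeasurable_open)
  have "integrable (lebesgue_on \<Omega>) (\<lambda>_. 1::real)"
    using finite_measure.integrable_const[OF finite_measure_lebesgue_on[OF lm]] .
  from integral_over_tiles[OF fin disj tile_sets negligible_rest sets_\<Omega> this]
  have "measure lebesgue \<Omega> = (\<Sum>T\<in>\<T>. measure lebesgue T)"
    using sets_\<Omega> tile_sets by (simp add: measure_restrict_space)
  also have "\<dots> = (\<Sum>T\<in>\<T>. measure lebesgue \<Omega>')"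
    using tile_measure by (intro sum.cong) auto
  finally show ?thesis by simp
qed

lemma dirichlet_count_le: "card \<T> * dirichlet_count \<Omega>' r \<le> dirichlet_count \<Omega> r"
proof -
  have es: "energy_space (W1_0 \<Omega>) (mass \<Omega>) (energy \<Omega>)" and es': "energy_space (W1_0 \<Omega>') (mass \<Omega>') (energy \<Omega>')"
    using energy_space_W1_0 \<Omega> \<Omega>' by auto
  interpret E: energy_space "W1_0 \<Omega>" "mass \<Omega>" "energy \<Omega>" by (rule es)
  interpret E': energy_space "W1_0 \<Omega>'" "mass \<Omega>'" "energy \<Omega>'" by (rule es')
  obtain w \<Lambda> where eb: "E.eigenbasis w \<Lambda>" using E.eigenbasis_exists by blast
  obtain w' \<Lambda>' where eb': "E'.eigenbasis w' \<Lambda>'" using E'.eigenbasis_exists by blast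
  obtain c A B where iso: "\<And>T. T \<in> \<T> \<Longrightarrow> isometric_domains (c T) (A T) (B T) \<Omega>' T"
    using isometries_exist by blast
  note inv = isometric_domains_inverse[OF iso]
  \<comment> \<open>Eigenpairs live on \<open>\<Omega>'\<close>, so carrying them to a tile is the
    pullback under the inverse isometry.\<close>
  define push where "push T = isometric_domains.pullback (- B T (c T)) (B T) (A T)" for T
  define W where "W = (\<lambda>(T, n). extension T (push T (w' n)))"
  define N' where "N' = {n. \<Lambda>' n \<le> r\<^sup>2}"
  have finN: "finite N'" unfolding N'_def by (rule E'.eigenbasis_finite[OF eb'])
  have w'L: "w' n \<in> L2_pairs \<Omega>'" for n
    using E'.eigenbasis_mem[OF eb'] by (auto simp: W1_0_def sobolev.adherence_def)
  have same: "mass \<Omega> (W (T, n)) (W (T, k)) = mass \<Omega>' (w' n) (w' k)"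
    "energy \<Omega> (W (T, n)) (W (T, k)) = energy \<Omega>' (w' n) (w' k)" if T: "T \<in> \<T>" for T n k
  proof -
    have "mass \<Omega> (W (T, n)) (W (T, k)) = mass T (push T (w' n)) (push T (w' k))"
      unfolding mass_def W_def case_prod_conv
      using tile_sets[OF T] sets_\<Omega> by (intro ip_extension) (auto simp: extension_def)
    also have "\<dots> = mass \<Omega>' (w' n) (w' k)"
      unfolding push_def by (rule isometric_domains.mass_pullback[OF inv[OF T] w'L w'L])
    finally show "mass \<Omega> (W (T, n)) (W (T, k)) = mass \<Omega>' (w' n) (w' k)" .
    have "energy \<Omega> (W (T, n)) (W (T, k)) = energy T (push T (w' n)) (push T (w' k))"
      unfolding energy_def W_def case_prod_conv
      using tile_sets[OF T] sets_\<Omega> by (intro ip_extension) (auto simp: extension_def)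
    also have "\<dots> = energy \<Omega>' (w' n) (w' k)"
      unfolding push_def by (rule isometric_domains.energy_pullback[OF inv[OF T] w'L w'L])
    finally show "energy \<Omega> (W (T, n)) (W (T, k)) = energy \<Omega>' (w' n) (w' k)" .
  qed
  \<comment> \<open>Functions from different tiles have disjoint supports, so both forms vanish on
    them.\<close>
  have diff: "mass \<Omega> (W (T, n)) (W (S, k)) = 0" "energy \<Omega> (W (T, n)) (W (S, k)) = 0"
    if "T \<in> \<T>" "S \<in> \<T>" "T \<noteq> S" for T S n k
  proof -
    have "T \<inter> S = {}" using disj that by (auto simp: disjoint_def)
    then have z: "fst (W (T, n)) x \<bullet> fst (W (S, k)) x = 0" "snd (W (T, n)) x \<bullet> snd (W (S, k)) x = 0" for x
      by (auto simp: W_def extension_def)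
    show "mass \<Omega> (W (T, n)) (W (S, k)) = 0" "energy \<Omega> (W (T, n)) (W (S, k)) = 0"
      unfolding mass_def energy_def ip_def z by simp_all
  qed
  have "card (\<T> \<times> N') \<le> card {n. \<Lambda> n \<le> r\<^sup>2}"
  proof (rule E.low_energy_family_card_le[OF eb, of _ W])
    show "finite (\<T> \<times> N')" using fin finN by simp
    fix i assume i: "i \<in> \<T> \<times> N'"
    then obtain T n where Tn: "i = (T, n)" "T \<in> \<T>" "\<Lambda>' n \<le> r\<^sup>2" by (auto simp: N'_def)
    show "W i \<in> W1_0 \<Omega>"
      unfolding Tn W_def case_prod_conv push_def
      by (intro extension_W1_0 tile_open subset \<Omega> Tn isometric_domains.pullback_W1_0[OF inv] E'.eigenbasis_mem[OF eb'])
    show "mass \<Omega> (W i) (W i) = 1" unfolding Tn using same(1)[OF Tn(2)] E'.eigenbasis_norm[OF eb'] by simp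
    show "energy \<Omega> (W i) (W i) \<le> r\<^sup>2"
      unfolding Tn using same(2)[OF Tn(2)] Tn(3) E'.eigenbasis_norm[OF eb']
        E'.eigenbasis_eigen[OF eb' E'.eigenbasis_mem[OF eb'], of n n] by simp
    \<comment> \<open>Within one tile, orthogonality in mass is that of the eigenbasis, and
      orthogonality in energy follows from it by the eigenvalue equation.\<close>
    fix j assume j: "j \<in> \<T> \<times> N'" "i \<noteq> j"
    then obtain S k where Sk: "j = (S, k)" "S \<in> \<T>" by auto
    show "mass \<Omega> (W i) (W j) = 0" "energy \<Omega> (W i) (W j) = 0"
      unfolding Tn Sk using diff[OF Tn(2) Sk(2)] same[OF Tn(2)] j(2) E'.eigenbasis_orth[OF eb', of n k]
        E'.eigenbasis_eigen[OF eb' E'.eigenbasis_mem[OF eb'], of n k] by (cases "T = S"; auto simp: Tn Sk)+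
  qed
  then show ?thesis
    by (simp add: dirichlet_count_eq[OF \<Omega>(1) es eb] dirichlet_count_eq[OF \<Omega>'(1) es' eb'] N'_def
        card_cartesian_product)
qed

lemma neumann_count_le:
  assumes "lipschitz_boundary \<Omega>" "lipschitz_boundary \<Omega>'"
  shows "neumann_count \<Omega> r \<le> card \<T> * neumann_count \<Omega>' r"
proof -
  have es: "energy_space (W1 \<Omega>) (mass \<Omega>) (energy \<Omega>)" and es': "energy_space (W1 \<Omega>') (mass \<Omega>') (energy \<Omega>')"
    using energy_space_W1 \<Omega> \<Omega>' assms by auto
  interpret E: energy_space "W1 \<Omega>" "mass \<Omega>" "energy \<Omega>" by (rule es)
  interpret E': energy_space "W1 \<Omega>'" "mass \<Omega>'" "energy \<Omega>'" by (rule es')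
  obtain w \<Lambda> where eb: "E.eigenbasis w \<Lambda>" using E.eigenbasis_exists by blast
  obtain w' \<Lambda>' where eb': "E'.eigenbasis w' \<Lambda>'" using E'.eigenbasis_exists by blast
  obtain c A B where iso: "\<And>T. T \<in> \<T> \<Longrightarrow> isometric_domains (c T) (A T) (B T) \<Omega>' T"
    using isometries_exist by blast
  define pull where "pull T = isometric_domains.pullback (c T) (A T) (B T)" for T
  define t where "t = r\<^sup>2"
  define N where "N = {n. \<Lambda> n \<le> t}"
  define N' where "N' = {n. \<Lambda>' n \<le> t}"
  have finN: "finite N" "finite N'" unfolding N_def N'_def
    by (rule E.eigenbasis_finite[OF eb], rule E'.eigenbasis_finite[OF eb'])
  \<comment> \<open>Elements of \<open>W1\<close> satisfy no boundary condition, so cutting along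
    tile boundaries stays inside the form domain of each tile.\<close>
  have restrict: "p \<in> W1 T" if T: "T \<in> \<T>" and p: "p \<in> W1 \<Omega>" for T p
    using weak_gradient_restrict[OF _ subset[OF T]] p tile_sets[OF T] sets_\<Omega> by (auto simp: W1_def)
  have pull_mem: "pull T p \<in> W1 \<Omega>'" if T: "T \<in> \<T>" and p: "p \<in> W1 \<Omega>" for T p
    unfolding pull_def by (rule isometric_domains.pullback_W1[OF iso[OF T] restrict[OF T p]])
  have TL: "p \<in> L2_pairs T" if "T \<in> \<T>" "p \<in> W1 \<Omega>" for T p using restrict[OF that] W1_subset by blast
  have "card N \<le> card (\<T> \<times> N')"
  proof (rule ccontr)
    assume "\<not> ?thesis"
    \<comment> \<open>One orthogonality condition for each tile and each low eigenfunction of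
      \<open>\<Omega>'\<close>; by assumption there are fewer conditions than coefficients.\<close>
    then obtain d where d: "\<exists>i\<in>N. d i \<noteq> 0"
      "\<forall>j\<in>\<T> \<times> N'. (\<Sum>i\<in>N. d i * (\<lambda>(T, k) i. mass \<Omega>' (pull T (w i)) (w' k)) j i) = 0"
      using homogeneous_system_nontrivial[of "\<T> \<times> N'" N "\<lambda>(T, k) i. mass \<Omega>' (pull T (w i)) (w' k)"] fin finN by auto
    define p where "p = (\<Sum>i\<in>N. d i *\<^sub>R w i)"
    have wX: "w i \<in> W1 \<Omega>" for i by (rule E.eigenbasis_mem[OF eb])
    have pX: "p \<in> W1 \<Omega>" unfolding p_def using E.m.X wX by (intro subspace_sum subspace_scale) auto
    have orth: "mass \<Omega>' (pull T p) (w' k) = 0" if T: "T \<in> \<T>" and k: "\<Lambda>' k \<le> t" for T k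
    proof -
      have "pull T p = (\<Sum>i\<in>N. d i *\<^sub>R pull T (w i))"
        unfolding p_def pull_def by (rule isometric_domains.pullback_sum[OF iso[OF T]])
      then have "mass \<Omega>' (pull T p) (w' k) = (\<Sum>i\<in>N. d i * mass \<Omega>' (pull T (w i)) (w' k))"
        using E'.m.sum_left[of N "\<lambda>i. pull T (w i)" "w' k" d] pull_mem[OF T wX] E'.eigenbasis_mem[OF eb'] by simp
      then show ?thesis using d(2) T k by (auto simp: N'_def)
    qed
    have mT: "mass \<Omega>' (pull T p) (pull T p) = mass T p p" "energy \<Omega>' (pull T p) (pull T p) = energy T p p" if T: "T \<in> \<T>" for T
      unfolding pull_def using isometric_domains.mass_pullback[OF iso[OF T] TL[OF T pX] TL[OF T pX]]
        isometric_domains.energy_pullback[OF iso[OF T] TL[OF T pX] TL[OF T pX]] by auto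
    have le: "t * mass T p p \<le> energy T p p" if T: "T \<in> \<T>" for T
      using E'.eigenbasis_le[OF eb' pull_mem[OF T pX], of t] orth[OF T] mT[OF T] by auto
    have less: "t * mass T p p < energy T p p" if T: "T \<in> \<T>" and "mass T p p > 0" for T
      using E'.eigenbasis_less[OF eb' pull_mem[OF T pX], of t] orth[OF T] mT[OF T] that by auto
    have pL: "fst p \<in> L2 (lebesgue_on \<Omega>)" "snd p \<in> L2 (lebesgue_on \<Omega>)" using subsetD[OF W1_subset pX] by (auto simp: mem_Times_iff)
    have mass_sum: "mass \<Omega> p p = (\<Sum>T\<in>\<T>. mass T p p)"
      unfolding mass_def ip_def
      by (rule integral_over_tiles[OF fin disj tile_sets negligible_rest sets_\<Omega> L2_inner_integrable[OF pL(1,1)]])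
    have energy_sum: "energy \<Omega> p p = (\<Sum>T\<in>\<T>. energy T p p)"
      unfolding energy_def ip_def
      by (rule integral_over_tiles[OF fin disj tile_sets negligible_rest sets_\<Omega> L2_inner_integrable[OF pL(2,2)]])
    have "mass \<Omega> p p = (\<Sum>i\<in>N. (d i)\<^sup>2 * mass \<Omega> (w i) (w i))"
      unfolding p_def using finN wX E.eigenbasis_orth[OF eb] by (intro E.m.orthogonal_sum) auto
    then have mp: "mass \<Omega> p p = (\<Sum>i\<in>N. (d i)\<^sup>2)" by (simp add: E.eigenbasis_norm[OF eb])
    have "energy \<Omega> p p = (\<Sum>i\<in>N. (d i)\<^sup>2 * energy \<Omega> (w i) (w i))"
      unfolding p_def using finN wX E.eigenbasis_orth[OF eb] E.eigenbasis_eigen[OF eb wX]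
      by (intro E.e.orthogonal_sum) auto
    also have "\<dots> \<le> (\<Sum>i\<in>N. t * (d i)\<^sup>2)"
      using E.eigenbasis_eigen[OF eb wX] E.eigenbasis_norm[OF eb]
      by (intro sum_mono) (auto simp: N_def mult.commute intro!: mult_right_mono)
    also have "\<dots> = t * mass \<Omega> p p" unfolding mp by (simp add: sum_distrib_left)
    finally have "energy \<Omega> p p \<le> t * mass \<Omega> p p" .
    moreover have "t * mass \<Omega> p p < energy \<Omega> p p"
    proof -
      have "mass \<Omega> p p > 0"
      proof -
        obtain i where "i \<in> N" "d i \<noteq> 0" using d(1) by blast
        then show ?thesis unfolding mp by (intro sum_pos2[OF finN(1)]) auto
      qed
      \<comment> \<open>Some tile carries positive mass, and there the inequality is strict. On the
        others the weak inequality suffices, so the sum over the tiles is strict.\<close>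
      then obtain T where T: "T \<in> \<T>" "mass T p p > 0"
        unfolding mass_sum by (metis not_less sum_nonpos)
      show ?thesis
        unfolding mass_sum energy_sum sum_distrib_left
        by (rule sum_strict_mono_ex1[OF fin]) (use le less[OF T] T(1) in auto)
    qed
    ultimately show False by simp
  qed
  then show ?thesis
    by (simp add: neumann_count_eq[OF es eb] neumann_count_eq[OF es' eb'] N_def N'_def t_def
        card_cartesian_product)
qed

lemma dirichlet_polya_tile: "dirichlet_polya \<Omega> \<Longrightarrow> dirichlet_polya \<Omega>'"
  unfolding dirichlet_polya_def
proof (intro allI impI)
  fix r :: real assume "0 \<le> r" and polya: "\<forall>r\<ge>0. real (dirichlet_count \<Omega> r) \<le> weyl_constant DIM('a) * measure lebesgue \<Omega> * r ^ DIM('a)"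
  let ?b = "weyl_constant DIM('a) * measure lebesgue \<Omega>' * r ^ DIM('a)"
  have "real (card \<T>) * real (dirichlet_count \<Omega>' r) \<le> real (dirichlet_count \<Omega> r)"
    using dirichlet_count_le[of r] by (simp flip: of_nat_mult)
  also have "\<dots> \<le> real (card \<T>) * ?b" using polya \<open>0 \<le> r\<close> by (simp add: measure_eq mult.assoc mult.left_commute)
  finally show "real (dirichlet_count \<Omega>' r) \<le> ?b" using card_pos by simp
qed

lemma neumann_polya_tile:
  assumes "lipschitz_boundary \<Omega>" "lipschitz_boundary \<Omega>'"
  shows "neumann_polya \<Omega> \<Longrightarrow> neumann_polya \<Omega>'"
  unfolding neumann_polya_def
proof (intro allI impI)
  fix r :: real assume "0 \<le> r" and polya: "\<forall>r\<ge>0. real (neumann_count \<Omega> r) \<ge> weyl_constant DIM('a) * measure lebesgue \<Omega> * r ^ DIM('a)"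
  let ?b = "weyl_constant DIM('a) * measure lebesgue \<Omega>' * r ^ DIM('a)"
  have "real (card \<T>) * ?b \<le> real (neumann_count \<Omega> r)" using polya \<open>0 \<le> r\<close> by (simp add: measure_eq mult.assoc mult.left_commute)
  also have "\<dots> \<le> real (card \<T>) * real (neumann_count \<Omega>' r)"
    using neumann_count_le[OF assms, of r] by (simp flip: of_nat_mult)
  finally show "?b \<le> real (neumann_count \<Omega>' r)" using card_pos by simp
qed

end

theorem theorem1p8:
  fixes \<Omega> \<Omega>' :: "'a::euclidean_space set"
  assumes "bounded_domain \<Omega>" and "bounded_domain \<Omega>'" and "tiles \<Omega>' \<Omega>"
  shows "(dirichlet_polya \<Omega> \<longrightarrow> dirichlet_polya \<Omega>') \<and>
    (lipschitz_boundary \<Omega> \<and> lipschitz_boundary \<Omega>' \<longrightarrow> neumann_polya \<Omega> \<longrightarrow> neumann_polya \<Omega>')"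
proof -
  obtain \<T> where "tiling \<Omega> \<Omega>' \<T>"
    using assms unfolding tiles_def tiling_def by blast
  then interpret tiling \<Omega> \<Omega>' \<T> .
  show ?thesis using dirichlet_polya_tile neumann_polya_tile by blast
qed

end
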